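(* Fix $0 < p \le r < 1$. Let $G_n \sim \mathcal{G}(n,p)$ be an Erdős–Rényi random graph on $n$ vertices with edge probability $p$, and let $\lambda_1(G_n)$ denote the largest eigenvalue of its adjacency matrix. (i) If $p \ge \left[1 + (r^{-1}-1)^{1/(1-2r)}\right]^{-1}$ then $$\lim_{n\to\infty} \frac{1}{\binom n2}\log \mathbb{P}\left(\lambda_1(G_n) \ge nr\right) = -h_p(r),$$ and furthermore, for every $\varepsilon>0$ there exists some $C = C(\varepsilon,p,r)>0$ such that for all $n$, $$\mathbb{P}\left(\delta_\square(G_n,r) < \varepsilon \,\middle|\, \lambda_1(G_n) \ge nr\right) \ge 1 - e^{-Cn^2}.$$ (ii) If $p < \left[1 + (r^{-1}-1)^{1/(1-2r)}\right]^{-1}$ then $$\lim_{n\to\infty} \frac{1}{\binom n2}\log \mathbb{P}\left(\lambda_1(G_n) \ge nr\right) > -h_p(r),$$ and furthermore, there exist $\varepsilon, C>0$ such that for all $n$, $$\mathbb{P}\left(\inf\{\delta_\square(G_n,s) : 0\le s\le 1\} > \varepsilon \,\middle|\, \lambda_1(G_n)\ge nr\right) \ge 1 - e^{-Cn^2}.$$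
   Context: For $p \in (0,1)$ and $x \in [0,1]$, $h_p(x) := x \log\frac{x}{p} + (1-x)\log\frac{1-x}{1-p}$ (with $0\log 0 = 0$). For a finite simple graph $G$ with vertex set $V(G)$ and edge set $E(G)$, and $r \in [0,1]$, $\delta_\square(G,r) := \sup_{A,B \subset V(G)} \frac{1}{|V(G)|^2}\big|e_G(A,B) - r|A||B|\big|$, where $e_G(A,B)$ is the number of pairs $(a,b)\in A\times B$ with $ab \in E(G)$. For $r = 1/2$ the expression $(r^{-1}-1)^{1/(1-2r)}$ is interpreted as its limit $e^2$ as $r \to 1/2$.
   Formalization: In (i) the conditional bound is proved for all sufficiently large n, since "for all n" fails (p = r = 1/2, n = 2, ε ≤ 1/8: the probability is 0); in (ii) it is for all n for which the conditioning event has positive probability. *)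

theory Defs
  imports
    "HOL-Probability.Probability"
    "HOL-Probability.Product_PMF"
    "Jordan_Normal_Form.Spectral_Radius"
begin

text \<open>
  A simple graph is given by its vertex set and a set of edges, each edge being a two-element
  set of vertices. Graphs on \<open>n\<close> vertices have vertex set \<open>{..<n}\<close>.
\<close>

definition all_pairs :: "nat \<Rightarrow> nat set set" where
  "all_pairs n = {e. e \<subseteq> {..<n} \<and> card e = 2}"

definition erdos_renyi :: "nat \<Rightarrow> real \<Rightarrow> nat set set pmf" where
  "erdos_renyi n p =
     map_pmf (\<lambda>f. {e \<in> all_pairs n. f e}) (Pi_pmf (all_pairs n) False (\<lambda>_. bernoulli_pmf p))"

definition adjacency_matrix :: "nat \<Rightarrow> nat set set \<Rightarrow> real mat" where
  "adjacency_matrix n E = Matrix.mat n n (\<lambda>(i, j). if {i, j} \<in> E then 1 else 0)"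

text \<open>
  The adjacency matrix is real symmetric, so its spectrum over the reals contains all its
  eigenvalues; it is nonempty for \<open>n > 0\<close>. For \<open>n = 0\<close> the value is unspecified.
\<close>

definition lambda1 :: "nat \<Rightarrow> nat set set \<Rightarrow> real" where
  "lambda1 n E = Max (spectrum (adjacency_matrix n E))"

text \<open>The convention \<open>0 log 0 = 0\<close> holds because multiplication by zero gives zero.\<close>

definition h :: "real \<Rightarrow> real \<Rightarrow> real" where
  "h p x = x * ln (x / p) + (1 - x) * ln ((1 - x) / (1 - p))"

definition edge_count :: "'a set set \<Rightarrow> 'a set \<Rightarrow> 'a set \<Rightarrow> nat" where
  "edge_count E A B = card {(a, b). a \<in> A \<and> b \<in> B \<and> {a, b} \<in> E}"

definition cut_dist :: "'a set \<Rightarrow> 'a set set \<Rightarrow> real \<Rightarrow> real" where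
  "cut_dist V E r =
     (SUP (A, B) \<in> Pow V \<times> Pow V.
        1 / (real (card V))\<^sup>2 * \<bar>real (edge_count E A B) - r * real (card A) * real (card B)\<bar>)"

text \<open>At \<open>r = 1/2\<close> the power takes its limiting value \<open>e\<^sup>2\<close>.\<close>

definition threshold :: "real \<Rightarrow> real" where
  "threshold r =
     inverse (1 + (if r = 1 / 2 then exp 2 else (inverse r - 1) powr (1 / (1 - 2 * r))))"

end

theory Submission
  imports Defs "HOL-Real_Asymp.Real_Asymp"
begin

text \<open>
  A top eigenvector of a graph with \<open>lambda1 n G \<ge> n r\<close> has entries at most \<open>1 / (r sqrt n)\<close>, and
  after rounding there are only \<open>exp (o (n\<^sup>2))\<close> of them. A union bound therefore replaces the
  eigenvalue event by the linear events \<open>y\<^sup>T G y \<ge> n r - 2\<close> for fixed \<open>y\<close>, and no regularity lemma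
  is needed. If \<open>h p x \<ge> h p r + c (x\<^sup>2 - r\<^sup>2)\<close> on \<open>[0, 1]\<close>, the exponential moment with weights
  \<open>2 c n r y\<^sub>i y\<^sub>j\<close> gives the upper bound \<open>exp (- (n choose 2) h p r)\<close> up to lower order factors;
  tilting in addition by the discrepancy of a pair of vertex sets gains a factor \<open>exp (- C n\<^sup>2)\<close> on
  the graphs far from \<open>r\<close>. The tangent condition is equivalent to \<open>p \<ge> threshold r\<close>, because
  \<open>h p\<close> plus a suitable multiple of \<open>x (1 - x)\<close> is symmetric under \<open>x \<mapsto> 1 - x\<close> up to an affine
  function. Below the threshold a thin strip of vertices of a different density
  is cheaper than the constant density \<open>r\<close>, while graphs close to a constant must have that constant
  at least about \<open>r\<close>, hence edge density at least about \<open>r\<close>, which costs \<open>h p r\<close>. The limit exists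
  because an optimal density on \<open>m\<close> vertices, obtained as the marginals of the conditioned measure,
  can be blown up to any larger number of vertices.
\<close>

section \<open>Finite products of Bernoulli measures\<close>

text \<open>Why a parabola: for a vector \<open>y\<close> of norm about 1 the numbers
  \<open>Y = n r y_i y_j\<close> satisfy: the sum of \<open>Y^2\<close> over all pairs is about
  \<open>n^2 r^2 / 2\<close>, whatever the shape of \<open>y\<close>. A bound of the logarithmic
  moment generating function by a constant plus \<open>c Y^2\<close> therefore costs the same for
  every candidate vector, and by Legendre duality the tangent condition is exactly such a bound. The
  bound \<open>1 / (r sqrt n)\<close> on the entries serves three purposes: the sum of
  \<open>y^4\<close> is O(1 / n), so the missing diagonal is negligible; \<open>Y\<close> stays in
  the compact interval from 0 to \<open>1 / r\<close>; and the rescaled vector lies in the unit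
  cube, where cuts control the quadratic form. Two obstacles shape the rest. At the threshold itself
  the parabola touches \<open>h p\<close> a second time at \<open>1 - r\<close>, so a zero deficit
  does not force the tilted density to be \<open>r\<close>. Below the threshold the value of the
  limit is not identified, so its existence needs an argument that compares different sizes; there a
  plain blow-up falls short of the eigenvalue bound by a rounding error and has to be
  repaired.\<close>

definition weight :: "'e set \<Rightarrow> ('e \<Rightarrow> real) \<Rightarrow> 'e set \<Rightarrow> real" where
  "weight E f G = (\<Prod>e\<in>E. if e \<in> G then f e else 1 - f e)"

definition prb :: "'e set \<Rightarrow> ('e \<Rightarrow> real) \<Rightarrow> ('e set \<Rightarrow> bool) \<Rightarrow> real" where
  "prb E f Q = (\<Sum>G | G \<subseteq> E \<and> Q G. weight E f G)"

lemma sum_subsets_prod: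
  fixes a b :: "'e \<Rightarrow> real"
  assumes "finite E"
  shows "(\<Sum>G\<in>Pow E. \<Prod>e\<in>E. if e \<in> G then a e else b e) = (\<Prod>e\<in>E. a e + b e)"
proof -
  have "(\<Prod>e\<in>E. if e \<in> G then a e else b e) = (\<Prod>e\<in>G. a e) * (\<Prod>e\<in>E-G. b e)"
    if "G \<in> Pow E" for G
  proof -
    have "E \<inter> G = G" "E \<inter> - G = E - G" using that by auto
    then show ?thesis
      using assms prod.If_cases[of E "\<lambda>e. e \<in> G" a b] by simp
  qed
  then show ?thesis
    using prod_add[OF assms, of a b] by simp
qed

lemma weight_nonneg:
  assumes "\<And>e. e \<in> E \<Longrightarrow> 0 \<le> f e \<and> f e \<le> 1"
  shows "0 \<le> weight E f G"
  unfolding weight_def using assms by (intro prod_nonneg) auto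

lemma weight_pos:
  assumes "\<And>e. e \<in> E \<Longrightarrow> 0 < f e \<and> f e < 1"
  shows "0 < weight E f G"
  unfolding weight_def using assms by (intro prod_pos) auto

lemma sum_weight:
  assumes "finite E"
  shows "(\<Sum>G\<in>Pow E. weight E f G) = 1"
  unfolding weight_def by (subst sum_subsets_prod[OF assms]) simp

lemma prb_nonneg:
  assumes "\<And>e. e \<in> E \<Longrightarrow> 0 \<le> f e \<and> f e \<le> 1"
  shows "0 \<le> prb E f Q"
  unfolding prb_def by (intro sum_nonneg weight_nonneg assms)

lemma prb_mono:
  assumes "finite E" "\<And>e. e \<in> E \<Longrightarrow> 0 \<le> f e \<and> f e \<le> 1"
    and "\<And>G. G \<subseteq> E \<Longrightarrow> Q G \<Longrightarrow> R G"
  shows "prb E f Q \<le> prb E f R"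
  unfolding prb_def
  by (intro sum_mono2 weight_nonneg) (use assms in auto)

lemma prb_True:
  assumes "finite E"
  shows "prb E f (\<lambda>_. True) = 1"
  using sum_weight[OF assms, of f] by (simp add: prb_def Pow_def)

lemma prb_le_1:
  assumes "finite E" "\<And>e. e \<in> E \<Longrightarrow> 0 \<le> f e \<and> f e \<le> 1"
  shows "prb E f Q \<le> 1"
proof -
  have "prb E f Q \<le> prb E f (\<lambda>_. True)" by (rule prb_mono) (use assms in auto)
  then show ?thesis using prb_True[OF assms(1), of f] by simp
qed

lemma prb_compl:
  assumes "finite E"
  shows "prb E f (\<lambda>G. \<not> Q G) = 1 - prb E f Q"
proof -
  have "prb E f (\<lambda>G. \<not> Q G) + prb E f Q
      = (\<Sum>G\<in>{G. G \<subseteq> E \<and> \<not> Q G} \<union> {G. G \<subseteq> E \<and> Q G}. weight E f G)"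
    unfolding prb_def using assms by (intro sum.union_disjoint[symmetric]) auto
  also have "{G. G \<subseteq> E \<and> \<not> Q G} \<union> {G. G \<subseteq> E \<and> Q G} = Pow E" by auto
  finally show ?thesis using sum_weight[OF assms, of f] by simp
qed

lemma prb_Bex_le:
  assumes "finite E" "finite I" "\<And>e. e \<in> E \<Longrightarrow> 0 \<le> f e \<and> f e \<le> 1"
  shows "prb E f (\<lambda>G. \<exists>i\<in>I. Q i G) \<le> (\<Sum>i\<in>I. prb E f (Q i))"
proof -
  let ?w = "weight E f"
  have w: "0 \<le> ?w G" for G using assms(3) by (rule weight_nonneg)
  have prb_if: "prb E f R = (\<Sum>G\<in>Pow E. if R G then ?w G else 0)" for R
    unfolding prb_def using assms(1) by (subst sum.inter_filter[symmetric]) (auto intro: sum.cong)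
  have "prb E f (\<lambda>G. \<exists>i\<in>I. Q i G) \<le> (\<Sum>G\<in>Pow E. \<Sum>i\<in>I. if Q i G then ?w G else 0)"
    unfolding prb_if
  proof (rule sum_mono)
    fix G
    show "(if \<exists>i\<in>I. Q i G then ?w G else 0) \<le> (\<Sum>i\<in>I. if Q i G then ?w G else 0)"
    proof (cases "\<exists>i\<in>I. Q i G")
      case True
      then obtain i where i: "i \<in> I" "Q i G" by blast
      have "(if Q i G then ?w G else 0) \<le> (\<Sum>i\<in>I. if Q i G then ?w G else 0)"
        using i(1) assms(2) w by (intro member_le_sum) auto
      then show ?thesis using True i by simp
    qed (use w in \<open>auto intro: sum_nonneg\<close>)
  qed
  also have "\<dots> = (\<Sum>i\<in>I. prb E f (Q i))" unfolding prb_if by (rule sum.swap)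
  finally show ?thesis .
qed

text \<open>Markov's inequality for an exponential whose expectation factorises over
  \<open>E\<close>. Separate weights \<open>u\<close> and \<open>v\<close> for present and absent
  elements allow centred sums, as in \<open>tilted_concentration\<close> and
  \<open>vector_tail\<close>.\<close>

lemma chernoff:
  assumes "finite E" "\<And>e. e \<in> E \<Longrightarrow> 0 \<le> f e \<and> f e \<le> 1"
    and Q: "\<And>G. G \<subseteq> E \<Longrightarrow> Q G \<Longrightarrow> s \<le> (\<Sum>e\<in>E. if e \<in> G then u e else v e)"
  shows "prb E f Q \<le> exp (- s) * (\<Prod>e\<in>E. f e * exp (u e) + (1 - f e) * exp (v e))"
proof -
  let ?s = "\<lambda>G. \<Sum>e\<in>E. if e \<in> G then u e else v e"
  have w: "0 \<le> weight E f G" for G using assms(2) by (rule weight_nonneg)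
  have "prb E f Q \<le> (\<Sum>G | G \<subseteq> E \<and> Q G. exp (- s) * (weight E f G * exp (?s G)))"
    unfolding prb_def
  proof (rule sum_mono)
    fix G assume "G \<in> {G. G \<subseteq> E \<and> Q G}"
    then have "1 \<le> exp (- s) * exp (?s G)" using Q[of G] by (simp add: exp_add[symmetric])
    then have "weight E f G * 1 \<le> weight E f G * (exp (- s) * exp (?s G))"
      using w by (intro mult_left_mono)
    then show "weight E f G \<le> exp (- s) * (weight E f G * exp (?s G))"
      by (simp add: mult.left_commute)
  qed
  also have "\<dots> \<le> (\<Sum>G\<in>Pow E. exp (- s) * (weight E f G * exp (?s G)))"
    using assms(1) w by (intro sum_mono2) auto
  also have "\<dots> = exp (- s) * (\<Sum>G\<in>Pow E. weight E f G * exp (?s G))"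
    by (rule sum_distrib_left[symmetric])
  also have "(\<Sum>G\<in>Pow E. weight E f G * exp (?s G))
      = (\<Prod>e\<in>E. f e * exp (u e) + (1 - f e) * exp (v e))"
  proof -
    have "weight E f G * exp (?s G)
        = (\<Prod>e\<in>E. if e \<in> G then f e * exp (u e) else (1 - f e) * exp (v e))" for G
    proof -
      have "exp (?s G) = (\<Prod>e\<in>E. exp (if e \<in> G then u e else v e))"
        by (rule exp_sum[OF assms(1)])
      then show ?thesis
        unfolding weight_def by (simp only: prod.distrib[symmetric]) (intro prod.cong, auto)
    qed
    then show ?thesis by (simp only: sum_subsets_prod[OF assms(1)])
  qed
  finally show ?thesis .
qed

lemma weight_marginal:
  fixes a b :: real
  assumes "finite E" "d \<in> E"
  shows "(\<Sum>G\<in>Pow E. weight E f G * (if d \<in> G then a else b)) = f d * a + (1 - f d) * b"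
proof -
  let ?a = "\<lambda>e. f e * (if e = d then a else 1)" and ?b = "\<lambda>e. (1 - f e) * (if e = d then b else 1)"
  have "weight E f G * (if d \<in> G then a else b) = (\<Prod>e\<in>E. if e \<in> G then ?a e else ?b e)"
    if "G \<in> Pow E" for G
  proof -
    have "(\<Prod>e\<in>E. if e \<in> G then ?a e else ?b e)
        = weight E f G * (\<Prod>e\<in>E. if e = d then (if d \<in> G then a else b) else 1)"
      unfolding weight_def prod.distrib[symmetric] by (intro prod.cong) auto
    then show ?thesis using assms by simp
  qed
  then have "(\<Sum>G\<in>Pow E. weight E f G * (if d \<in> G then a else b)) = (\<Prod>e\<in>E. ?a e + ?b e)"
    using sum_subsets_prod[OF assms(1), of ?a ?b] by simp
  also have "\<dots> = (\<Prod>e\<in>E. if e = d then f d * a + (1 - f d) * b else 1)"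
    by (intro prod.cong) auto
  finally show ?thesis using assms by simp
qed

section \<open>Relative entropy of product measures\<close>

definition log_ratio :: "real \<Rightarrow> real \<Rightarrow> bool \<Rightarrow> real" where
  "log_ratio p x b = (if b then ln (x / p) else ln ((1 - x) / (1 - p)))"

lemma weight_ratio:
  assumes "finite E" "0 < p" "p < 1" "\<And>e. e \<in> E \<Longrightarrow> 0 \<le> f e \<and> f e \<le> 1"
    and pos: "0 < weight E f G"
  shows "ln (weight E f G / weight E (\<lambda>_. p) G) = (\<Sum>e\<in>E. log_ratio p (f e) (e \<in> G))"
proof -
  have nz: "(if e \<in> G then f e else 1 - f e) \<noteq> 0" if "e \<in> E" for e
  proof
    assume "(if e \<in> G then f e else 1 - f e) = 0"
    then have "weight E f G = 0"
      unfolding weight_def using assms(1) that by (intro prod_zero) blast+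
    then show False using pos by simp
  qed
  have "weight E f G / weight E (\<lambda>_. p) G
      = (\<Prod>e\<in>E. (if e \<in> G then f e else 1 - f e) / (if e \<in> G then p else 1 - p))"
    unfolding weight_def by (simp add: prod_dividef)
  also have "ln \<dots> = (\<Sum>e\<in>E. ln ((if e \<in> G then f e else 1 - f e) / (if e \<in> G then p else 1 - p)))"
  proof (rule ln_prod)
    fix e assume "e \<in> E"
    then show "(if e \<in> G then f e else 1 - f e) / (if e \<in> G then p else 1 - p) \<noteq> 0"
      using nz[of e] assms(2,3) by auto
  qed (use assms in auto)
  also have "\<dots> = (\<Sum>e\<in>E. log_ratio p (f e) (e \<in> G))"
    by (intro sum.cong) (auto simp: log_ratio_def)
  finally show ?thesis .
qed

lemma relative_entropy_weight:
  assumes "finite E" "0 < p" "p < 1" "\<And>e. e \<in> E \<Longrightarrow> 0 \<le> f e \<and> f e \<le> 1"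
  shows "(\<Sum>G\<in>Pow E. weight E f G * ln (weight E f G / weight E (\<lambda>_. p) G)) = (\<Sum>e\<in>E. h p (f e))"
proof -
  have "(\<Sum>G\<in>Pow E. weight E f G * ln (weight E f G / weight E (\<lambda>_. p) G))
      = (\<Sum>G\<in>Pow E. \<Sum>e\<in>E. weight E f G * log_ratio p (f e) (e \<in> G))"
  proof (intro sum.cong refl)
    fix G assume "G \<in> Pow E"
    show "weight E f G * ln (weight E f G / weight E (\<lambda>_. p) G)
        = (\<Sum>e\<in>E. weight E f G * log_ratio p (f e) (e \<in> G))"
    proof (cases "weight E f G = 0")
      case False
      then have "0 < weight E f G" using weight_nonneg[OF assms(4), of E] by (simp add: less_le)
      then show ?thesis using weight_ratio[OF assms] by (simp add: sum_distrib_left)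
    qed simp
  qed
  also have "\<dots> = (\<Sum>e\<in>E. \<Sum>G\<in>Pow E. weight E f G * log_ratio p (f e) (e \<in> G))"
    by (rule sum.swap)
  also have "\<dots> = (\<Sum>e\<in>E. h p (f e))"
    unfolding log_ratio_def using assms by (intro sum.cong refl) (simp add: weight_marginal h_def)
  finally show ?thesis .
qed

lemma ln_ge_one_minus_inverse:
  fixes x :: real
  assumes "0 < x"
  shows "1 - 1 / x \<le> ln x"
  using ln_le_minus_one[of "1 / x"] assms by (simp add: ln_div)

text \<open>The convex function \<open>a * ln (a / b)\<close> of \<open>a\<close> lies above its
  tangent at \<open>a = \<rho> * b\<close>. With \<open>\<rho> = 1\<close> this gives Gibbs'
  inequality, with a general \<open>\<rho>\<close> the log-sum inequality.\<close>

lemma mult_ln_div_ge: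
  fixes a b \<rho> :: real
  assumes "0 \<le> a" "0 < b" "0 < \<rho>"
  shows "a * ln \<rho> + a - \<rho> * b \<le> a * ln (a / b)"
proof (cases "a = 0")
  case False
  then have a: "0 < a" using assms by simp
  have "1 - 1 / (a / (\<rho> * b)) \<le> ln (a / (\<rho> * b))"
    using a assms by (intro ln_ge_one_minus_inverse) simp
  also have "ln (a / (\<rho> * b)) = ln (a / b) - ln \<rho>"
    using a assms by (simp add: ln_div ln_mult)
  finally have "a * (1 - \<rho> * b / a) \<le> a * (ln (a / b) - ln \<rho>)"
    using a by (intro mult_left_mono) auto
  then show ?thesis using a by (simp add: algebra_simps)
qed (use assms in auto)

lemma relative_entropy_nonneg:
  assumes "0 < p" "p < 1" "0 \<le> x" "x \<le> 1"
  shows "0 \<le> h p x"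
  using mult_ln_div_ge[of x p 1] mult_ln_div_ge[of "1 - x" "1 - p" 1] assms by (simp add: h_def)

text \<open>Change of measure: the relative entropy between the two product measures is split over
  \<open>Q\<close> and its complement, and the log-sum inequality is applied on each part.\<close>

lemma tilting_lower_bound:
  assumes E: "finite E" and p: "0 < p" "p < 1" and f: "\<And>e. e \<in> E \<Longrightarrow> 0 \<le> f e \<and> f e \<le> 1"
    and q: "0 < prb E f Q"
  shows "0 < prb E (\<lambda>_. p) Q"
    and "- ((\<Sum>e\<in>E. h p (f e)) + 2) / prb E f Q \<le> ln (prb E (\<lambda>_. p) Q)"
proof -
  let ?q = "prb E f Q" and ?P = "prb E (\<lambda>_. p) Q"
  let ?a = "weight E f" and ?b = "weight E (\<lambda>_. p)"
  let ?A = "{G. G \<subseteq> E \<and> Q G}" and ?B = "{G. G \<subseteq> E \<and> \<not> Q G}"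
  have b: "0 < ?b G" for G using p by (intro weight_pos) auto
  have a: "0 \<le> ?a G" for G using f by (rule weight_nonneg)
  have ne: "?A \<noteq> {}"
  proof
    assume "?A = {}"
    then have "?q = 0" unfolding prb_def by (simp only: sum.empty)
    then show False using q by simp
  qed
  show P: "0 < ?P" unfolding prb_def using E ne b by (intro sum_pos) auto
  \<comment> \<open>With this tangent point \<open>?q - \<rho> * ?P\<close> vanishes, so summation
    over \<open>Q\<close> leaves only \<open>?q * ln \<rho>\<close>.\<close>
  define \<rho> where "\<rho> = ?q / ?P"
  have \<rho>: "0 < \<rho>" using P q by (simp add: \<rho>_def)
  have "prb E f (\<lambda>G. \<not> Q G) - prb E (\<lambda>_. p) (\<lambda>G. \<not> Q G) \<le> (\<Sum>G\<in>?B. ?a G * ln (?a G / ?b G))"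
    unfolding prb_def sum_subtractf[symmetric]
  proof (rule sum_mono)
    fix G
    show "?a G - ?b G \<le> ?a G * ln (?a G / ?b G)" using mult_ln_div_ge[of "?a G" "?b G" 1] a b by simp
  qed
  moreover have "- 1 \<le> prb E f (\<lambda>G. \<not> Q G) - prb E (\<lambda>_. p) (\<lambda>G. \<not> Q G)"
  proof -
    have "0 \<le> prb E f (\<lambda>G. \<not> Q G)" using f by (rule prb_nonneg)
    moreover have "prb E (\<lambda>_. p) (\<lambda>G. \<not> Q G) \<le> 1" using E p by (intro prb_le_1) auto
    ultimately show ?thesis by linarith
  qed
  moreover have "?q * ln ?q - ?q * ln ?P \<le> (\<Sum>G\<in>?A. ?a G * ln (?a G / ?b G))"
  proof -
    have "?q * ln ?q - ?q * ln ?P = ?q * ln \<rho> + ?q - \<rho> * ?P"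
      using P q by (simp add: \<rho>_def ln_div algebra_simps)
    also have "\<dots> = (\<Sum>G\<in>?A. ?a G * ln \<rho> + ?a G - \<rho> * ?b G)"
      unfolding prb_def sum.distrib sum_subtractf sum_distrib_left sum_distrib_right ..
    also have "\<dots> \<le> (\<Sum>G\<in>?A. ?a G * ln (?a G / ?b G))"
      using a b \<rho> by (intro sum_mono mult_ln_div_ge) auto
    finally show ?thesis .
  qed
  moreover have "(\<Sum>e\<in>E. h p (f e))
      = (\<Sum>G\<in>?A. ?a G * ln (?a G / ?b G)) + (\<Sum>G\<in>?B. ?a G * ln (?a G / ?b G))"
  proof -
    have "(\<Sum>e\<in>E. h p (f e)) = (\<Sum>G\<in>Pow E. ?a G * ln (?a G / ?b G))"
      by (rule relative_entropy_weight[OF E p f, symmetric])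
    also have "Pow E = ?A \<union> ?B" by auto
    also have "(\<Sum>G\<in>?A \<union> ?B. ?a G * ln (?a G / ?b G))
        = (\<Sum>G\<in>?A. ?a G * ln (?a G / ?b G)) + (\<Sum>G\<in>?B. ?a G * ln (?a G / ?b G))"
      using E by (intro sum.union_disjoint) auto
    finally show ?thesis .
  qed
  ultimately have 1: "?q * ln ?q - ?q * ln ?P - 1 \<le> (\<Sum>e\<in>E. h p (f e))" by linarith
  \<comment> \<open>The constant 2 in the claim consists of the 1 lost on the complement of
    \<open>Q\<close> and the 1 lost here.\<close>
  have "?q * ln ?q \<ge> - 1"
    using mult_ln_div_ge[of ?q 1 1] q by simp
  with 1 have "- ((\<Sum>e\<in>E. h p (f e)) + 2) \<le> ?q * ln ?P" by simp
  then show "- ((\<Sum>e\<in>E. h p (f e)) + 2) / ?q \<le> ln ?P"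
    using q by (simp add: divide_le_eq mult.commute)
qed

text \<open>Among all laws with given one-dimensional marginals the product law has the smallest
  relative entropy to \<open>weight E (\<lambda>_. p)\<close>; applied to that measure conditioned on \<open>Q\<close>.\<close>

lemma sum_marginal_entropy_le:
  assumes E: "finite E" and p: "0 < p" "p < 1" and P: "0 < prb E (\<lambda>_. p) Q"
  defines "f \<equiv> \<lambda>e. prb E (\<lambda>_. p) (\<lambda>G. Q G \<and> e \<in> G) / prb E (\<lambda>_. p) Q"
  shows "\<And>e. e \<in> E \<Longrightarrow> 0 \<le> f e \<and> f e \<le> 1"
    and "(\<Sum>e\<in>E. h p (f e)) \<le> - ln (prb E (\<lambda>_. p) Q)"
proof -
  let ?P = "prb E (\<lambda>_. p) Q" and ?b = "weight E (\<lambda>_. p)"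
  let ?A = "{G. G \<subseteq> E \<and> Q G}"
  define \<mu> where "\<mu> G = ?b G / ?P" for G
  have b: "0 < ?b G" for G using p by (intro weight_pos) auto
  then have \<mu>: "0 < \<mu> G" for G using P by (simp add: \<mu>_def)
  have sum_\<mu>: "(\<Sum>G\<in>?A. \<mu> G) = 1"
    using P by (simp add: \<mu>_def sum_divide_distrib[symmetric] prb_def)
  have f_eq: "f e = (\<Sum>G\<in>?A. \<mu> G * (if e \<in> G then 1 else 0))" for e
  proof -
    have "prb E (\<lambda>_. p) (\<lambda>G. Q G \<and> e \<in> G) = (\<Sum>G\<in>?A. if e \<in> G then ?b G else 0)"
      unfolding prb_def using E by (subst sum.inter_filter[symmetric]) (auto intro: sum.cong)
    then show ?thesis
      unfolding f_def \<mu>_def by (simp add: sum_divide_distrib) (intro sum.cong, auto)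
  qed
  have f1_eq: "1 - f e = (\<Sum>G\<in>?A. \<mu> G * (if e \<in> G then 0 else 1))" for e
  proof -
    have "1 - f e = (\<Sum>G\<in>?A. \<mu> G - \<mu> G * (if e \<in> G then 1 else 0))"
      unfolding f_eq sum_subtractf sum_\<mu> ..
    also have "\<dots> = (\<Sum>G\<in>?A. \<mu> G * (if e \<in> G then 0 else 1))"
      by (intro sum.cong) auto
    finally show ?thesis .
  qed
  show f01: "\<And>e. e \<in> E \<Longrightarrow> 0 \<le> f e \<and> f e \<le> 1"
  proof
    fix e
    show "0 \<le> f e" unfolding f_eq using \<mu> by (intro sum_nonneg) (auto intro: less_imp_le)
    have "0 \<le> 1 - f e" unfolding f1_eq using \<mu> by (intro sum_nonneg) (auto intro: less_imp_le)
    then show "f e \<le> 1" by simp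
  qed
  \<comment> \<open>On the support of the conditioned law the product of its marginals does not
    vanish, so the logarithm of the product may be split.\<close>
  have fac: "0 < (if e \<in> G then f e else 1 - f e)" if "G \<in> ?A" for e G
  proof (cases "e \<in> G")
    case True
    have "0 < f e" unfolding f_eq
      by (rule sum_pos2[OF _ that]) (use E \<mu> True in \<open>auto intro: less_imp_le\<close>)
    then show ?thesis using True by simp
  next
    case False
    have "0 < 1 - f e" unfolding f1_eq
      by (rule sum_pos2[OF _ that]) (use E \<mu> False in \<open>auto intro: less_imp_le\<close>)
    then show ?thesis using False by simp
  qed
  then have wf: "0 < weight E f G" if "G \<in> ?A" for G
    unfolding weight_def using that by (intro prod_pos) blast
  have "(\<Sum>G\<in>?A. \<mu> G) - (\<Sum>G\<in>?A. weight E f G) \<le> (\<Sum>G\<in>?A. \<mu> G * ln (\<mu> G / weight E f G))"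
    unfolding sum_subtractf[symmetric]
  proof (rule sum_mono)
    fix G assume "G \<in> ?A"
    then show "\<mu> G - weight E f G \<le> \<mu> G * ln (\<mu> G / weight E f G)"
      using mult_ln_div_ge[of "\<mu> G" "weight E f G" 1] \<mu>[of G] wf by simp
  qed
  moreover have "(\<Sum>G\<in>?A. weight E f G) \<le> 1"
  proof -
    have "prb E f Q \<le> 1" using E f01 by (rule prb_le_1)
    then show ?thesis by (simp only: prb_def)
  qed
  \<comment> \<open>This is the relative entropy of the conditioned law to the product of its
    marginals. Expanded, it equals \<open>- ln ?P\<close> minus the sum of all
    \<open>h p (f e)\<close>.\<close>
  ultimately have "0 \<le> (\<Sum>G\<in>?A. \<mu> G * ln (\<mu> G / weight E f G))"
    using sum_\<mu> by linarith
  also have "\<dots> = (\<Sum>G\<in>?A. \<mu> G * (- ln ?P) - (\<Sum>e\<in>E. \<mu> G * log_ratio p (f e) (e \<in> G)))"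
  proof (intro sum.cong refl)
    fix G assume G: "G \<in> ?A"
    have "ln (\<mu> G / weight E f G) = - ln ?P - ln (weight E f G / ?b G)"
      using wf[OF G] b[of G] P by (simp add: \<mu>_def ln_div ln_mult)
    also have "ln (weight E f G / ?b G) = (\<Sum>e\<in>E. log_ratio p (f e) (e \<in> G))"
      by (rule weight_ratio[OF E p f01 wf[OF G]])
    finally show "\<mu> G * ln (\<mu> G / weight E f G)
        = \<mu> G * (- ln ?P) - (\<Sum>e\<in>E. \<mu> G * log_ratio p (f e) (e \<in> G))"
      by (simp only: right_diff_distrib sum_distrib_left)
  qed
  also have "\<dots> = - ln ?P - (\<Sum>e\<in>E. \<Sum>G\<in>?A. \<mu> G * log_ratio p (f e) (e \<in> G))"
    unfolding sum_subtractf sum_distrib_right[symmetric] sum_\<mu> by (subst sum.swap) simp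
  also have "(\<Sum>e\<in>E. \<Sum>G\<in>?A. \<mu> G * log_ratio p (f e) (e \<in> G)) = (\<Sum>e\<in>E. h p (f e))"
  proof (intro sum.cong refl)
    fix e
    have "(\<Sum>G\<in>?A. \<mu> G * log_ratio p (f e) (e \<in> G))
        = (\<Sum>G\<in>?A. \<mu> G * (if e \<in> G then 1 else 0)) * ln (f e / p)
          + (\<Sum>G\<in>?A. \<mu> G * (if e \<in> G then 0 else 1)) * ln ((1 - f e) / (1 - p))"
      unfolding sum_distrib_right sum.distrib[symmetric]
      by (intro sum.cong) (auto simp: log_ratio_def)
    then show "(\<Sum>G\<in>?A. \<mu> G * log_ratio p (f e) (e \<in> G)) = h p (f e)"
      unfolding f_eq[symmetric] f1_eq[symmetric] h_def .
  qed
  finally show "(\<Sum>e\<in>E. h p (f e)) \<le> - ln ?P" by simp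
qed

text \<open>A linear lower bound valid throughout \<open>Q\<close> survives averaging over the
  measure conditioned on \<open>Q\<close>. This is what makes the marginals feasible densities in
  \<open>optimal_marginals_exist\<close>.\<close>

lemma conditional_mean_ge:
  fixes u :: "'e \<Rightarrow> real"
  assumes E: "finite E" and p: "0 < p" "p < 1" and P: "0 < prb E (\<lambda>_. p) Q"
    and Q: "\<And>G. G \<subseteq> E \<Longrightarrow> Q G \<Longrightarrow> t \<le> (\<Sum>e\<in>E. if e \<in> G then u e else 0)"
  shows "t \<le> (\<Sum>e\<in>E. u e * (prb E (\<lambda>_. p) (\<lambda>G. Q G \<and> e \<in> G) / prb E (\<lambda>_. p) Q))"
proof -
  let ?P = "prb E (\<lambda>_. p) Q" and ?b = "weight E (\<lambda>_. p)"
  let ?A = "{G. G \<subseteq> E \<and> Q G}"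
  have b: "0 < ?b G" for G using p by (intro weight_pos) auto
  have "t * ?P = (\<Sum>G\<in>?A. ?b G * t)" by (simp add: prb_def sum_distrib_right mult.commute sum_distrib_left)
  also have "\<dots> \<le> (\<Sum>G\<in>?A. ?b G * (\<Sum>e\<in>E. if e \<in> G then u e else 0))"
    using b Q by (intro sum_mono mult_left_mono) (auto intro: less_imp_le)
  also have "\<dots> = (\<Sum>e\<in>E. \<Sum>G\<in>?A. ?b G * (if e \<in> G then u e else 0))"
    unfolding sum_distrib_left by (rule sum.swap)
  also have "\<dots> = (\<Sum>e\<in>E. u e * prb E (\<lambda>_. p) (\<lambda>G. Q G \<and> e \<in> G))"
  proof (intro sum.cong refl)
    fix e
    have "prb E (\<lambda>_. p) (\<lambda>G. Q G \<and> e \<in> G) = (\<Sum>G\<in>?A. if e \<in> G then ?b G else 0)"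
      unfolding prb_def using E by (subst sum.inter_filter[symmetric]) (auto intro: sum.cong)
    then show "(\<Sum>G\<in>?A. ?b G * (if e \<in> G then u e else 0)) = u e * prb E (\<lambda>_. p) (\<lambda>G. Q G \<and> e \<in> G)"
      by (simp add: sum_distrib_left) (intro sum.cong, auto)
  qed
  finally have "t \<le> (\<Sum>e\<in>E. u e * prb E (\<lambda>_. p) (\<lambda>G. Q G \<and> e \<in> G)) / ?P"
    using P by (simp add: le_divide_eq)
  then show ?thesis by (simp add: sum_divide_distrib)
qed

section \<open>The random graph as a product measure\<close>

lemma finite_all_pairs: "finite (all_pairs n)"
  by (rule finite_subset[of _ "Pow {..<n}"]) (auto simp: all_pairs_def)

lemma card_all_pairs: "card (all_pairs n) = n choose 2"
  using n_subsets[of "{..<n}" 2] by (simp add: all_pairs_def)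

lemma prob_erdos_renyi:
  assumes "0 \<le> p" "p \<le> 1"
  shows "\<P>(G in erdos_renyi n p. Q G) = prb (all_pairs n) (\<lambda>_. p) Q"
proof -
  let ?E = "all_pairs n" and ?M = "Pi_pmf (all_pairs n) False (\<lambda>_. bernoulli_pmf p)"
  let ?S = "\<lambda>f. {e \<in> ?E. f e}"
  have E: "finite ?E" by (rule finite_all_pairs)
  have pmf: "pmf (erdos_renyi n p) G = weight ?E (\<lambda>_. p) G" if "G \<subseteq> ?E" for G
  proof -
    \<comment> \<open>On the support of \<open>?M\<close> all values outside \<open>?E\<close> are
      \<open>False\<close>, so there the preimage of \<open>G\<close> is a single point.\<close>
    have eq: "?S -` {G} \<inter> set_pmf ?M = {\<lambda>e. e \<in> G} \<inter> set_pmf ?M"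
      using that set_Pi_pmf_subset[OF E, of False "\<lambda>_. bernoulli_pmf p"] by auto
    have "pmf (erdos_renyi n p) G = measure ?M (?S -` {G})"
      unfolding erdos_renyi_def by (rule pmf_map)
    also have "\<dots> = measure ?M {\<lambda>e. e \<in> G}"
      unfolding measure_Int_set_pmf[of ?M "?S -` {G}", symmetric] eq measure_Int_set_pmf ..
    also have "\<dots> = pmf ?M (\<lambda>e. e \<in> G)" by (simp add: measure_pmf_single)
    also have "\<dots> = (\<Prod>e\<in>?E. pmf (bernoulli_pmf p) (e \<in> G))"
      using that by (intro pmf_Pi' E) auto
    also have "\<dots> = weight ?E (\<lambda>_. p) G"
      unfolding weight_def using assms by (intro prod.cong) auto
    finally show ?thesis .
  qed
  have sub: "set_pmf (erdos_renyi n p) \<subseteq> Pow ?E" unfolding erdos_renyi_def by auto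
  have "measure (erdos_renyi n p) {G. Q G} = measure (erdos_renyi n p) {G. G \<subseteq> ?E \<and> Q G}"
    by (rule measure_prob_cong_0) (use sub in \<open>auto simp: pmf_eq_0_set_pmf\<close>)
  also have "\<dots> = (\<Sum>G | G \<subseteq> ?E \<and> Q G. pmf (erdos_renyi n p) G)"
    using E by (intro measure_measure_pmf_finite) auto
  also have "\<dots> = prb ?E (\<lambda>_. p) Q"
    unfolding prb_def using pmf by (intro sum.cong) auto
  finally show ?thesis by simp
qed

section \<open>The largest eigenvalue\<close>

definition bil :: "nat \<Rightarrow> nat set set \<Rightarrow> (nat \<Rightarrow> real) \<Rightarrow> (nat \<Rightarrow> real) \<Rightarrow> real" where
  "bil n G x y = (\<Sum>i<n. \<Sum>j<n. if {i, j} \<in> G then x i * y j else 0)"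

text \<open>Edges are sets, while \<open>H\<close> need not be symmetric; \<open>Min\<close> and
  \<open>Max\<close> fix one orientation of each edge, and the second term is the reverse
  one.\<close>

lemma sum_ordered_pairs:
  fixes H :: "nat \<Rightarrow> nat \<Rightarrow> real"
  shows "(\<Sum>i<n. \<Sum>j<n. if i \<noteq> j then H i j else 0)
    = (\<Sum>e\<in>all_pairs n. H (Min e) (Max e) + H (Max e) (Min e))"
proof -
  let ?D = "{(i, j). i < n \<and> j < n \<and> i < j}" and ?D' = "{(i, j). i < n \<and> j < n \<and> j < i}"
  have fin: "finite ?D" "finite ?D'"
    by (rule finite_subset[of _ "{..<n} \<times> {..<n}"]; auto)+
  have "(\<Sum>i<n. \<Sum>j<n. if i \<noteq> j then H i j else 0)
      = (\<Sum>(i, j)\<in>{..<n} \<times> {..<n}. if i \<noteq> j then H i j else 0)"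
    by (simp add: sum.cartesian_product)
  also have "\<dots> = (\<Sum>(i, j)\<in>?D \<union> ?D'. H i j)"
    by (rule sum.mono_neutral_cong_right) (auto split: if_splits)
  also have "\<dots> = (\<Sum>(i, j)\<in>?D. H i j) + (\<Sum>(i, j)\<in>?D'. H i j)"
    using fin by (intro sum.union_disjoint) auto
  also have "(\<Sum>(i, j)\<in>?D'. H i j) = (\<Sum>(i, j)\<in>?D. H j i)"
    by (rule sum.reindex_bij_witness[of _ prod.swap prod.swap]) auto
  also have "(\<Sum>(i, j)\<in>?D. H i j) + (\<Sum>(i, j)\<in>?D. H j i) = (\<Sum>(i, j)\<in>?D. H i j + H j i)"
    by (simp add: sum.distrib case_prod_beta)
  also have "\<dots> = (\<Sum>e\<in>all_pairs n. H (Min e) (Max e) + H (Max e) (Min e))"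
  proof (rule sum.reindex_bij_witness[of _ "\<lambda>e. (Min e, Max e)" "\<lambda>(i, j). {i, j}"])
    fix e assume e: "e \<in> all_pairs n"
    then obtain a b where ab: "e = {a, b}" "a \<noteq> b" "a < n" "b < n"
      by (auto simp: all_pairs_def card_2_iff)
    then show "(case (Min e, Max e) of (i, j) \<Rightarrow> {i, j}) = e" "(Min e, Max e) \<in> ?D"
      by (cases "a < b"; auto simp: min_def max_def)+
  qed (auto simp: all_pairs_def card_2_iff min_def max_def)
  finally show ?thesis .
qed

lemma pair_Min_Max:
  assumes "e \<in> all_pairs n"
  shows "e = {Min e, Max e}" "Min e < Max e" "Max e < n"
proof -
  obtain a b where ab: "e = {a, b}" "a \<noteq> b" "a < n" "b < n"
    using assms by (auto simp: all_pairs_def card_2_iff)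
  then show "e = {Min e, Max e}" "Min e < Max e" "Max e < n"
    by (cases "a < b"; auto simp: min_def max_def)+
qed

lemma sum_ordered_pairs_sym:
  fixes F :: "nat set \<Rightarrow> real"
  shows "(\<Sum>i<n. \<Sum>j<n. if i \<noteq> j then F {i, j} else 0) = 2 * (\<Sum>e\<in>all_pairs n. F e)"
proof -
  have "F {Min e, Max e} + F {Max e, Min e} = 2 * F e" if "e \<in> all_pairs n" for e
  proof -
    have "{Min e, Max e} = e" "{Max e, Min e} = e"
      using pair_Min_Max(1)[OF that] by (metis insert_commute)+
    then show ?thesis by simp
  qed
  then show ?thesis
    by (simp add: sum_ordered_pairs[where H = "\<lambda>i j. F {i, j}"] sum_distrib_left)
qed

lemma prod_pair:
  fixes x :: "nat \<Rightarrow> real"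
  assumes "e \<in> all_pairs n"
  shows "prod x e = x (Min e) * x (Max e)"
proof -
  have "prod x e = prod x {Min e, Max e}"
    using arg_cong[OF pair_Min_Max(1)[OF assms], of "prod x"] .
  then show ?thesis using pair_Min_Max(2)[OF assms] by simp
qed

lemma bil_eq_sum_pairs:
  assumes "G \<subseteq> all_pairs n"
  shows "bil n G x y
    = (\<Sum>e\<in>all_pairs n. if e \<in> G then x (Min e) * y (Max e) + x (Max e) * y (Min e) else 0)"
proof -
  let ?H = "\<lambda>i j. if {i, j} \<in> G then x i * y j else 0"
  have "{i} \<notin> G" for i using assms by (auto simp: all_pairs_def)
  then have "bil n G x y = (\<Sum>i<n. \<Sum>j<n. if i \<noteq> j then ?H i j else 0)"
    unfolding bil_def by (intro sum.cong refl) auto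
  also have "\<dots> = (\<Sum>e\<in>all_pairs n. ?H (Min e) (Max e) + ?H (Max e) (Min e))"
    by (rule sum_ordered_pairs)
  also have "\<dots> = (\<Sum>e\<in>all_pairs n. if e \<in> G then x (Min e) * y (Max e) + x (Max e) * y (Min e) else 0)"
  proof (intro sum.cong refl)
    fix e assume "e \<in> all_pairs n"
    then have "{Min e, Max e} = e" "{Max e, Min e} = e"
      using pair_Min_Max(1) by (metis insert_commute)+
    then show "?H (Min e) (Max e) + ?H (Max e) (Min e)
        = (if e \<in> G then x (Min e) * y (Max e) + x (Max e) * y (Min e) else 0)"
      by simp
  qed
  finally show ?thesis .
qed

lemma quadratic_eq_sum_pairs:
  assumes "G \<subseteq> all_pairs n"
  shows "bil n G x x = (\<Sum>e\<in>all_pairs n. if e \<in> G then 2 * prod x e else 0)"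
  unfolding bil_eq_sum_pairs[OF assms] by (intro sum.cong refl) (simp add: prod_pair)

text \<open>Vectors are functions on all of \<open>nat\<close>. Confining the coordinates beyond
  \<open>n\<close> to the interval from -1 to 1 as well lets Tychonoff's theorem supply
  compactness.\<close>

lemma compact_unit_sphere_seq:
  "compact {x :: nat \<Rightarrow> real. (\<forall>i. \<bar>x i\<bar> \<le> 1) \<and> (\<Sum>i<n. (x i)\<^sup>2) = 1}"
proof -
  have "compactin (product_topology (\<lambda>_. euclidean) UNIV) (PiE UNIV (\<lambda>_. {-1..1::real}))"
    by (simp add: compactin_PiE)
  then have "compact (PiE UNIV (\<lambda>_::nat. {-1..1::real}))"
    by (simp add: euclidean_product_topology)
  moreover have "closed {x :: nat \<Rightarrow> real. (\<Sum>i<n. (x i)\<^sup>2) = 1}"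
    by (intro closed_Collect_eq continuous_intros) (rule continuous_on_product_coordinates)
  ultimately have "compact (PiE UNIV (\<lambda>_::nat. {-1..1::real}) \<inter> {x. (\<Sum>i<n. (x i)\<^sup>2) = 1})"
    by (rule compact_Int_closed)
  also have "PiE UNIV (\<lambda>_::nat. {-1..1::real}) \<inter> {x. (\<Sum>i<n. (x i)\<^sup>2) = 1}
      = {x. (\<forall>i. \<bar>x i\<bar> \<le> 1) \<and> (\<Sum>i<n. (x i)\<^sup>2) = 1}"
    by (auto simp: PiE_def Pi_def abs_le_iff)
  finally show ?thesis .
qed

lemma linear_coeff_zero:
  fixes a b :: real
  assumes "\<And>t. t * a + t\<^sup>2 * b \<le> 0"
  shows "a = 0"
proof (rule ccontr)
  assume a: "a \<noteq> 0"
  define s where "s = \<bar>b\<bar> + 1"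
  have s: "0 < s" "0 < s + b" by (auto simp: s_def)
  have "a / s * a + (a / s)\<^sup>2 * b = (a\<^sup>2 / s\<^sup>2) * (s + b)"
    using s by (simp add: field_simps power2_eq_square)
  also have "\<dots> > 0" using a s by (intro mult_pos_pos divide_pos_pos) auto
  finally show False using assms[of "a / s"] by simp
qed

text \<open>The maximum of the form on the unit sphere extends to all vectors by homogeneity.
  Perturbing the maximiser along one coordinate and comparing first-order terms gives the eigenvalue
  equation in that coordinate.\<close>

lemma quadratic_form_maximizer:
  fixes a :: "nat \<Rightarrow> nat \<Rightarrow> real"
  assumes n: "0 < n" and sym: "\<And>i j. a i j = a j i"
  obtains \<mu> z where "(\<Sum>i<n. (z i)\<^sup>2) = 1"
    "\<forall>i<n. (\<Sum>j<n. a i j * z j) = \<mu> * z i"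
    "\<forall>x. (\<Sum>i<n. \<Sum>j<n. a i j * (x i * x j)) \<le> \<mu> * (\<Sum>i<n. (x i)\<^sup>2)"
proof -
  let ?K = "{x :: nat \<Rightarrow> real. (\<forall>i. \<bar>x i\<bar> \<le> 1) \<and> (\<Sum>i<n. (x i)\<^sup>2) = 1}"
  let ?q = "\<lambda>x. \<Sum>i<n. \<Sum>j<n. a i j * (x i * x j)"
  let ?N = "\<lambda>x. \<Sum>i<n. (x i :: real)\<^sup>2"
  have "(\<Sum>i<n. (if i = 0 then 1 else 0 :: real)\<^sup>2) = 1"
    using n by (simp add: if_distrib[of "\<lambda>x. x\<^sup>2"] cong: if_cong)
  then have "(\<lambda>i. if i = 0 then 1 else 0) \<in> ?K" by auto
  then have ne: "?K \<noteq> {}" by (rule ex_in_conv[THEN iffD1, OF exI])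
  have cont: "continuous_on ?K ?q"
    by (intro continuous_intros) (auto intro: continuous_on_subset[OF continuous_on_product_coordinates])
  obtain z where z: "z \<in> ?K" and max: "\<And>x. x \<in> ?K \<Longrightarrow> ?q x \<le> ?q z"
    using continuous_attains_sup[OF compact_unit_sphere_seq ne cont] by blast
  define \<mu> where "\<mu> = ?q z"
  have le: "?q x \<le> \<mu> * ?N x" for x
  proof (cases "?N x = 0")
    case True
    then have "x i = 0" if "i < n" for i using that by (simp add: sum_nonneg_eq_0_iff)
    then have "?q x = 0" by simp
    then show ?thesis using True by simp
  next
    case False
    then have pos: "0 < ?N x" by (simp add: less_le sum_nonneg)
    define c where "c = sqrt (?N x)"
    have c: "0 < c" "c\<^sup>2 = ?N x" using pos by (simp_all add: c_def)
    define y where "y i = (if i < n then x i / c else 0)" for i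
    have "?N y = ?N x / c\<^sup>2"
      by (simp add: y_def power_divide sum_divide_distrib)
    then have Ny: "?N y = 1" using c(2) pos by simp
    have "\<bar>y i\<bar> \<le> 1" for i
    proof (cases "i < n")
      case True
      then have "(y i)\<^sup>2 \<le> ?N y" by (intro member_le_sum) auto
      then show ?thesis using Ny by (simp add: abs_square_le_1)
    qed (simp add: y_def)
    then have "?q y \<le> \<mu>" using max[of y] Ny by (simp add: \<mu>_def)
    moreover have "?q y = ?q x / c\<^sup>2"
      by (simp add: y_def sum_divide_distrib power2_eq_square)
    ultimately have "?q x / c\<^sup>2 \<le> \<mu>" by simp
    then have "?q x \<le> \<mu> * c\<^sup>2" using c(1) by (subst (asm) pos_divide_le_eq) simp_all
    then show ?thesis using c(2) by simp
  qed
  have ev: "(\<Sum>j<n. a i j * z j) = \<mu> * z i" if i: "i < n" for i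
  proof -
    let ?d = "\<lambda>k. if k = i then 1 else 0 :: real"
    define A where "A = (\<Sum>j<n. a i j * z j)"
    have 1: "?q (\<lambda>k. z k + t * ?d k) = ?q z + 2 * t * A + t\<^sup>2 * a i i" for t
    proof -
      have row: "(\<Sum>j<n. if k = i then f j else 0) = (if k = i then \<Sum>j<n. f j else 0)"
        for k and f :: "nat \<Rightarrow> real" by simp
      have "?q (\<lambda>k. z k + t * ?d k) = (\<Sum>k<n. \<Sum>j<n. a k j * (z k * z j)
          + (if j = i then t * (a k i * z k) else 0) + (if k = i then t * (a i j * z j) else 0)
          + (if k = i then if j = i then t\<^sup>2 * a i i else 0 else 0))"
        by (intro sum.cong refl) (simp add: algebra_simps power2_eq_square)
      also have "\<dots> = ?q z + t * (\<Sum>k<n. a k i * z k) + t * A + t\<^sup>2 * a i i"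
        using i unfolding sum.distrib row by (simp add: A_def sum_distrib_left)
      also have "(\<Sum>k<n. a k i * z k) = A" unfolding A_def by (subst sym) simp
      finally show ?thesis by (simp add: algebra_simps)
    qed
    have 2: "?N (\<lambda>k. z k + t * ?d k) = 1 + 2 * t * z i + t\<^sup>2" for t
    proof -
      have "?N (\<lambda>k. z k + t * ?d k) = (\<Sum>k<n. (z k)\<^sup>2 + (if k = i then 2 * t * z i + t\<^sup>2 else 0))"
        by (intro sum.cong refl) (simp add: algebra_simps power2_eq_square)
      also have "\<dots> = 1 + 2 * t * z i + t\<^sup>2" using z i by (simp add: sum.distrib)
      finally show ?thesis .
    qed
    have "t * (2 * (A - \<mu> * z i)) + t\<^sup>2 * (a i i - \<mu>) \<le> 0" for t
      using le[of "\<lambda>k. z k + t * ?d k"] unfolding 1 2 \<mu>_def[symmetric] by (simp add: algebra_simps)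
    then have "2 * (A - \<mu> * z i) = 0" by (rule linear_coeff_zero)
    then show ?thesis by (simp add: A_def)
  qed
  show thesis using z ev le by (intro that) auto
qed

text \<open>Connects \<open>Max\<close> over the spectrum with the Rayleigh quotient: the maximum of
  the form is itself an eigenvalue, and testing the form on any eigenvector shows that no eigenvalue
  exceeds it.\<close>

lemma lambda1_maximizer:
  assumes n: "0 < n"
  obtains z where "(\<Sum>i<n. (z i)\<^sup>2) = 1"
    "\<forall>i<n. (\<Sum>j<n. if {i, j} \<in> G then z j else 0) = lambda1 n G * z i"
    "\<forall>x. bil n G x x \<le> lambda1 n G * (\<Sum>i<n. (x i)\<^sup>2)"
proof -
  let ?A = "adjacency_matrix n G"
  let ?a = "\<lambda>i j. if {i, j} \<in> G then 1 else 0 :: real"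
  have A: "?A \<in> carrier_mat n n" by (simp add: adjacency_matrix_def)
  have sym: "?a i j = ?a j i" for i j by (simp add: insert_commute)
  obtain \<mu> z where z: "(\<Sum>i<n. (z i)\<^sup>2) = 1"
    and ev: "\<forall>i<n. (\<Sum>j<n. ?a i j * z j) = \<mu> * z i"
    and max: "\<forall>x. (\<Sum>i<n. \<Sum>j<n. ?a i j * (x i * x j)) \<le> \<mu> * (\<Sum>i<n. (x i)\<^sup>2)"
    by (rule quadratic_form_maximizer[OF n, of ?a, OF sym])
  have mult: "vec_index (?A *\<^sub>v v) i = (\<Sum>j<n. ?a i j * vec_index v j)"
    if "i < n" "v \<in> carrier_vec n" for v i
    using that by (auto simp: adjacency_matrix_def scalar_prod_def lessThan_atLeast0 intro!: sum.cong)
  have "eigenvector ?A (Matrix.vec n z) \<mu>"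
    unfolding eigenvector_def
  proof (intro conjI)
    show "Matrix.vec n z \<in> carrier_vec (dim_row ?A)" by (simp add: adjacency_matrix_def)
    show "Matrix.vec n z \<noteq> 0\<^sub>v (dim_row ?A)"
    proof
      assume "Matrix.vec n z = 0\<^sub>v (dim_row ?A)"
      then have "vec_index (Matrix.vec n z) i = vec_index (0\<^sub>v n) i" for i
        using A by simp
      then have "z i = 0" if "i < n" for i using that by (metis index_vec index_zero_vec(1))
      then show False using z by simp
    qed
    show "?A *\<^sub>v Matrix.vec n z = \<mu> \<cdot>\<^sub>v Matrix.vec n z"
    proof (rule eq_vecI)
      fix i assume "i < dim_vec (\<mu> \<cdot>\<^sub>v Matrix.vec n z)"
      then show "vec_index (?A *\<^sub>v Matrix.vec n z) i = vec_index (\<mu> \<cdot>\<^sub>v Matrix.vec n z) i"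
        using mult[of i "Matrix.vec n z"] ev by simp
    qed (simp add: adjacency_matrix_def)
  qed
  then have mem: "\<mu> \<in> spectrum ?A" by (auto simp: spectrum_def eigenvalue_def)
  have ub: "k \<le> \<mu>" if k: "k \<in> spectrum ?A" for k
  proof -
    have dim: "dim_row ?A = n" using A by (rule carrier_matD)
    obtain v where "eigenvector ?A v k"
      using k by (auto simp: spectrum_def eigenvalue_def)
    then have v: "v \<in> carrier_vec n" "v \<noteq> 0\<^sub>v n" "?A *\<^sub>v v = k \<cdot>\<^sub>v v"
      unfolding eigenvector_def dim by blast+
    have eq: "(\<Sum>j<n. ?a i j * vec_index v j) = k * vec_index v i" if "i < n" for i
      using mult[OF that v(1)] v that by simp
    have "(\<Sum>i<n. \<Sum>j<n. ?a i j * (vec_index v i * vec_index v j))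
        = (\<Sum>i<n. vec_index v i * (\<Sum>j<n. ?a i j * vec_index v j))"
      unfolding sum_distrib_left by (intro sum.cong refl) simp
    also have "\<dots> = (\<Sum>i<n. vec_index v i * (k * vec_index v i))"
      by (intro sum.cong refl) (simp only: eq lessThan_iff)
    also have "\<dots> = k * (\<Sum>i<n. (vec_index v i)\<^sup>2)"
      unfolding sum_distrib_left by (intro sum.cong refl) (simp add: power2_eq_square)
    finally have 1: "k * (\<Sum>i<n. (vec_index v i)\<^sup>2) \<le> \<mu> * (\<Sum>i<n. (vec_index v i)\<^sup>2)"
      using spec[OF max, of "vec_index v"] by linarith
    have "\<exists>i<n. vec_index v i \<noteq> 0"
    proof (rule ccontr)
      assume "\<not> ?thesis"
      then have "v = 0\<^sub>v n" using v(1) by (intro eq_vecI) auto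
      then show False using v(2) by simp
    qed
    then obtain i where "i < n" "vec_index v i \<noteq> 0" by blast
    then have "0 < (\<Sum>i<n. (vec_index v i)\<^sup>2)" by (intro sum_pos2[of _ i]) auto
    then show ?thesis using 1 by simp
  qed
  have "lambda1 n G = \<mu>"
    unfolding lambda1_def using card_finite_spectrum(1)[OF A] mem ub by (intro Max_eqI) auto
  moreover have "(\<Sum>j<n. ?a i j * y j) = (\<Sum>j<n. if {i, j} \<in> G then y j else 0)" for i and y :: "nat \<Rightarrow> real"
    by (intro sum.cong refl) simp
  moreover have "(\<Sum>i<n. \<Sum>j<n. ?a i j * (x i * x j)) = bil n G x x" for x
    unfolding bil_def by (intro sum.cong refl) simp
  ultimately show thesis using z ev max by (intro that[of z]) auto
qed

lemma lambda1_ge: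
  assumes "0 < n" and "r * (\<Sum>i<n. (x i)\<^sup>2) \<le> bil n G x x" and "0 < (\<Sum>i<n. (x i)\<^sup>2)"
  shows "r \<le> lambda1 n G"
proof -
  have "bil n G x x \<le> lambda1 n G * (\<Sum>i<n. (x i)\<^sup>2)"
    by (rule lambda1_maximizer[OF assms(1), of G]) blast
  with assms(2) have "r * (\<Sum>i<n. (x i)\<^sup>2) \<le> lambda1 n G * (\<Sum>i<n. (x i)\<^sup>2)" by linarith
  then show ?thesis using assms(3) by simp
qed

text \<open>The entrywise absolute value of a top eigenvector; its entries are at most
  \<open>sqrt n / lambda1 n G\<close> by Cauchy--Schwarz.\<close>

lemma nonneg_top_vector:
  assumes n: "0 < n" and r: "0 < r" "real n * r \<le> lambda1 n G"
  obtains z where "(\<Sum>i<n. (z i)\<^sup>2) = 1" "\<forall>i. 0 \<le> z i" "real n * r \<le> bil n G z z"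
    "\<forall>i<n. z i \<le> 1 / (r * sqrt n)"
proof -
  obtain v where v: "(\<Sum>i<n. (v i)\<^sup>2) = 1"
    and ev: "\<forall>i<n. (\<Sum>j<n. if {i, j} \<in> G then v j else 0) = lambda1 n G * v i"
    and "\<forall>x. bil n G x x \<le> lambda1 n G * (\<Sum>i<n. (x i)\<^sup>2)"
    by (rule lambda1_maximizer[OF n, of G])
  define z where "z i = \<bar>v i\<bar>" for i
  have nr: "0 < real n * r" using n r by simp
  then have l: "0 < lambda1 n G" using r by linarith
  have z1: "(\<Sum>i<n. (z i)\<^sup>2) = 1" using v by (simp add: z_def)
  have "lambda1 n G = lambda1 n G * (\<Sum>i<n. (v i)\<^sup>2)" using v by simp
  also have "\<dots> = (\<Sum>i<n. v i * (lambda1 n G * v i))"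
    unfolding sum_distrib_left by (intro sum.cong refl) (simp add: power2_eq_square)
  also have "\<dots> = (\<Sum>i<n. v i * (\<Sum>j<n. if {i, j} \<in> G then v j else 0))"
    using ev by simp
  also have "\<dots> = bil n G v v"
    unfolding bil_def sum_distrib_left by (intro sum.cong refl) auto
  \<comment> \<open>The matrix has nonnegative entries, so absolute values can only increase the
    form.\<close>
  also have "\<dots> \<le> bil n G z z"
    unfolding bil_def z_def by (intro sum_mono) (auto simp: abs_mult[symmetric])
  finally have 1: "real n * r \<le> bil n G z z" using r by simp
  have "(\<Sum>j<n. z j)\<^sup>2 \<le> (\<Sum>j<n. (1::real)\<^sup>2) * (\<Sum>j<n. (z j)\<^sup>2)"
    using Cauchy_Schwarz_ineq_sum[of "\<lambda>_. 1" z "{..<n}"] by simp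
  then have "(\<Sum>j<n. z j)\<^sup>2 \<le> real n" using z1 by simp
  then have cs: "(\<Sum>j<n. z j) \<le> sqrt n" by (rule real_le_rsqrt)
  have 2: "z i \<le> 1 / (r * sqrt n)" if i: "i < n" for i
  proof -
    have "real n * r * z i \<le> lambda1 n G * z i" using r by (simp add: z_def mult_right_mono)
    also have "\<dots> = \<bar>\<Sum>j<n. if {i, j} \<in> G then v j else 0\<bar>"
      using ev i l by (simp add: z_def abs_mult)
    also have "\<dots> \<le> (\<Sum>j<n. \<bar>if {i, j} \<in> G then v j else 0\<bar>)" by (rule sum_abs)
    also have "\<dots> \<le> (\<Sum>j<n. z j)" unfolding z_def by (intro sum_mono) auto
    also have "\<dots> \<le> sqrt n" by (rule cs)
    finally have "z i \<le> sqrt n / (real n * r)" using nr by (simp add: le_divide_eq mult.commute)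
    also have "\<dots> = 1 / (r * sqrt n)"
      using n r by (simp add: field_simps)
    finally show ?thesis .
  qed
  show thesis by (rule that[of z]) (use z1 1 2 in \<open>auto simp: z_def\<close>)
qed

text \<open>Rounding the entries of the top vector down to multiples of \<open>1 / n\<^sup>2\<close> leaves only
  \<open>exp (o (n\<^sup>2))\<close> candidate vectors and changes the quadratic form by at most 2.\<close>

definition grid :: "nat \<Rightarrow> (nat \<Rightarrow> real) set" where
  "grid n = PiE {..<n} (\<lambda>_. (\<lambda>k. real k / (real n)\<^sup>2) ` {..n\<^sup>2})"

text \<open>The conditions on \<open>y\<close> alone belong to the event, so any graph in it
  certifies them and a vector violating them gives an empty event. The slacks \<open>2 / n\<close>
  and \<open>2\<close> are rounding errors.\<close>

definition grid_event :: "real \<Rightarrow> nat \<Rightarrow> (nat \<Rightarrow> real) \<Rightarrow> nat set set \<Rightarrow> bool" where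
  "grid_event r n y G \<longleftrightarrow> (\<forall>i<n. 0 \<le> y i \<and> y i \<le> 1 / (r * sqrt n))
     \<and> (\<Sum>i<n. (y i)\<^sup>2) \<le> 1 \<and> 1 - 2 / real n \<le> (\<Sum>i<n. (y i)\<^sup>2)
     \<and> real n * r - 2 \<le> bil n G y y"

lemma finite_grid: "finite (grid n)"
  unfolding grid_def by (intro finite_PiE) auto

lemma card_grid_le: "card (grid n) \<le> (n\<^sup>2 + 1) ^ n"
proof -
  have "card (grid n) = card ((\<lambda>k. real k / (real n)\<^sup>2) ` {..n\<^sup>2}) ^ n"
    unfolding grid_def by (simp add: card_PiE)
  also have "\<dots> \<le> card {..n\<^sup>2} ^ n" by (intro power_mono card_image_le) auto
  finally show ?thesis by simp
qed

lemma grid_vector_exists: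
  assumes n: "0 < n" and r: "0 < r" "real n * r \<le> lambda1 n G"
  shows "\<exists>y\<in>grid n. grid_event r n y G"
proof -
  obtain z where z: "(\<Sum>i<n. (z i)\<^sup>2) = 1" "\<forall>i. 0 \<le> z i" "real n * r \<le> bil n G z z"
    "\<forall>i<n. z i \<le> 1 / (r * sqrt n)"
    by (rule nonneg_top_vector[OF assms])
  have z1: "z i \<le> 1" if "i < n" for i
  proof -
    have "(z i)\<^sup>2 \<le> (\<Sum>i<n. (z i)\<^sup>2)" using that by (intro member_le_sum) auto
    then show ?thesis using z(1,2) by (simp add: power_le_one_iff)
  qed
  let ?m = "(real n)\<^sup>2"
  have m: "0 < ?m" using n by simp
  \<comment> \<open>Rounding down, not to the nearest point, preserves the upper bounds on the
    entries and on the norm.\<close>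
  define y where "y = (\<lambda>i\<in>{..<n}. real (nat \<lfloor>?m * z i\<rfloor>) / ?m)"
  have y_le: "0 \<le> y i \<and> y i \<le> z i \<and> z i \<le> y i + 1 / ?m" if "i < n" for i
  proof -
    have "0 \<le> ?m * z i" using z(2) by simp
    then have "real (nat \<lfloor>?m * z i\<rfloor>) \<le> ?m * z i" "?m * z i \<le> real (nat \<lfloor>?m * z i\<rfloor>) + 1"
      by linarith+
    then show ?thesis using m that by (simp add: y_def field_simps)
  qed
  have "y \<in> grid n"
    unfolding grid_def
  proof (rule PiE_I)
    fix i assume "i \<in> {..<n}"
    then have i: "i < n" by simp
    have "?m * z i \<le> real (n\<^sup>2)" using z1[OF i] m by simp
    then have "\<lfloor>?m * z i\<rfloor> \<le> \<lfloor>real (n\<^sup>2)\<rfloor>" by (rule floor_mono)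
    then have "nat \<lfloor>?m * z i\<rfloor> \<le> n\<^sup>2" unfolding floor_of_nat by (simp only: nat_le_iff)
    then show "y i \<in> (\<lambda>k. real k / ?m) ` {..n\<^sup>2}" using i by (auto simp: y_def)
  qed (simp add: y_def)
  have diff: "z i * z j - y i * y j \<le> 2 / ?m" if "i < n" "j < n" for i j
  proof -
    have "z i * z j - y i * y j = z i * (z j - y j) + (z i - y i) * y j" by (simp add: algebra_simps)
    also have "\<dots> \<le> 1 * (1 / ?m) + (1 / ?m) * 1"
      using y_le[OF that(1)] y_le[OF that(2)] z1[OF that(1)] z1[OF that(2)] z(2)
      by (intro add_mono mult_mono) auto
    finally show ?thesis by simp
  qed
  have sq_le: "(\<Sum>i<n. (y i)\<^sup>2) \<le> 1"
  proof -
    have "(\<Sum>i<n. (y i)\<^sup>2) \<le> (\<Sum>i<n. (z i)\<^sup>2)" using y_le by (intro sum_mono power_mono) auto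
    then show ?thesis using z(1) by simp
  qed
  have sq_ge: "1 - 2 / real n \<le> (\<Sum>i<n. (y i)\<^sup>2)"
  proof -
    have "(\<Sum>i<n. (z i)\<^sup>2) - (\<Sum>i<n. (y i)\<^sup>2) = (\<Sum>i<n. z i * z i - y i * y i)"
      by (simp add: sum_subtractf power2_eq_square)
    also have "\<dots> \<le> (\<Sum>i<n. 2 / ?m)" using diff by (intro sum_mono) auto
    also have "\<dots> = 2 / real n" by (simp add: power2_eq_square)
    finally show ?thesis using z(1) by simp
  qed
  have form: "real n * r - 2 \<le> bil n G y y"
  proof -
    have "bil n G z z - bil n G y y
        = (\<Sum>i<n. \<Sum>j<n. (if {i, j} \<in> G then z i * z j - y i * y j else 0))"
      unfolding bil_def sum_subtractf[symmetric] by (intro sum.cong refl) auto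
    also have "\<dots> \<le> (\<Sum>i<n. \<Sum>j<n. 2 / ?m)" using diff m by (intro sum_mono) auto
    also have "\<dots> = 2" using n by (simp add: power2_eq_square)
    finally show ?thesis using z(3) by simp
  qed
  have "grid_event r n y G"
    unfolding grid_event_def using y_le z(4) sq_le sq_ge form by (meson order_trans)
  then show ?thesis using \<open>y \<in> grid n\<close> by blast
qed

section \<open>Lower bounds by change of measure\<close>

definition eig_prob :: "real \<Rightarrow> real \<Rightarrow> nat \<Rightarrow> real" where
  "eig_prob p r n = prb (all_pairs n) (\<lambda>_. p) (\<lambda>G. real n * r \<le> lambda1 n G)"

section \<open>Exponential moments of Bernoulli variables\<close>

lemma exp_le_quadratic:
  fixes t :: real
  assumes "\<bar>t\<bar> \<le> 1"
  shows "exp t \<le> 1 + t + t\<^sup>2"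
proof (cases "0 \<le> t")
  case True
  then show ?thesis using assms by (intro exp_bound) auto
next
  case False
  then have "exp t * (1 - t) \<le> exp t * exp (- t)"
    using exp_ge_add_one_self[of "- t"] by (intro mult_left_mono) auto
  also have "\<dots> = 1" by (simp add: exp_minus)
  also have "1 \<le> (1 + t + t\<^sup>2) * (1 - t)"
  proof -
    have "t * t\<^sup>2 \<le> 0" using False by (intro mult_nonpos_nonneg) auto
    then show ?thesis by (simp add: algebra_simps power2_eq_square)
  qed
  finally show ?thesis using False by simp
qed

lemma bernoulli_mgf_le:
  fixes x t :: real
  assumes "0 \<le> x" "x \<le> 1" "\<bar>t\<bar> \<le> 1"
  shows "x * exp t + (1 - x) \<le> exp (x * t + t\<^sup>2)"
proof -
  have "x * exp t + (1 - x) \<le> x * (1 + t + t\<^sup>2) + (1 - x)"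
    using mult_left_mono[OF exp_le_quadratic[OF assms(3)] assms(1)] by simp
  also have "\<dots> = 1 + (x * t + x * t\<^sup>2)" by (simp add: algebra_simps)
  also have "\<dots> \<le> 1 + (x * t + 1 * t\<^sup>2)" using mult_right_mono[of x 1 "t\<^sup>2"] assms by simp
  also have "\<dots> \<le> exp (x * t + t\<^sup>2)" using exp_ge_add_one_self[of "x * t + t\<^sup>2"] by simp
  finally show ?thesis .
qed

lemma real_choose_two: "real (n choose 2) = real n * (real n - 1) / 2"
proof -
  have "even (n * (n - 1))" by (cases n) auto
  then have "2 * (n choose 2) = n * (n - 1)" unfolding choose_two by (rule dvd_mult_div_cancel)
  then have "2 * real (n choose 2) = real n * real (n - 1)"
    by (metis of_nat_mult of_nat_numeral)
  then show ?thesis by (cases n) simp_all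
qed

lemma choose_two_le: "real (n choose 2) \<le> (real n)\<^sup>2 / 2"
proof -
  have "real n * (real n - 1) / 2 \<le> real n * real n / 2"
    by (intro divide_right_mono mult_left_mono) auto
  then show ?thesis by (simp add: real_choose_two power2_eq_square)
qed

text \<open>The mean of the form exceeds the target by \<open>\<tau> n^2\<close>, and a Chernoff
  bound of strength \<open>\<theta>\<close> controls the lower tail. The first bound on
  \<open>\<theta>\<close> keeps the weights below 1; the second makes each variance term at most
  \<open>\<theta> * \<tau>\<close>, so that about \<open>n^2 / 2\<close> pairs use up half of the
  gain \<open>\<theta> * \<tau> * n^2\<close>.\<close>

lemma tilted_concentration:
  assumes M: "0 < M" "\<And>i. i < n \<Longrightarrow> 0 \<le> x i \<and> x i \<le> M"
    and f: "\<And>e. e \<in> all_pairs n \<Longrightarrow> 0 \<le> f e \<and> f e \<le> 1" and n: "0 < n" and \<tau>: "0 < \<tau>"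
    and gap: "r * real n * (\<Sum>i<n. (x i)\<^sup>2) + \<tau> * (real n)\<^sup>2 \<le> 2 * (\<Sum>e\<in>all_pairs n. f e * prod x e)"
    and \<theta>: "0 < \<theta>" "\<theta> \<le> 1 / (2 * M\<^sup>2)" "\<theta> \<le> \<tau> / (4 * M ^ 4)"
  shows "1 - exp (- (\<theta> * \<tau> / 2 * (real n)\<^sup>2)) \<le> prb (all_pairs n) f (\<lambda>G. real n * r \<le> lambda1 n G)"
proof -
  let ?E = "all_pairs n"
  have x_pos: "0 < (\<Sum>i<n. (x i)\<^sup>2)"
  proof (rule ccontr)
    assume "\<not> ?thesis"
    then have z: "(\<Sum>i<n. (x i)\<^sup>2) = 0" by (simp add: sum_nonneg antisym not_less)
    then have x0: "x i = 0" if "i < n" for i using that by (simp add: sum_nonneg_eq_0_iff)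
    have "prod x e = 0" if "e \<in> ?E" for e
      using pair_Min_Max(2,3)[OF that] x0[of "Max e"] by (simp add: prod_pair[OF that])
    then have "\<tau> * (real n)\<^sup>2 \<le> 0" using gap z by simp
    moreover have "0 < \<tau> * (real n)\<^sup>2" using \<tau> n by simp
    ultimately show False by linarith
  qed
  define w where "w e = 2 * \<theta> * prod x e" for e
  have w: "0 \<le> w e" "w e \<le> 2 * \<theta> * M\<^sup>2" if "e \<in> ?E" for e
  proof -
    have b: "0 \<le> x (Min e)" "x (Min e) \<le> M" "0 \<le> x (Max e)" "x (Max e) \<le> M"
      using M(2) pair_Min_Max(2,3)[OF that] by auto
    then have "prod x e \<le> M * M" unfolding prod_pair[OF that] by (intro mult_mono) auto
    then show "w e \<le> 2 * \<theta> * M\<^sup>2" using \<theta> by (simp add: w_def power2_eq_square)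
    show "0 \<le> w e" using b \<theta> by (simp add: w_def prod_pair[OF that])
  qed
  have "2 * \<theta> * M\<^sup>2 \<le> 1" using \<theta>(2) M(1) by (simp add: field_simps)
  then have w1: "\<bar>w e\<bar> \<le> 1" if "e \<in> ?E" for e using w[OF that] by simp
  have w2: "(w e)\<^sup>2 \<le> \<theta> * \<tau>" if "e \<in> ?E" for e
  proof -
    have "(w e)\<^sup>2 \<le> (2 * \<theta> * M\<^sup>2)\<^sup>2" using w[OF that] by (intro power_mono) auto
    also have "\<dots> = \<theta> * (\<theta> * (4 * M ^ 4))" by (simp add: power2_eq_square power4_eq_xxxx)
    also have "\<dots> \<le> \<theta> * \<tau>"
      using \<theta> M(1) by (intro mult_left_mono) (auto simp: field_simps)
    finally show ?thesis .
  qed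
  have "prb ?E f (\<lambda>G. \<not> real n * r \<le> lambda1 n G)
      \<le> exp (- (\<theta> * \<tau> * (real n)\<^sup>2)) * (\<Prod>e\<in>?E. f e * exp (f e * w e - w e) + (1 - f e) * exp (f e * w e))"
  proof (rule chernoff[OF finite_all_pairs f])
    fix G assume G: "G \<subseteq> ?E" and "\<not> real n * r \<le> lambda1 n G"
    then have "\<not> (real n * r) * (\<Sum>i<n. (x i)\<^sup>2) \<le> bil n G x x"
      using lambda1_ge[OF n _ x_pos] by blast
    then have "bil n G x x + \<tau> * (real n)\<^sup>2 \<le> 2 * (\<Sum>e\<in>?E. f e * prod x e)"
      using gap by (simp add: mult.commute)
    then have "\<theta> * (bil n G x x + \<tau> * (real n)\<^sup>2) \<le> \<theta> * (2 * (\<Sum>e\<in>?E. f e * prod x e))"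
      using \<theta> by (intro mult_left_mono) auto
    moreover have "\<theta> * bil n G x x = (\<Sum>e\<in>?E. if e \<in> G then w e else 0)"
      unfolding quadratic_eq_sum_pairs[OF G] sum_distrib_left w_def by (intro sum.cong) auto
    moreover have "\<theta> * (2 * (\<Sum>e\<in>?E. f e * prod x e)) = (\<Sum>e\<in>?E. f e * w e)"
      unfolding sum_distrib_left w_def by (intro sum.cong) auto
    moreover have "(\<Sum>e\<in>?E. if e \<in> G then f e * w e - w e else f e * w e)
        = (\<Sum>e\<in>?E. f e * w e) - (\<Sum>e\<in>?E. if e \<in> G then w e else 0)"
      unfolding sum_subtractf[symmetric] by (intro sum.cong) auto
    ultimately show "\<theta> * \<tau> * (real n)\<^sup>2 \<le> (\<Sum>e\<in>?E. if e \<in> G then f e * w e - w e else f e * w e)"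
      by (simp add: algebra_simps)
  qed
  also have "(\<Prod>e\<in>?E. f e * exp (f e * w e - w e) + (1 - f e) * exp (f e * w e)) \<le> (\<Prod>e\<in>?E. exp (\<theta> * \<tau>))"
  proof (intro prod_mono conjI)
    fix e assume e: "e \<in> ?E"
    show "0 \<le> f e * exp (f e * w e - w e) + (1 - f e) * exp (f e * w e)"
      using f[OF e] by (intro add_nonneg_nonneg mult_nonneg_nonneg) auto
    have "f e * exp (f e * w e - w e) + (1 - f e) * exp (f e * w e)
        = exp (f e * w e) * (f e * exp (- w e) + (1 - f e))"
      by (simp add: exp_diff exp_minus field_simps)
    also have "\<dots> \<le> exp (f e * w e) * exp (f e * (- w e) + (- w e)\<^sup>2)"
      using f[OF e] w1[OF e] by (intro mult_left_mono bernoulli_mgf_le) auto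
    also have "\<dots> = exp ((w e)\<^sup>2)" by (simp add: exp_add[symmetric])
    also have "\<dots> \<le> exp (\<theta> * \<tau>)" using w2[OF e] by simp
    finally show "f e * exp (f e * w e - w e) + (1 - f e) * exp (f e * w e) \<le> exp (\<theta> * \<tau>)" .
  qed
  also have "(\<Prod>e\<in>?E. exp (\<theta> * \<tau>)) = exp (real (n choose 2) * (\<theta> * \<tau>))"
    by (simp add: card_all_pairs exp_of_nat_mult)
  also have "\<dots> \<le> exp ((real n)\<^sup>2 / 2 * (\<theta> * \<tau>))"
    using choose_two_le[of n] \<theta> \<tau> by (simp only: exp_le_cancel_iff) (intro mult_right_mono, auto)
  also have "exp (- (\<theta> * \<tau> * (real n)\<^sup>2)) * exp ((real n)\<^sup>2 / 2 * (\<theta> * \<tau>)) = exp (- (\<theta> * \<tau> / 2 * (real n)\<^sup>2))"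
    by (simp add: exp_add[symmetric])
  finally have "prb ?E f (\<lambda>G. \<not> real n * r \<le> lambda1 n G) \<le> exp (- (\<theta> * \<tau> / 2 * (real n)\<^sup>2))"
    by simp
  then show ?thesis unfolding prb_compl[OF finite_all_pairs] by simp
qed

text \<open>Densities \<open>f\<close> and test vector \<open>x\<close> are quantified inside
  \<open>eventually\<close>, so they may depend on \<open>n\<close>. By concentration the event has
  tilted probability close to 1, hence the division by it in \<open>tilting_lower_bound\<close>
  costs only a factor \<open>1 + \<kappa>\<close>.\<close>

lemma variational_lower_bound:
  assumes p: "0 < p" "p < 1" and M: "0 < M" and \<tau>: "0 < \<tau>" and \<kappa>: "0 < \<kappa>"
  shows "\<forall>\<^sub>F n in sequentially. \<forall>f x. (\<forall>e\<in>all_pairs n. 0 \<le> f e \<and> f e \<le> 1)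
      \<longrightarrow> (\<forall>i<n. 0 \<le> x i \<and> x i \<le> M)
      \<longrightarrow> r * real n * (\<Sum>i<n. (x i)\<^sup>2) + \<tau> * (real n)\<^sup>2 \<le> 2 * (\<Sum>e\<in>all_pairs n. f e * prod x e)
      \<longrightarrow> 0 < eig_prob p r n \<and> - ln (eig_prob p r n) \<le> (1 + \<kappa>) * ((\<Sum>e\<in>all_pairs n. h p (f e)) + 2)"
proof -
  define \<theta> where "\<theta> = min (1 / (2 * M\<^sup>2)) (\<tau> / (4 * M ^ 4))"
  have \<theta>: "0 < \<theta>" "\<theta> \<le> 1 / (2 * M\<^sup>2)" "\<theta> \<le> \<tau> / (4 * M ^ 4)"
    using M \<tau> by (auto simp: \<theta>_def)
  have c: "0 < \<theta> * \<tau> / 2" using \<theta> \<tau> by simp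
  have "((\<lambda>n. exp (- (c * (real n)\<^sup>2))) \<longlongrightarrow> 0) sequentially" if "0 < c" for c :: real
    using that by real_asymp
  then have "((\<lambda>n. exp (- (\<theta> * \<tau> / 2 * (real n)\<^sup>2))) \<longlongrightarrow> 0) sequentially" using c by blast
  moreover have "0 < \<kappa> / (1 + \<kappa>)" using \<kappa> by simp
  ultimately have "\<forall>\<^sub>F n in sequentially. exp (- (\<theta> * \<tau> / 2 * (real n)\<^sup>2)) < \<kappa> / (1 + \<kappa>)"
    by (rule order_tendstoD)
  then show ?thesis
    using eventually_gt_at_top[of 0]
  proof eventually_elim
    case (elim n)
    show ?case
    proof (intro allI impI)
      fix f x
      assume f: "\<forall>e\<in>all_pairs n. 0 \<le> f e \<and> f e \<le> 1" and x: "\<forall>i<n. 0 \<le> x i \<and> x i \<le> M"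
        and gap: "r * real n * (\<Sum>i<n. (x i)\<^sup>2) + \<tau> * (real n)\<^sup>2 \<le> 2 * (\<Sum>e\<in>all_pairs n. f e * prod x e)"
      define q where "q = prb (all_pairs n) f (\<lambda>G. real n * r \<le> lambda1 n G)"
      define K where "K = (\<Sum>e\<in>all_pairs n. h p (f e)) + 2"
      have "1 - exp (- (\<theta> * \<tau> / 2 * (real n)\<^sup>2)) \<le> q"
        unfolding q_def using M x f elim \<tau> gap \<theta> by (intro tilted_concentration) auto
      then have "1 - \<kappa> / (1 + \<kappa>) \<le> q" using elim by linarith
      then have q1: "1 / (1 + \<kappa>) \<le> q" using \<kappa> by (simp add: field_simps)
      have "0 < 1 / (1 + \<kappa>)" using \<kappa> by simp
      then have q: "0 < q" using q1 by (rule less_le_trans)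
      have K: "0 \<le> K" unfolding K_def using f p
        by (intro add_nonneg_nonneg sum_nonneg relative_entropy_nonneg) auto
      have f': "\<And>e. e \<in> all_pairs n \<Longrightarrow> 0 \<le> f e \<and> f e \<le> 1" using f by blast
      have "0 < eig_prob p r n"
        unfolding eig_prob_def using finite_all_pairs p f' q[unfolded q_def] by (rule tilting_lower_bound(1))
      moreover have "- (K / q) \<le> ln (eig_prob p r n)"
        unfolding eig_prob_def K_def q_def minus_divide_left
        by (rule tilting_lower_bound(2)[OF finite_all_pairs p f' q[unfolded q_def]])
      moreover have "K / q \<le> (1 + \<kappa>) * K"
      proof -
        have "K * 1 \<le> K * (q * (1 + \<kappa>))" using q1 \<kappa> K by (intro mult_left_mono) (auto simp: field_simps)
        then show ?thesis using q by (simp add: field_simps)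
      qed
      ultimately show "0 < eig_prob p r n \<and> - ln (eig_prob p r n) \<le> (1 + \<kappa>) * ((\<Sum>e\<in>all_pairs n. h p (f e)) + 2)"
        unfolding K_def by linarith
    qed
  qed
qed

section \<open>Existence of the rate\<close>

lemma sum_lessThan_add:
  fixes g :: "nat \<Rightarrow> real"
  shows "(\<Sum>i<a + b. g i) = (\<Sum>i<a. g i) + (\<Sum>i<b. g (a + i))"
  by (induction b) auto

lemma sum_mod:
  fixes g :: "nat \<Rightarrow> real"
  shows "(\<Sum>i<m * k. g (i mod m)) = real k * (\<Sum>a<m. g a)"
proof (induction k)
  case (Suc k)
  have "(\<Sum>i<m * Suc k. g (i mod m)) = (\<Sum>i<m * k. g (i mod m)) + (\<Sum>i<m. g ((m * k + i) mod m))"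
    using sum_lessThan_add[of "\<lambda>i. g (i mod m)" "m * k" m] by (simp add: add.commute)
  also have "(\<Sum>i<m. g ((m * k + i) mod m)) = (\<Sum>a<m. g a)" by (intro sum.cong) auto
  finally show ?case using Suc by (simp add: algebra_simps)
qed simp

lemma sum_mod2:
  fixes H :: "nat \<Rightarrow> nat \<Rightarrow> real"
  shows "(\<Sum>i<m * k. \<Sum>j<m * k. H (i mod m) (j mod m)) = (real k)\<^sup>2 * (\<Sum>a<m. \<Sum>b<m. H a b)"
proof -
  have "(\<Sum>i<m * k. \<Sum>j<m * k. H (i mod m) (j mod m)) = (\<Sum>i<m * k. real k * (\<Sum>b<m. H (i mod m) b))"
    by (intro sum.cong refl sum_mod)
  also have "\<dots> = real k * (\<Sum>a<m. real k * (\<Sum>b<m. H a b))"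
    by (rule sum_mod[of "\<lambda>a. real k * (\<Sum>b<m. H a b)"])
  finally show ?thesis by (simp add: sum_distrib_left power2_eq_square mult.assoc)
qed

lemma sum_if_less:
  fixes g :: "nat \<Rightarrow> real"
  assumes "L \<le> N"
  shows "(\<Sum>i<N. if i < L then g i else 0) = (\<Sum>i<L. g i)"
  by (rule sum.mono_neutral_cong_right) (use assms in auto)

lemma sum_if_ge:
  fixes c :: real
  assumes "L \<le> N"
  shows "(\<Sum>i<N. if L \<le> i then c else 0) = real (N - L) * c"
proof -
  have "(\<Sum>i<N. if L \<le> i then c else 0) = (\<Sum>i\<in>{L..<N}. c)"
    by (rule sum.mono_neutral_cong_right) auto
  then show ?thesis by simp
qed

lemma relative_entropy_one: "0 < p \<Longrightarrow> h p 1 = ln (1 / p)"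
  by (simp add: h_def)

lemma relative_entropy_self: "0 < p \<Longrightarrow> p < 1 \<Longrightarrow> h p p = 0"
  by (simp add: h_def)

text \<open>A blow-up of the weights \<open>F\<close> on \<open>m\<close> vertices to \<open>m * k\<close> vertices; the remaining vertices
  up to \<open>N\<close> are joined to everything, which compensates for the loss in the eigenvalue.\<close>

definition blow_up :: "real \<Rightarrow> nat \<Rightarrow> nat \<Rightarrow> (nat set \<Rightarrow> real) \<Rightarrow> nat set \<Rightarrow> real" where
  "blow_up p m k F e = (if \<exists>i\<in>e. m * k \<le> i then 1
     else if (\<lambda>i. i mod m) ` e \<in> all_pairs m then F ((\<lambda>i. i mod m) ` e) else p)"

lemma blow_up_pair:
  "blow_up p m k F {i, j} = (if m * k \<le> i \<or> m * k \<le> j then 1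
     else if {i mod m, j mod m} \<in> all_pairs m then F {i mod m, j mod m} else p)"
  by (auto simp: blow_up_def)

lemma pair_mem_all_pairs: "{a, b} \<in> all_pairs m \<longleftrightarrow> a \<noteq> b \<and> a < m \<and> b < m"
  by (auto simp: all_pairs_def card_insert_if)

lemma singleton_not_pair: "{a} \<notin> all_pairs m"
  by (simp add: all_pairs_def)

lemma blow_up_cost:
  assumes p: "0 < p" "p < 1" and m: "0 < m" and le: "m * k \<le> N"
    and F: "\<And>e. e \<in> all_pairs m \<Longrightarrow> 0 \<le> F e \<and> F e \<le> 1"
  shows "(\<Sum>e\<in>all_pairs N. h p (blow_up p m k F e))
    \<le> (real k)\<^sup>2 * (\<Sum>e\<in>all_pairs m. h p (F e)) + real (N - m * k) * real N * ln (1 / p)"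
proof -
  let ?L = "ln (1 / p)" and ?f = "blow_up p m k F"
  define H where "H a b = (if a \<noteq> b then h p (F {a, b}) else 0)" for a b
  have L: "0 \<le> ?L" using p by simp
  have H: "0 \<le> H a b" if "a < m" "b < m" for a b
    using that p F by (auto simp: H_def pair_mem_all_pairs intro!: relative_entropy_nonneg)
  have "2 * (\<Sum>e\<in>all_pairs N. h p (?f e)) = (\<Sum>i<N. \<Sum>j<N. if i \<noteq> j then h p (?f {i, j}) else 0)"
    by (rule sum_ordered_pairs_sym[symmetric])
  \<comment> \<open>Pairs inside one class carry density \<open>p\<close> and cost nothing; pairs
    meeting a remaining vertex cost \<open>ln (1 / p)\<close>, charged to such an endpoint.\<close>
  also have "\<dots> \<le> (\<Sum>i<N. \<Sum>j<N. (if i < m * k then if j < m * k then H (i mod m) (j mod m) else 0 else 0)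
      + (if m * k \<le> i then ?L else 0) + (if m * k \<le> j then ?L else 0))"
  proof (intro sum_mono)
    fix i j
    have H': "0 \<le> H (i mod m) (j mod m)" using m by (intro H) auto
    show "(if i \<noteq> j then h p (?f {i, j}) else 0)
      \<le> (if i < m * k then if j < m * k then H (i mod m) (j mod m) else 0 else 0)
        + (if m * k \<le> i then ?L else 0) + (if m * k \<le> j then ?L else 0)"
    proof (cases "m * k \<le> i \<or> m * k \<le> j")
      case True
      then have "h p (?f {i, j}) = ?L" using p by (simp add: blow_up_pair relative_entropy_one)
      then show ?thesis using True L H' by auto
    next
      case False
      then have "h p (?f {i, j}) = H (i mod m) (j mod m)"
        using p m by (simp add: blow_up_pair pair_mem_all_pairs H_def relative_entropy_self)
      then show ?thesis using False H' by auto
    qed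
  qed
  also have "\<dots> = (\<Sum>i<m * k. \<Sum>j<m * k. H (i mod m) (j mod m)) + 2 * (real (N - m * k) * real N * ?L)"
  proof -
    have row: "(\<Sum>j<N. if i < m * k then if j < m * k then H (i mod m) (j mod m) else 0 else 0)
        = (if i < m * k then \<Sum>j<m * k. H (i mod m) (j mod m) else 0)" for i
      using sum_if_less[OF le] by simp
    show ?thesis
      unfolding sum.distrib row sum_if_less[OF le] using le
      by (simp add: sum_if_ge sum_distrib_left[symmetric])
  qed
  also have "\<dots> = (real k)\<^sup>2 * (\<Sum>a<m. \<Sum>b<m. H a b) + 2 * (real (N - m * k) * real N * ?L)"
    unfolding sum_mod2 ..
  also have "(\<Sum>a<m. \<Sum>b<m. H a b) = 2 * (\<Sum>e\<in>all_pairs m. h p (F e))"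
    unfolding H_def by (rule sum_ordered_pairs_sym)
  finally show ?thesis by simp
qed

text \<open>For a unit vector \<open>y\<close> with spread-out entries the factor
  \<open>sqrt m\<close> matches them in size with the value 1 at the remaining vertices. Only pairs
  in different classes and pairs joining a class to a remaining vertex are kept; the others
  contribute nonnegative terms.\<close>

lemma blow_up_form:
  assumes p: "0 < p" "p < 1" and m: "0 < m" and le: "m * k \<le> N"
    and F: "\<And>e. e \<in> all_pairs m \<Longrightarrow> 0 \<le> F e \<and> F e \<le> 1"
    and y: "\<And>i. i < m \<Longrightarrow> 0 \<le> y i"
  defines "x \<equiv> \<lambda>i. if i < m * k then sqrt m * y (i mod m) else 1"
  shows "(real k)\<^sup>2 * (real m * (2 * (\<Sum>e\<in>all_pairs m. F e * prod y e)))
      + 2 * real (N - m * k) * (real k * (sqrt m * (\<Sum>a<m. y a)))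
    \<le> 2 * (\<Sum>e\<in>all_pairs N. blow_up p m k F e * prod x e)"
    and "(\<Sum>i<N. (x i)\<^sup>2) = real (m * k) * (\<Sum>a<m. (y a)\<^sup>2) + real (N - m * k)"
proof -
  let ?f = "blow_up p m k F"
  define H where "H a b = (if a \<noteq> b then F {a, b} * prod y {a, b} else 0)" for a b
  have y': "0 \<le> y (i mod m)" for i using y m by simp
  have x: "0 \<le> x i" for i using y' by (simp add: x_def)
  have row: "(\<Sum>j<N. if i < m * k then if j < m * k then real m * H (i mod m) (j mod m) else 0 else 0)
      = (if i < m * k then \<Sum>j<m * k. real m * H (i mod m) (j mod m) else 0)" for i
    using sum_if_less[OF le] by simp
  have row2: "(\<Sum>j<N. if i < m * k then if m * k \<le> j then x i else 0 else 0)
      = (if i < m * k then real (N - m * k) * x i else 0)" for i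
    using sum_if_ge[OF le] by simp
  have row3: "(\<Sum>j<N. if m * k \<le> i then if j < m * k then x j else 0 else 0)
      = (if m * k \<le> i then \<Sum>j<m * k. x j else 0)" for i
    using sum_if_less[OF le] by simp
  have sx: "(\<Sum>i<m * k. x i) = real k * (sqrt m * (\<Sum>a<m. y a))"
  proof -
    have "(\<Sum>i<m * k. x i) = (\<Sum>i<m * k. sqrt m * y (i mod m))"
      by (intro sum.cong) (auto simp: x_def)
    also have "\<dots> = real k * (\<Sum>a<m. sqrt m * y a)" by (rule sum_mod)
    finally show ?thesis by (simp add: sum_distrib_left)
  qed
  have "(real k)\<^sup>2 * (real m * (2 * (\<Sum>e\<in>all_pairs m. F e * prod y e)))
      + 2 * real (N - m * k) * (real k * (sqrt m * (\<Sum>a<m. y a)))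
      = (\<Sum>i<m * k. \<Sum>j<m * k. real m * H (i mod m) (j mod m))
        + real (N - m * k) * (\<Sum>i<m * k. x i) + real (N - m * k) * (\<Sum>j<m * k. x j)"
  proof -
    have "2 * (\<Sum>e\<in>all_pairs m. F e * prod y e) = (\<Sum>a<m. \<Sum>b<m. H a b)"
      unfolding H_def by (rule sum_ordered_pairs_sym[symmetric])
    then show ?thesis
      unfolding sx sum_mod2[of "\<lambda>a b. real m * H a b"] by (simp add: sum_distrib_left mult.assoc)
  qed
  also have "\<dots> = (\<Sum>i<N. \<Sum>j<N. (if i < m * k then if j < m * k then real m * H (i mod m) (j mod m) else 0 else 0)
      + (if i < m * k then if m * k \<le> j then x i else 0 else 0)
      + (if m * k \<le> i then if j < m * k then x j else 0 else 0))"
    unfolding sum.distrib row row2 row3 sum_if_less[OF le] sum_if_ge[OF le] sum_distrib_left ..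
  also have "\<dots> \<le> (\<Sum>i<N. \<Sum>j<N. if i \<noteq> j then ?f {i, j} * prod x {i, j} else 0)"
  proof (intro sum_mono)
    fix i j
    show "(if i < m * k then if j < m * k then real m * H (i mod m) (j mod m) else 0 else 0)
      + (if i < m * k then if m * k \<le> j then x i else 0 else 0)
      + (if m * k \<le> i then if j < m * k then x j else 0 else 0)
      \<le> (if i \<noteq> j then ?f {i, j} * prod x {i, j} else 0)"
    proof (cases "i < m * k \<and> j < m * k")
      case True
      show ?thesis
      proof (cases "i mod m = j mod m")
        case True
        then show ?thesis using \<open>i < m * k \<and> j < m * k\<close> x p
          by (auto simp: H_def blow_up_pair singleton_not_pair intro!: mult_nonneg_nonneg)
      next
        case False
        then have "i \<noteq> j" by auto
        moreover have "?f {i, j} = F {i mod m, j mod m}"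
          using True False m by (simp add: blow_up_pair pair_mem_all_pairs)
        moreover have "x i * x j = real m * (y (i mod m) * y (j mod m))"
          using True by (simp add: x_def)
        ultimately show ?thesis using True False by (simp add: H_def)
      qed
    next
      case False
      then show ?thesis using x
        by (auto simp: blow_up_pair x_def intro!: mult_nonneg_nonneg)
    qed
  qed
  also have "\<dots> = 2 * (\<Sum>e\<in>all_pairs N. ?f e * prod x e)"
    by (rule sum_ordered_pairs_sym)
  finally show "(real k)\<^sup>2 * (real m * (2 * (\<Sum>e\<in>all_pairs m. F e * prod y e)))
      + 2 * real (N - m * k) * (real k * (sqrt m * (\<Sum>a<m. y a)))
    \<le> 2 * (\<Sum>e\<in>all_pairs N. ?f e * prod x e)" .
  have "(\<Sum>i<N. (x i)\<^sup>2)
      = (\<Sum>i<N. (if i < m * k then real m * (y (i mod m))\<^sup>2 else 0) + (if m * k \<le> i then 1 else 0))"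
    by (intro sum.cong refl) (simp add: x_def power_mult_distrib)
  also have "\<dots> = (\<Sum>i<m * k. real m * (y (i mod m))\<^sup>2) + real (N - m * k)"
    unfolding sum.distrib sum_if_less[OF le] sum_if_ge[OF le] by simp
  also have "(\<Sum>i<m * k. real m * (y (i mod m))\<^sup>2) = real k * (\<Sum>a<m. real m * (y a)\<^sup>2)"
    by (rule sum_mod[of "\<lambda>a. real m * (y a)\<^sup>2"])
  finally show "(\<Sum>i<N. (x i)\<^sup>2) = real (m * k) * (\<Sum>a<m. (y a)\<^sup>2) + real (N - m * k)"
    by (simp add: sum_distrib_left mult_ac)
qed

text \<open>Pigeonhole over the grid, then pass to the marginals of the conditioned measure.\<close>

lemma optimal_marginals_exist:
  assumes p: "0 < p" "p < 1" and r: "0 < r" and m: "0 < m" and pos: "0 < eig_prob p r m"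
    and large: "2 < real m * r"
  obtains F y where "\<forall>e\<in>all_pairs m. 0 \<le> F e \<and> F e \<le> (1::real)"
    "\<forall>i<m. 0 \<le> y i \<and> y i \<le> 1 / (r * sqrt m)" "(\<Sum>i<m. (y i)\<^sup>2) \<le> 1"
    "sqrt (real m * r - 2) \<le> (\<Sum>i<m. y i)"
    "real m * r - 2 \<le> 2 * (\<Sum>e\<in>all_pairs m. F e * prod y e)"
    "(\<Sum>e\<in>all_pairs m. h p (F e)) \<le> - ln (eig_prob p r m) + real m * ln ((real m)\<^sup>2 + 1)"
proof -
  let ?E = "all_pairs m" and ?P = "\<lambda>Q. prb (all_pairs m) (\<lambda>_. p) Q"
  define c where "c = real ((m\<^sup>2 + 1) ^ m)"
  have c: "0 < c" unfolding c_def by (simp del: of_nat_power)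
  have ln_c: "ln c = real m * ln ((real m)\<^sup>2 + 1)"
    unfolding c_def by (simp add: ln_realpow add_nonneg_pos add.commute)
  have "eig_prob p r m \<le> ?P (\<lambda>G. \<exists>y\<in>grid m. grid_event r m y G)"
    unfolding eig_prob_def using p grid_vector_exists[OF m r]
    by (intro prb_mono finite_all_pairs) auto
  also have "\<dots> \<le> (\<Sum>y\<in>grid m. ?P (grid_event r m y))"
    using p by (intro prb_Bex_le finite_all_pairs finite_grid) auto
  finally have le: "eig_prob p r m \<le> (\<Sum>y\<in>grid m. ?P (grid_event r m y))" .
  have "\<exists>y\<in>grid m. eig_prob p r m / c \<le> ?P (grid_event r m y)"
  proof (rule ccontr)
    assume "\<not> ?thesis"
    then have lt: "\<And>y. y \<in> grid m \<Longrightarrow> ?P (grid_event r m y) < eig_prob p r m / c" by force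
    have "grid m \<noteq> {}" using le pos by force
    then have "(\<Sum>y\<in>grid m. ?P (grid_event r m y)) < (\<Sum>y\<in>grid m. eig_prob p r m / c)"
      using lt by (intro sum_strict_mono finite_grid)
    also have "\<dots> = real (card (grid m)) * (eig_prob p r m / c)" by simp
    also have "\<dots> \<le> c * (eig_prob p r m / c)"
    proof (rule mult_right_mono)
      show "real (card (grid m)) \<le> c" unfolding c_def using card_grid_le[of m] by (rule of_nat_mono)
    qed (use pos c in simp)
    also have "\<dots> = eig_prob p r m" using c by simp
    finally show False using le by simp
  qed
  then obtain y where y: "eig_prob p r m / c \<le> ?P (grid_event r m y)" by blast
  let ?Q = "grid_event r m y"
  have "0 < eig_prob p r m / c" using pos c by (rule divide_pos_pos)
  then have P: "0 < ?P ?Q" using y by (rule less_le_trans)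
  obtain G where G: "G \<subseteq> ?E" "?Q G"
  proof (rule ccontr)
    assume "\<not> thesis"
    then have "{G. G \<subseteq> ?E \<and> ?Q G} = {}" using that by blast
    then have "?P ?Q = 0" unfolding prb_def by (simp only: sum.empty)
    then show False using P by simp
  qed
  then have y': "\<forall>i<m. 0 \<le> y i \<and> y i \<le> 1 / (r * sqrt m)" "(\<Sum>i<m. (y i)\<^sup>2) \<le> 1"
    "real m * r - 2 \<le> bil m G y y" by (simp_all add: grid_event_def)
  \<comment> \<open>A 0/1 matrix yields a large form only if the entries of \<open>y\<close> have a
    large sum, and this sum is what the fully joined vertices see in
    \<open>blow_up_form\<close>.\<close>
  have "bil m G y y \<le> (\<Sum>i<m. \<Sum>j<m. y i * y j)"
    unfolding bil_def using y'(1) by (intro sum_mono) auto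
  also have "\<dots> = (\<Sum>i<m. y i)\<^sup>2" by (simp add: power2_eq_square sum_product)
  finally have "real m * r - 2 \<le> (\<Sum>i<m. y i)\<^sup>2" using y'(3) by simp
  then have sq: "sqrt (real m * r - 2) \<le> (\<Sum>i<m. y i)"
    using y'(1) by (intro real_le_lsqrt sum_nonneg) auto
  define F where "F e = prb ?E (\<lambda>_. p) (\<lambda>G. ?Q G \<and> e \<in> G) / ?P ?Q" for e
  have F01: "\<forall>e\<in>?E. 0 \<le> F e \<and> F e \<le> 1"
    unfolding F_def using sum_marginal_entropy_le(1)[OF finite_all_pairs p P] by blast
  have "(\<Sum>e\<in>?E. h p (F e)) \<le> - ln (?P ?Q)"
    unfolding F_def by (rule sum_marginal_entropy_le(2)[OF finite_all_pairs p P])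
  also have "- ln (?P ?Q) \<le> - ln (eig_prob p r m / c)"
    using y pos c P by simp
  also have "\<dots> = - ln (eig_prob p r m) + real m * ln ((real m)\<^sup>2 + 1)"
    using pos c by (simp add: ln_div ln_c)
  finally have cost: "(\<Sum>e\<in>?E. h p (F e)) \<le> - ln (eig_prob p r m) + real m * ln ((real m)\<^sup>2 + 1)" .
  have "real m * r - 2 \<le> (\<Sum>e\<in>?E. 2 * prod y e * F e)"
    unfolding F_def
  proof (rule conditional_mean_ge[OF finite_all_pairs p P])
    fix G assume "G \<subseteq> ?E" "?Q G"
    then show "real m * r - 2 \<le> (\<Sum>e\<in>?E. if e \<in> G then 2 * prod y e else 0)"
      using quadratic_eq_sum_pairs[of G m y] by (simp add: grid_event_def)
  qed
  also have "\<dots> = 2 * (\<Sum>e\<in>?E. F e * prod y e)"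
    unfolding sum_distrib_left by (intro sum.cong refl) simp
  finally show thesis using F01 y'(1,2) sq cost by (intro that[of F y])
qed

text \<open>A \<open>k\<close>-fold blow-up multiplies the cost by \<open>k^2\<close>, so
  \<open>n^2\<close> is the normalisation that it preserves. Limits are half of those taken with
  \<open>n choose 2\<close>.\<close>

definition rate :: "real \<Rightarrow> real \<Rightarrow> nat \<Rightarrow> real" where
  "rate p r n = - ln (eig_prob p r n) / (real n)\<^sup>2"

text \<open>The complete graph with the constant vector is the competitor; its surplus over
  \<open>r\<close> is of order \<open>1 - r\<close>.\<close>

lemma rate_bounded:
  assumes p: "0 < p" "p < 1" and r: "r < 1"
  shows "\<forall>\<^sub>F n in sequentially. 0 < eig_prob p r n \<and> 0 \<le> rate p r n \<and> rate p r n \<le> ln (1 / p) + 4"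
proof -
  let ?L = "ln (1 / p)"
  have L: "0 < ?L" using p by simp
  have one: "(0::real) < 1" by simp
  have "0 < (1 - r) / 2" using r by simp
  from variational_lower_bound[OF p one this one, of r]
    eventually_ge_at_top[of "nat \<lceil>2 / (1 - r)\<rceil>"] eventually_gt_at_top[of 0]
  show ?thesis
  proof eventually_elim
    case (elim n)
    have n: "1 \<le> (real n)\<^sup>2" using elim(3) by simp
    have "2 / (1 - r) \<le> real n" using elim(2) by linarith
    then have "2 * real n \<le> (1 - r) * real n * real n"
      using r by (simp add: divide_le_eq mult.commute mult_left_mono)
    then have "real n * real n - (1 - r) * real n * real n / 2 \<le> real n * (real n - 1)"
      by (simp add: algebra_simps)
    moreover have "r * real n * real n + (1 - r) / 2 * (real n)\<^sup>2
        = real n * real n - (1 - r) * real n * real n / 2"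
      by (simp add: power2_eq_square field_simps)
    ultimately have "r * real n * (\<Sum>i<n. 1\<^sup>2) + (1 - r) / 2 * (real n)\<^sup>2
        \<le> 2 * (\<Sum>e\<in>all_pairs n. 1 * prod (\<lambda>_. 1) e)"
      by (simp add: card_all_pairs real_choose_two)
    then have 1: "0 < eig_prob p r n" "- ln (eig_prob p r n) \<le> 2 * ((\<Sum>e\<in>all_pairs n. h p 1) + 2)"
      using elim(1)[rule_format, of "\<lambda>_. 1" "\<lambda>_. 1"] by simp_all
    have "2 * ((\<Sum>e\<in>all_pairs n. h p 1) + 2) = 2 * (real (n choose 2) * ?L) + 4"
      using p by (simp add: card_all_pairs relative_entropy_one)
    also have "\<dots> \<le> (real n)\<^sup>2 * ?L + 4 * (real n)\<^sup>2"
    proof -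
      have "2 * real (n choose 2) * ?L \<le> (real n)\<^sup>2 * ?L"
        using choose_two_le[of n] L by (intro mult_right_mono) auto
      then show ?thesis using n by linarith
    qed
    also have "\<dots> = (?L + 4) * (real n)\<^sup>2" by (simp add: algebra_simps)
    finally have "- ln (eig_prob p r n) \<le> (?L + 4) * (real n)\<^sup>2" using 1 by linarith
    then have "rate p r n \<le> ?L + 4"
      using elim(3) unfolding rate_def by (subst pos_divide_le_eq) simp_all
    moreover have "eig_prob p r n \<le> 1"
      unfolding eig_prob_def using p by (intro prb_le_1 finite_all_pairs) auto
    then have "0 \<le> rate p r n" using 1(1) by (simp add: rate_def divide_le_0_iff)
    ultimately show ?case using 1(1) by blast
  qed
qed

lemma floor_multiple_tendsto:
  assumes m: "0 < m" and c: "0 \<le> c"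
  shows "(\<lambda>N. real (m * nat \<lfloor>c * real N / real m\<rfloor>) / real N) \<longlonglongrightarrow> c"
proof (rule tendsto_sandwich)
  have b: "c * real N - real m \<le> real (m * nat \<lfloor>c * real N / real m\<rfloor>)"
    "real (m * nat \<lfloor>c * real N / real m\<rfloor>) \<le> c * real N" for N
  proof -
    have nn: "0 \<le> c * real N / real m" using c by simp
    have "c * real N / real m - 1 \<le> real (nat \<lfloor>c * real N / real m\<rfloor>)" by linarith
    then have "real m * (c * real N / real m - 1) \<le> real m * real (nat \<lfloor>c * real N / real m\<rfloor>)"
      by (intro mult_left_mono) auto
    then show "c * real N - real m \<le> real (m * nat \<lfloor>c * real N / real m\<rfloor>)"
      using m by (simp add: algebra_simps)
    have "real (nat \<lfloor>c * real N / real m\<rfloor>) \<le> c * real N / real m" using nn by linarith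
    then have "real m * real (nat \<lfloor>c * real N / real m\<rfloor>) \<le> real m * (c * real N / real m)"
      by (intro mult_left_mono) auto
    then show "real (m * nat \<lfloor>c * real N / real m\<rfloor>) \<le> c * real N"
      using m by simp
  qed
  show "\<forall>\<^sub>F N in sequentially. c - real m / real N \<le> real (m * nat \<lfloor>c * real N / real m\<rfloor>) / real N"
    using eventually_gt_at_top[of 0]
  proof eventually_elim
    case (elim N)
    then show ?case using divide_right_mono[OF b(1)[of N], of "real N"] by (simp add: diff_divide_distrib)
  qed
  show "\<forall>\<^sub>F N in sequentially. real (m * nat \<lfloor>c * real N / real m\<rfloor>) / real N \<le> c"
    using eventually_gt_at_top[of 0]
  proof eventually_elim
    case (elim N)
    then show ?case using divide_right_mono[OF b(2)[of N], of "real N"] by simp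
  qed
  show "(\<lambda>N. c - real m / real N) \<longlonglongrightarrow> c" by real_asymp
qed simp

text \<open>The marginals at size \<open>m\<close> reach only \<open>r - 2 / m\<close>, so a plain
  blow-up misses the target. Joining a small fraction \<open>\<delta>\<close> of the vertices to
  everything raises the form by about \<open>2 \<delta> (sqrt r - r)\<close>, which is positive
  because \<open>r < 1\<close> and beats the loss once \<open>m\<close> is large, at a cost
  proportional to \<open>\<delta>\<close>.\<close>

lemma rate_almost_decreasing:
  assumes p: "0 < p" "p < 1" and r: "0 < r" "r < 1" and \<kappa>: "0 < \<kappa>"
  shows "\<forall>\<^sub>F m in sequentially. \<forall>\<^sub>F N in sequentially. rate p r N \<le> rate p r m + \<kappa>"
proof -
  define L where "L = ln (1 / p)"
  have L: "0 < L" using p by (simp add: L_def)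
  define B where "B = L + 4"
  \<comment> \<open>Keeps the multiplicative error of \<open>variational_lower_bound\<close> below
    \<open>\<kappa> / 2\<close>, as the rates are bounded by \<open>B\<close>.\<close>
  define \<kappa>' where "\<kappa>' = \<kappa> / (2 * (B + \<kappa>))"
  have \<kappa>': "0 < \<kappa>'" "\<kappa>' * (B + \<kappa>) = \<kappa> / 2"
  proof -
    have "0 < B + \<kappa>" using \<kappa> L by (simp add: B_def)
    moreover have "\<kappa> / (2 * D) * D = \<kappa> / 2" if "0 < D" for D using that by simp
    ultimately show "0 < \<kappa>'" "\<kappa>' * (B + \<kappa>) = \<kappa> / 2" using \<kappa> unfolding \<kappa>'_def by (blast intro: divide_pos_pos mult_pos_pos zero_less_numeral)+
  qed
  define g where "g = sqrt r - r"
  have g: "0 < g"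
  proof -
    have "r\<^sup>2 < r" using r by (simp add: power2_eq_square)
    then have "r < sqrt r" by (rule real_less_rsqrt)
    then show ?thesis by (simp add: g_def)
  qed
  define \<delta> where "\<delta> = min (1 / 2) (min (\<kappa> / (8 * L)) (g / (g + sqrt r)))"
  have \<delta>: "0 < \<delta>" "\<delta> \<le> 1 / 2" "\<delta> * L \<le> \<kappa> / 8" "\<delta> * (g + sqrt r) \<le> g"
  proof -
    show "0 < \<delta>" using \<kappa> L g r by (auto simp: \<delta>_def add_pos_pos)
    show "\<delta> \<le> 1 / 2" unfolding \<delta>_def by (rule min.cobounded1)
    have "\<delta> \<le> \<kappa> / (8 * L)" by (simp add: \<delta>_def)
    then have "\<delta> * L \<le> \<kappa> / (8 * L) * L" using L by (intro mult_right_mono) auto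
    then show "\<delta> * L \<le> \<kappa> / 8" using L by simp
    have gs: "0 < g + sqrt r" using g r by (simp add: add_pos_pos)
    have "\<delta> \<le> g / (g + sqrt r)" by (simp add: \<delta>_def)
    then show "\<delta> * (g + sqrt r) \<le> g" using gs by (simp add: pos_le_divide_eq)
  qed
  define \<tau> where "\<tau> = \<delta> * g / 4"
  have \<tau>: "0 < \<tau>" using \<delta> g by (simp add: \<tau>_def)
  \<comment> \<open>The form divided by \<open>N^2\<close> when a fraction \<open>u\<close> of the
    vertices is blown up from level \<open>s\<close> and the rest is fully joined;
    \<open>sqrt s\<close> comes from the lower bound on the sum of the entries of
    \<open>y\<close>.\<close>
  define \<phi> where "\<phi> u s = u\<^sup>2 * s + 2 * (1 - u) * u * sqrt s" for u s :: real
  have \<phi>1: "r + 4 * \<tau> \<le> \<phi> (1 - \<delta>) r"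
  proof -
    have "\<phi> (1 - \<delta>) r = r + \<delta> * (2 * g - \<delta> * (g + sqrt r))"
      by (simp add: \<phi>_def g_def power2_eq_square algebra_simps)
    moreover have "\<delta> * g \<le> \<delta> * (2 * g - \<delta> * (g + sqrt r))"
      using \<delta> by (intro mult_left_mono) auto
    ultimately show ?thesis by (simp add: \<tau>_def)
  qed
  have "(\<lambda>m. r - 2 / real m) \<longlonglongrightarrow> r" by real_asymp
  then have "(\<lambda>m. \<phi> (1 - \<delta>) (r - 2 / real m)) \<longlonglongrightarrow> \<phi> (1 - \<delta>) r"
    unfolding \<phi>_def by (intro tendsto_intros)
  moreover have "r + 2 * \<tau> < \<phi> (1 - \<delta>) r" using \<phi>1 \<tau> by simp
  ultimately have ev1: "\<forall>\<^sub>F m in sequentially. r + 2 * \<tau> < \<phi> (1 - \<delta>) (r - 2 / real m)"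
    by (rule order_tendstoD)
  have "(\<lambda>m. ln ((real m)\<^sup>2 + 1) / real m) \<longlonglongrightarrow> 0" by real_asymp
  moreover have "0 < \<kappa> / 8" using \<kappa> by simp
  ultimately have ev2: "\<forall>\<^sub>F m in sequentially. ln ((real m)\<^sup>2 + 1) / real m < \<kappa> / 8"
    by (rule order_tendstoD)
  have ev3: "\<forall>\<^sub>F m in sequentially. 2 < real m * r"
    using r by real_asymp
  show ?thesis
    using ev1 ev2 ev3 rate_bounded[OF p r(2)] eventually_gt_at_top[of 0]
  proof eventually_elim
    case (elim m)
    then have m: "0 < m" and pos: "0 < eig_prob p r m" and large: "2 < real m * r" by auto
    obtain F y where F: "\<forall>e\<in>all_pairs m. 0 \<le> F e \<and> F e \<le> (1::real)"
      and y: "\<forall>i<m. 0 \<le> y i \<and> y i \<le> 1 / (r * sqrt m)" and y1: "(\<Sum>i<m. (y i)\<^sup>2) \<le> 1"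
      and sy: "sqrt (real m * r - 2) \<le> (\<Sum>i<m. y i)"
      and form: "real m * r - 2 \<le> 2 * (\<Sum>e\<in>all_pairs m. F e * prod y e)"
      and cost: "(\<Sum>e\<in>all_pairs m. h p (F e)) \<le> - ln (eig_prob p r m) + real m * ln ((real m)\<^sup>2 + 1)"
      by (rule optimal_marginals_exist[OF p r(1) m pos large])
    define s where "s = r - 2 / real m"
    have s: "real m * r - 2 = real m * s" "0 < s" using m large by (simp_all add: s_def field_simps)
    define k where "k N = nat \<lfloor>(1 - \<delta>) * real N / real m\<rfloor>" for N
    define u where "u N = real (m * k N) / real N" for N
    have u: "u \<longlonglongrightarrow> 1 - \<delta>"
      unfolding u_def k_def using m \<delta>(2) by (intro floor_multiple_tendsto) auto
    then have "(\<lambda>N. \<phi> (u N) s) \<longlonglongrightarrow> \<phi> (1 - \<delta>) s" unfolding \<phi>_def by (intro tendsto_intros)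
    moreover have "r + \<tau> < \<phi> (1 - \<delta>) s" using elim(1) \<tau> by (simp add: s_def)
    ultimately have ev4: "\<forall>\<^sub>F N in sequentially. r + \<tau> < \<phi> (u N) s" by (rule order_tendstoD)
    have "(\<lambda>N. (1 - u N) * L + 2 / (real N)\<^sup>2) \<longlonglongrightarrow> (1 - (1 - \<delta>)) * L + 0"
      by (intro tendsto_add tendsto_mult tendsto_diff tendsto_const u) real_asymp
    moreover have "(1 - (1 - \<delta>)) * L + 0 < \<kappa> / 4" using \<delta>(3) \<kappa> by simp
    ultimately have ev5: "\<forall>\<^sub>F N in sequentially. (1 - u N) * L + 2 / (real N)\<^sup>2 < \<kappa> / 4"
      by (rule order_tendstoD)
    have M: "0 < 1 / r" using r by simp
    show ?case
      using ev4 ev5 variational_lower_bound[OF p M \<tau> \<kappa>'(1), of r] eventually_gt_at_top[of 0]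
    proof eventually_elim
      case (elim N)
      let ?f = "blow_up p m (k N) F"
      let ?x = "\<lambda>i. if i < m * k N then sqrt m * y (i mod m) else 1"
      have N: "0 < real N" using elim by simp
      have mk: "real (m * k N) = u N * real N" using N by (simp add: u_def)
      have le: "m * k N \<le> N"
      proof -
        have "real (k N) \<le> (1 - \<delta>) * real N / real m" using \<delta>(2) unfolding k_def by (intro of_nat_floor) simp
        then have "real m * real (k N) \<le> (1 - \<delta>) * real N" using m by (simp add: field_simps)
        also have "\<dots> \<le> 1 * real N" using \<delta>(1) by (intro mult_right_mono) auto
        finally have "real (m * k N) \<le> real N" by simp
        then show ?thesis by (simp only: of_nat_le_iff)
      qed
      then have rest: "real (N - m * k N) = (1 - u N) * real N"
        using mk by (simp add: of_nat_diff algebra_simps)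
      have F': "\<And>e. e \<in> all_pairs m \<Longrightarrow> 0 \<le> F e \<and> F e \<le> 1" using F by blast
      have y': "\<And>i. i < m \<Longrightarrow> 0 \<le> y i" using y by blast
      note bf = blow_up_form[OF p m le F' y']
      have "r * real N * (\<Sum>i<N. (?x i)\<^sup>2) + \<tau> * (real N)\<^sup>2 \<le> (r + \<tau>) * (real N)\<^sup>2"
      proof -
        have "(\<Sum>i<N. (?x i)\<^sup>2) = real (m * k N) * (\<Sum>a<m. (y a)\<^sup>2) + real (N - m * k N)"
          by (rule bf(2))
        also have "\<dots> \<le> real (m * k N) * 1 + real (N - m * k N)"
          using y1 by (intro add_mono mult_left_mono) auto
        also have "\<dots> = real N" using le by simp
        finally have "r * real N * (\<Sum>i<N. (?x i)\<^sup>2) \<le> r * real N * real N"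
          using r by (intro mult_left_mono) auto
        then show ?thesis by (simp add: power2_eq_square algebra_simps)
      qed
      also have "\<dots> \<le> \<phi> (u N) s * (real N)\<^sup>2" using elim(1) by (intro mult_right_mono) auto
      also have "\<dots> = (real (m * k N))\<^sup>2 * s + 2 * real (N - m * k N) * (real (m * k N) * sqrt s)"
        unfolding mk rest by (simp add: \<phi>_def power2_eq_square algebra_simps)
      also have "\<dots> = (real (k N))\<^sup>2 * (real m * (real m * r - 2))
          + 2 * real (N - m * k N) * (real (k N) * (sqrt m * sqrt (real m * r - 2)))"
      proof -
        have "sqrt m * sqrt (real m * s) = real m * sqrt s"
          by (simp add: real_sqrt_mult mult.assoc[symmetric])
        then show ?thesis unfolding s(1) by (simp add: power2_eq_square)
      qed
      also have "\<dots> \<le> (real (k N))\<^sup>2 * (real m * (2 * (\<Sum>e\<in>all_pairs m. F e * prod y e)))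
          + 2 * real (N - m * k N) * (real (k N) * (sqrt m * (\<Sum>a<m. y a)))"
        using form sy by (intro add_mono mult_left_mono) auto
      also have "\<dots> \<le> 2 * (\<Sum>e\<in>all_pairs N. ?f e * prod ?x e)" by (rule bf(1))
      finally have gap: "r * real N * (\<Sum>i<N. (?x i)\<^sup>2) + \<tau> * (real N)\<^sup>2 \<le> 2 * (\<Sum>e\<in>all_pairs N. ?f e * prod ?x e)" .
      have x: "\<forall>i<N. 0 \<le> ?x i \<and> ?x i \<le> 1 / r"
      proof (intro allI impI)
        fix i
        have "0 \<le> y (i mod m) \<and> y (i mod m) \<le> 1 / (r * sqrt m)" using y m by simp
        moreover from this have "sqrt m * y (i mod m) \<le> sqrt m * (1 / (r * sqrt m))"
          by (intro mult_left_mono) auto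
        ultimately show "0 \<le> ?x i \<and> ?x i \<le> 1 / r" using m r by auto
      qed
      have f: "\<forall>e\<in>all_pairs N. 0 \<le> ?f e \<and> ?f e \<le> 1" using F p by (auto simp: blow_up_def)
      have "- ln (eig_prob p r N) \<le> (1 + \<kappa>') * ((\<Sum>e\<in>all_pairs N. h p (?f e)) + 2)"
        using mp[OF mp[OF mp[OF spec[OF spec[OF elim(3), of ?f], of ?x] f] x] gap] by (rule conjunct2)
      also have "\<dots> \<le> (1 + \<kappa>') * ((rate p r m + \<kappa> / 2) * (real N)\<^sup>2)"
      proof (intro mult_left_mono)
        have "(\<Sum>e\<in>all_pairs N. h p (?f e))
            \<le> (real (k N))\<^sup>2 * (\<Sum>e\<in>all_pairs m. h p (F e)) + real (N - m * k N) * real N * L"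
          unfolding L_def by (rule blow_up_cost[OF p m le F'])
        also have "(real (k N))\<^sup>2 * (\<Sum>e\<in>all_pairs m. h p (F e))
            \<le> (real (k N))\<^sup>2 * (- ln (eig_prob p r m) + real m * ln ((real m)\<^sup>2 + 1))"
          using cost by (intro mult_left_mono) auto
        also have "\<dots> = (real (m * k N))\<^sup>2 * (rate p r m + ln ((real m)\<^sup>2 + 1) / real m)"
        proof -
          have "(real m)\<^sup>2 * (a / (real m)\<^sup>2 + l / real m) = a + real m * l" for a l
            using m by (simp add: distrib_left power2_eq_square)
          then show ?thesis
            unfolding rate_def of_nat_mult power_mult_distrib by (simp only: mult.commute[of "(real m)\<^sup>2"] mult.assoc)
        qed
        also have "\<dots> \<le> (real N)\<^sup>2 * (rate p r m + \<kappa> / 8)"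
          using le \<open>0 < eig_prob p r m \<and> 0 \<le> rate p r m \<and> rate p r m \<le> ln (1 / p) + 4\<close>
            \<open>ln ((real m)\<^sup>2 + 1) / real m < \<kappa> / 8\<close>
          by (intro mult_mono power_mono add_nonneg_nonneg) (auto simp del: of_nat_mult)
        also have "real (N - m * k N) * real N * L = (real N)\<^sup>2 * ((1 - u N) * L)"
          unfolding rest by (simp add: power2_eq_square)
        finally have "(\<Sum>e\<in>all_pairs N. h p (?f e)) + 2
            \<le> (real N)\<^sup>2 * (rate p r m + \<kappa> / 8) + (real N)\<^sup>2 * ((1 - u N) * L) + (real N)\<^sup>2 * (2 / (real N)\<^sup>2)"
          using N by simp
        also have "\<dots> = (real N)\<^sup>2 * (rate p r m + \<kappa> / 8 + ((1 - u N) * L + 2 / (real N)\<^sup>2))"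
          by (simp only: distrib_left add.assoc)
        also have "\<dots> \<le> (real N)\<^sup>2 * (rate p r m + \<kappa> / 8 + \<kappa> / 4)"
          using elim(2) by (intro mult_left_mono) auto
        also have "\<dots> \<le> (real N)\<^sup>2 * (rate p r m + \<kappa> / 2)"
          using \<kappa> by (intro mult_left_mono) auto
        finally show "(\<Sum>e\<in>all_pairs N. h p (?f e)) + 2 \<le> (rate p r m + \<kappa> / 2) * (real N)\<^sup>2"
          by (simp add: mult.commute)
      qed (use \<kappa>' in simp)
      finally have "rate p r N \<le> (1 + \<kappa>') * (rate p r m + \<kappa> / 2)"
        using N unfolding rate_def[of p r N] by (subst pos_divide_le_eq) (simp_all only: zero_less_power mult.assoc)
      also have "\<dots> = rate p r m + \<kappa> / 2 + \<kappa>' * (rate p r m + \<kappa> / 2)" by (simp add: algebra_simps)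
      also have "\<dots> \<le> rate p r m + \<kappa> / 2 + \<kappa>' * (B + \<kappa>)"
        using \<kappa>' \<kappa> \<open>0 < eig_prob p r m \<and> 0 \<le> rate p r m \<and> rate p r m \<le> ln (1 / p) + 4\<close>
        by (intro add_mono mult_left_mono) (auto simp: B_def L_def)
      finally show ?case unfolding \<kappa>'(2) by simp
    qed
  qed
qed

text \<open>Any subsequential limit \<open>l\<close> is the limit. Letting \<open>N\<close> run
  along the subsequence bounds \<open>l\<close> by \<open>c m + \<kappa>\<close> for all large
  \<open>m\<close>; conversely one good index of the subsequence bounds all later terms from
  above.\<close>

lemma almost_decreasing_convergent:
  fixes c :: "nat \<Rightarrow> real"
  assumes bound: "\<forall>\<^sub>F n in sequentially. \<bar>c n\<bar> \<le> B"
    and dec: "\<And>\<kappa>. 0 < \<kappa> \<Longrightarrow> \<forall>\<^sub>F m in sequentially. \<forall>\<^sub>F N in sequentially. c N \<le> c m + \<kappa>"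
  shows "convergent c"
proof -
  obtain n0 where n0: "\<And>n. n \<ge> n0 \<Longrightarrow> \<bar>c n\<bar> \<le> B"
    using bound unfolding eventually_sequentially by blast
  have "bounded (range (\<lambda>n. c (n + n0)))"
    unfolding bounded_iff using n0 by (intro exI[of _ B]) auto
  then obtain l s where s: "strict_mono s" and lim: "((\<lambda>n. c (n + n0)) \<circ> s) \<longlonglongrightarrow> l"
    using bounded_imp_convergent_subsequence by blast
  define t where "t n = s n + n0" for n
  have t: "filterlim t at_top sequentially"
    unfolding t_def using filterlim_subseq[OF s] by (rule filterlim_at_top_mono) auto
  have lim: "(\<lambda>n. c (t n)) \<longlonglongrightarrow> l" using lim by (simp add: t_def o_def)
  have "c \<longlonglongrightarrow> l"
  proof (rule order_tendstoI)
    fix a assume a: "a < l"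
    define \<kappa> where "\<kappa> = (l - a) / 2"
    have \<kappa>: "0 < \<kappa>" "a + \<kappa> < l" using a by (simp_all add: \<kappa>_def field_simps)
    show "\<forall>\<^sub>F n in sequentially. a < c n"
      using dec[OF \<kappa>(1)]
    proof eventually_elim
      case (elim m)
      then have "\<forall>\<^sub>F n in sequentially. c (t n) \<le> c m + \<kappa>"
        using t by (rule eventually_compose_filterlim)
      then have "l \<le> c m + \<kappa>" using tendsto_upperbound[OF lim] by simp
      then show ?case using \<kappa>(2) by simp
    qed
  next
    fix b assume b: "l < b"
    define \<kappa> where "\<kappa> = (b - l) / 2"
    have \<kappa>: "0 < \<kappa>" "l < b - \<kappa>" using b by (simp_all add: \<kappa>_def field_simps)
    have "\<forall>\<^sub>F n in sequentially. c (t n) < b - \<kappa>" using lim \<kappa>(2) by (rule order_tendstoD)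
    moreover have "\<forall>\<^sub>F n in sequentially. \<forall>\<^sub>F N in sequentially. c N \<le> c (t n) + \<kappa>"
      using dec[OF \<kappa>(1)] t by (rule eventually_compose_filterlim)
    ultimately have "\<forall>\<^sub>F n in sequentially. c (t n) < b - \<kappa> \<and> (\<forall>\<^sub>F N in sequentially. c N \<le> c (t n) + \<kappa>)"
      by (rule eventually_conj)
    then obtain n where n: "c (t n) < b - \<kappa>" "\<forall>\<^sub>F N in sequentially. c N \<le> c (t n) + \<kappa>"
      using eventually_happens'[OF sequentially_bot] by blast
    show "\<forall>\<^sub>F N in sequentially. c N < b" using n(2) by eventually_elim (use n(1) in linarith)
  qed
  then show ?thesis by (rule convergentI)
qed

lemma rate_convergent:
  assumes p: "0 < p" "p < 1" and r: "0 < r" "r < 1"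
  shows "convergent (rate p r)"
proof (rule almost_decreasing_convergent)
  show "\<forall>\<^sub>F n in sequentially. \<bar>rate p r n\<bar> \<le> ln (1 / p) + 4"
    using rate_bounded[OF p r(2)] by eventually_elim auto
qed (rule rate_almost_decreasing[OF assms])

section \<open>The relative entropy against a parabola\<close>

text \<open>In the variable \<open>u = 1 - 2 x\<close> the derivative of the entropy is a multiple
  of the odd function \<open>artanh\<close>, which displays the symmetry under
  \<open>x \<mapsto> 1 - x\<close>.\<close>

lemma artanh_real_eq: "2 * artanh (1 - 2 * x) = ln ((1 - x) / x)" if "0 < x" for x :: real
proof -
  have "(1 + (1 - 2 * x)) / (1 - (1 - 2 * x)) = (1 - x) / x"
    using that by (simp add: field_simps)
  then show ?thesis by (simp add: artanh_def)
qed

lemma DERIV_artanh_real: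
  fixes x :: real
  assumes "0 \<le> x" "x < 1"
  shows "DERIV artanh x :> 1 / (1 - x\<^sup>2)"
  using artanh_real_has_field_derivative[of x] assms by auto

lemma artanh_bounds:
  fixes u :: real
  assumes u: "0 < u" "u < 1"
  shows "u < artanh u" "artanh u < u / (1 - u\<^sup>2)"
proof -
  have sq: "0 < x\<^sup>2" "x\<^sup>2 < 1" if "0 < x" "x < 1" for x :: real
    using that by (auto simp: abs_square_less_1)
  have d1: "DERIV (\<lambda>x. artanh x - x) x :> 1 / (1 - x\<^sup>2) - 1" if "0 \<le> x" "x < 1" for x :: real
    by (intro DERIV_diff DERIV_artanh_real DERIV_ident that)
  have d2: "DERIV (\<lambda>x. x / (1 - x\<^sup>2) - artanh x) x :> 2 * x\<^sup>2 / (1 - x\<^sup>2)\<^sup>2" if "0 \<le> x" "x < 1" for x :: real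
  proof -
    have nz: "1 - x\<^sup>2 \<noteq> 0" using that by (auto simp: power2_eq_1_iff)
    have "DERIV (\<lambda>x. 1 - x\<^sup>2) x :> - 2 * x" by (auto intro!: derivative_eq_intros)
    then have "DERIV (\<lambda>x. x / (1 - x\<^sup>2) - artanh x) x :>
        (1 * (1 - x\<^sup>2) - x * (- 2 * x)) / ((1 - x\<^sup>2) * (1 - x\<^sup>2)) - 1 / (1 - x\<^sup>2)"
      using nz that by (intro DERIV_diff DERIV_artanh_real DERIV_divide DERIV_ident)
    moreover have "(1 * D - x * (- 2 * x)) / (D * D) - 1 / D = 2 * x\<^sup>2 / D\<^sup>2" if "D \<noteq> 0" for D
      using that by (simp add: field_simps power2_eq_square)
    ultimately show ?thesis using nz by simp
  qed
  have "artanh 0 - 0 < artanh u - u"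
  proof (rule DERIV_pos_imp_increasing_open[OF u(1)])
    fix x assume x: "0 < x" "x < u"
    then have "0 < 1 / (1 - x\<^sup>2) - 1" using sq[of x] u by (simp add: field_simps)
    then show "\<exists>y. DERIV (\<lambda>x. artanh x - x) x :> y \<and> 0 < y" using d1[of x] x u by auto
  next
    show "continuous_on {0..u} (\<lambda>x. artanh x - x)"
      by (rule DERIV_atLeastAtMost_imp_continuous_on, rule exI, rule d1) (use u in linarith)+
  qed
  then show "u < artanh u" by simp
  have "0 / (1 - 0\<^sup>2) - artanh 0 < u / (1 - u\<^sup>2) - artanh u"
  proof (rule DERIV_pos_imp_increasing_open[OF u(1)])
    fix x assume x: "0 < x" "x < u"
    then have "0 < 2 * x\<^sup>2 / (1 - x\<^sup>2)\<^sup>2" using sq[of x] u by (intro divide_pos_pos) auto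
    then show "\<exists>y. DERIV (\<lambda>x. x / (1 - x\<^sup>2) - artanh x) x :> y \<and> 0 < y" using d2[of x] x u by auto
  next
    show "continuous_on {0..u} (\<lambda>x. x / (1 - x\<^sup>2) - artanh x)"
      by (rule DERIV_atLeastAtMost_imp_continuous_on, rule exI, rule d2) (use u in linarith)+
  qed
  then show "artanh u < u / (1 - u\<^sup>2)" by simp
qed

text \<open>With \<open>u = 1 - 2 x\<close>, half of \<open>artanh u / u\<close> is the derivative
  of the negative entropy in the variable \<open>u^2\<close>; its growth is the convexity behind
  \<open>tangent_gap_pos\<close>.\<close>

lemma artanh_div_strict_mono:
  fixes u v :: real
  assumes "0 < u" "u < v" "v < 1"
  shows "artanh u / u < artanh v / v"
proof (rule DERIV_pos_imp_increasing[OF assms(2)])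
  fix x assume x: "u \<le> x" "x \<le> v"
  then have x01: "0 < x" "x < 1" using assms by auto
  have "DERIV (\<lambda>x. artanh x / x) x :> (1 / (1 - x\<^sup>2) * x - artanh x * 1) / (x * x)"
    using x01 by (intro DERIV_divide DERIV_artanh_real DERIV_ident) auto
  moreover have "0 < (1 / (1 - x\<^sup>2) * x - artanh x * 1) / (x * x)"
    using artanh_bounds(2)[OF x01] x01 by simp
  ultimately show "\<exists>y. DERIV (\<lambda>x. artanh x / x) x :> y \<and> 0 < y" by blast
qed

text \<open>The logarithm of the base \<open>(1 / r - 1) powr (1 / (1 - 2 * r))\<close> in \<open>threshold\<close>.\<close>

definition slope :: "real \<Rightarrow> real" where
  "slope r = (if r = 1 / 2 then 2 else ln ((1 - r) / r) / (1 - 2 * r))"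

text \<open>Clearing the denominator removes the case distinction at \<open>r = 1 / 2\<close>, where
  both sides are 0.\<close>

lemma slope_eq: "(1 - 2 * r) * slope r = ln ((1 - r) / r)"
proof (cases "r = 1 / 2")
  case True
  show ?thesis unfolding True by simp
qed (simp add: slope_def)

lemma slope_symmetric: "slope (1 - r) = slope r" if "0 < r" "r < 1"
  using that by (simp add: slope_def ln_div field_simps)

lemma slope_artanh_less:
  assumes r: "0 < r" "r < 1 / 2" and u: "0 < u" "u < 1 - 2 * r"
  shows "2 * artanh u < slope r * u"
proof -
  have "artanh u / u < artanh (1 - 2 * r) / (1 - 2 * r)"
    using r u by (intro artanh_div_strict_mono) auto
  also have "\<dots> = slope r / 2"
    using r artanh_real_eq[of r] by (simp add: slope_def field_simps)
  finally show ?thesis using u by (simp add: field_simps)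
qed

lemma slope_artanh_greater:
  assumes r: "0 < r" "r \<le> 1 / 2" and u: "1 - 2 * r < u" "u < 1"
  shows "slope r * u < 2 * artanh u"
proof (cases "r = 1 / 2")
  case True
  then show ?thesis using artanh_bounds(1)[of u] u by (simp add: slope_def)
next
  case False
  have "slope r / 2 = artanh (1 - 2 * r) / (1 - 2 * r)"
    using r False artanh_real_eq[of r] by (simp add: slope_def field_simps)
  also have "\<dots> < artanh u / u" using r u False by (intro artanh_div_strict_mono) auto
  finally show ?thesis using u r by (simp add: field_simps)
qed

lemma slope_pos: "0 < slope r" if "0 < r" "r < 1"
proof (cases "r \<le> 1 / 2")
  case True
  have "r < 1 / 2 \<Longrightarrow> 0 < ln ((1 - r) / r)" using that by (intro ln_gt_zero) (simp add: field_simps)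
  then show ?thesis using True by (auto simp: slope_def)
next
  case False
  have "(1 - r) / r < 1" "0 < (1 - r) / r" using that False by (auto simp: field_simps)
  then have "ln ((1 - r) / r) < 0" by simp
  then show ?thesis using False by (simp add: slope_def divide_neg_neg)
qed

section \<open>Negative entropy and its tangent parabola\<close>

definition ent :: "real \<Rightarrow> real" where
  "ent x = x * ln x + (1 - x) * ln (1 - x)"

lemma h_eq_ent:
  assumes "0 < p" "p < 1" "0 \<le> x" "x \<le> 1"
  shows "h p x = ent x + x * ln ((1 - p) / p) - ln (1 - p)"
proof -
  have "x * ln (x / p) = x * ln x - x * ln p" using assms by (cases "x = 0") (simp_all add: ln_div algebra_simps)
  moreover have "(1 - x) * ln ((1 - x) / (1 - p)) = (1 - x) * ln (1 - x) - (1 - x) * ln (1 - p)"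
    using assms by (cases "x = 1") (simp_all add: ln_div algebra_simps)
  ultimately show ?thesis using assms by (simp add: h_def ent_def ln_div algebra_simps)
qed

lemma continuous_on_mult_ln: "continuous_on {0..} (\<lambda>x::real. x * ln x)"
  unfolding continuous_on_def
proof
  fix x :: real assume x: "x \<in> {0..}"
  show "((\<lambda>x. x * ln x) \<longlongrightarrow> x * ln x) (at x within {0..})"
  proof (cases "x = 0")
    case True
    have "((\<lambda>x::real. x * ln x) \<longlongrightarrow> 0) (at_right 0)" by real_asymp
    moreover have "at 0 within {0..} = at_right (0::real)"
      by (rule at_within_nhd[of _ UNIV]) auto
    ultimately show ?thesis using True by simp
  next
    case False
    then have "isCont (\<lambda>x. x * ln x) x" by (intro continuous_intros) auto
    then show ?thesis unfolding isCont_def by (rule tendsto_within_subset) auto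
  qed
qed

lemma continuous_on_ent: "continuous_on {0..1} ent"
proof -
  have c: "continuous_on {0..1} (\<lambda>x. x * ln x :: real)"
    by (rule continuous_on_subset[OF continuous_on_mult_ln]) auto
  moreover have "continuous_on {0..1} ((\<lambda>x. x * ln x) \<circ> (\<lambda>x. 1 - x :: real))"
    by (rule continuous_on_compose[OF _ continuous_on_subset[OF c]]) (auto intro: continuous_intros)
  ultimately show ?thesis unfolding ent_def o_def by (intro continuous_on_add)
qed

lemma DERIV_ent: "DERIV ent x :> - ln ((1 - x) / x)" if "0 < x" "x < 1"
  unfolding ent_def using that by (auto intro!: derivative_eq_intros simp: ln_div)

text \<open>In the variable \<open>(1 - 2 * x)\<^sup>2\<close> the entropy is strictly convex; the left-hand side is the
  gap to its tangent at \<open>r\<close>.\<close>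

lemma tangent_gap_pos:
  assumes r: "0 < r" "r < 1" and x: "0 \<le> x" "x \<le> 1" "x \<noteq> r" "x \<noteq> 1 - r"
  shows "0 < (ent x + slope r * (x * (1 - x))) - (ent r + slope r * (r * (1 - r)))"
proof -
  have lower: "ent r + slope r * (r * (1 - r)) < ent x + slope r * (x * (1 - x))"
    if r: "0 < r" "r \<le> 1 / 2" and x: "0 \<le> x" "x \<le> 1 / 2" "x \<noteq> r" for r x
  proof -
    let ?q = "\<lambda>x. ent x + slope r * (x * (1 - x))"
    have cont: "continuous_on {a..b} ?q" if "0 \<le> a" "b \<le> 1" for a b
      by (intro continuous_intros continuous_on_subset[OF continuous_on_ent]) (use that in auto)
    have d: "DERIV ?q y :> slope r * (1 - 2 * y) - 2 * artanh (1 - 2 * y)" if "0 < y" "y < 1" for y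
      unfolding artanh_real_eq[OF that(1)] using that DERIV_ent[OF that]
      by (auto intro!: derivative_eq_intros simp: algebra_simps)
    show ?thesis
    proof (cases "x < r")
      case True
      show ?thesis
      proof (rule DERIV_neg_imp_decreasing_open[OF True])
        fix y assume y: "x < y" "y < r"
        then have "slope r * (1 - 2 * y) < 2 * artanh (1 - 2 * y)"
          using r x by (intro slope_artanh_greater) auto
        then show "\<exists>z. DERIV ?q y :> z \<and> z < 0" using d[of y] y r x by force
      qed (use cont r x in auto)
    next
      case False
      then have lt: "r < x" using x by simp
      show ?thesis
      proof (rule DERIV_pos_imp_increasing_open[OF lt])
        fix y assume y: "r < y" "y < x"
        then have "2 * artanh (1 - 2 * y) < slope r * (1 - 2 * y)"
          using r x by (intro slope_artanh_less) auto
        then show "\<exists>z. DERIV ?q y :> z \<and> 0 < z" using d[of y] y r x by force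
      qed (use cont r x in auto)
    qed
  qed
  \<comment> \<open>\<open>ent\<close>, \<open>slope\<close> and \<open>x * (1 - x)\<close> are
    invariant under reflection at 1/2, so both points can be moved to the left half.\<close>
  define r' where "r' = min r (1 - r)"
  define x' where "x' = min x (1 - x)"
  have "ent r' = ent r" "r' * (1 - r') = r * (1 - r)" "slope r' = slope r"
    using slope_symmetric[OF r] by (auto simp: r'_def min_def ent_def algebra_simps)
  moreover have "ent x' = ent x" "x' * (1 - x') = x * (1 - x)"
    by (auto simp: x'_def min_def ent_def algebra_simps)
  moreover have "ent r' + slope r' * (r' * (1 - r')) < ent x' + slope r' * (x' * (1 - x'))"
    using r x by (intro lower) (auto simp: r'_def x'_def min_def split: if_splits)
  ultimately show ?thesis by simp
qed

text \<open>\<open>curv p r\<close> is the slope of \<open>x\<^sup>2 \<mapsto> h p x\<close> at \<open>r\<close>, and \<open>excess p r\<close> the distance of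
  \<open>h p\<close> from the corresponding tangent.\<close>

definition curv :: "real \<Rightarrow> real \<Rightarrow> real" where
  "curv p r = (ln ((1 - p) / p) - ln ((1 - r) / r)) / (2 * r)"

definition excess :: "real \<Rightarrow> real \<Rightarrow> real \<Rightarrow> real" where
  "excess p r x = h p x - h p r - curv p r * (x\<^sup>2 - r\<^sup>2)"

text \<open>\<open>h p\<close> is \<open>ent\<close> plus an affine function, and both sides vanish
  to first order at \<open>r\<close>; it remains to match the quadratic coefficients. The sign of
  \<open>slope r - curv p r\<close> thus decides the tangent condition.\<close>

lemma excess_eq:
  assumes p: "0 < p" "p < 1" and r: "0 < r" "r < 1" and x: "0 \<le> x" "x \<le> 1"
  shows "excess p r x = (ent x + slope r * (x * (1 - x))) - (ent r + slope r * (r * (1 - r)))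
    + (slope r - curv p r) * (x - r)\<^sup>2"
proof -
  have "ln ((1 - p) / p) = 2 * r * curv p r + ln ((1 - r) / r)"
    using r by (simp add: curv_def)
  then have a: "ln ((1 - p) / p) = 2 * r * curv p r + (1 - 2 * r) * slope r"
    by (simp only: slope_eq)
  have "excess p r x = ent x - ent r + (x - r) * ln ((1 - p) / p) - curv p r * (x\<^sup>2 - r\<^sup>2)"
    using p r x by (simp add: excess_def h_eq_ent left_diff_distrib)
  then show ?thesis unfolding a by (simp add: power2_eq_square algebra_simps)
qed

lemma curv_nonneg:
  assumes "0 < p" "p \<le> r" "r < 1"
  shows "0 \<le> curv p r"
proof -
  have "(1 - r) / r \<le> (1 - p) / p" using assms by (simp add: field_simps)
  then have "ln ((1 - r) / r) \<le> ln ((1 - p) / p)" using assms by (intro ln_mono) auto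
  then show ?thesis using assms by (simp add: curv_def)
qed

text \<open>The left side says that the log-odds \<open>ln ((1 - p) / p)\<close> are at most
  \<open>slope r\<close>. They equal \<open>2 r * curv p r + (1 - 2 r) * slope r\<close>, which
  turns this into a comparison of \<open>curv\<close> with \<open>slope\<close>.\<close>

lemma threshold_le_iff:
  assumes p: "0 < p" "p < 1" and r: "0 < r" "r < 1"
  shows "threshold r \<le> p \<longleftrightarrow> curv p r \<le> slope r"
proof -
  have t: "threshold r = inverse (1 + exp (slope r))"
    using r by (simp add: threshold_def slope_def powr_def divide_simps)
  have e: "0 < 1 + exp (slope r)" by (intro add_pos_pos) auto
  have "threshold r \<le> p \<longleftrightarrow> 1 \<le> p * (1 + exp (slope r))"
    unfolding t using e by (simp add: inverse_eq_divide divide_le_eq)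
  also have "\<dots> \<longleftrightarrow> (1 - p) / p \<le> exp (slope r)" using p by (simp add: field_simps)
  also have "\<dots> \<longleftrightarrow> ln ((1 - p) / p) \<le> slope r"
  proof -
    have "exp (ln ((1 - p) / p)) = (1 - p) / p" using p by simp
    then show ?thesis using exp_le_cancel_iff[of "ln ((1 - p) / p)" "slope r"] by simp
  qed
  also have "ln ((1 - p) / p) = 2 * r * curv p r + (1 - 2 * r) * slope r"
    using r by (simp only: slope_eq) (simp add: curv_def)
  also have "\<dots> \<le> slope r \<longleftrightarrow> curv p r \<le> slope r"
  proof -
    have "2 * r * curv p r + (1 - 2 * r) * slope r \<le> slope r \<longleftrightarrow> r * curv p r \<le> r * slope r"
      by (simp add: algebra_simps)
    then show ?thesis using r by simp
  qed
  finally show ?thesis .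
qed

lemma excess_nonneg:
  assumes p: "0 < p" "p < 1" and r: "0 < r" "r < 1" and t: "threshold r \<le> p" and x: "0 \<le> x" "x \<le> 1"
  shows "0 \<le> excess p r x"
    and "excess p r x = 0 \<Longrightarrow> x = r \<or> x = 1 - r \<and> curv p r = slope r"
proof -
  let ?T = "(ent x + slope r * (x * (1 - x))) - (ent r + slope r * (r * (1 - r)))"
  have T: "0 \<le> ?T"
  proof (cases "x = r \<or> x = 1 - r")
    case True
    moreover have "?T = 0" if "x = 1 - r" unfolding that by (simp add: ent_def algebra_simps)
    ultimately show ?thesis by auto
  next
    case False
    then show ?thesis using tangent_gap_pos[OF r x] by simp
  qed
  have c: "0 \<le> slope r - curv p r" using t threshold_le_iff[OF p r] by simp
  have c': "0 \<le> (slope r - curv p r) * (x - r)\<^sup>2" using c by (intro mult_nonneg_nonneg) auto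
  show "0 \<le> excess p r x" unfolding excess_eq[OF p r x] using T c' by linarith
  assume "excess p r x = 0"
  then have z: "?T = 0" "(slope r - curv p r) * (x - r)\<^sup>2 = 0"
    unfolding excess_eq[OF p r x] using T c' by linarith+
  then show "x = r \<or> x = 1 - r \<and> curv p r = slope r"
    using tangent_gap_pos[OF r x] by fastforce
qed

text \<open>For \<open>r \<noteq> 1 / 2\<close> the point \<open>1 - r\<close> works: the tangent
  gap vanishes there by symmetry and only the negative square in \<open>excess_eq\<close> remains.
  At \<open>r = 1 / 2\<close> this point merges with \<open>r\<close>, and a point to the left of
  \<open>r\<close> is used instead.\<close>

lemma excess_neg_exists:
  assumes p: "0 < p" "p < 1" and r: "0 < r" "r < 1" and t: "p < threshold r"
  shows "\<exists>x. 0 < x \<and> x < 1 \<and> excess p r x < 0"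
proof -
  have c: "slope r < curv p r" using t threshold_le_iff[OF p r] by linarith
  show ?thesis
  proof (cases "r = 1 / 2")
    case False
    have "excess p r (1 - r) = (slope r - curv p r) * (1 - 2 * r)\<^sup>2"
      using r by (subst excess_eq[OF p r]) (auto simp: ent_def algebra_simps)
    also have "\<dots> < 0" using c False by (intro mult_neg_pos) auto
    finally show ?thesis using r by (intro exI[of _ "1 - r"]) auto
  next
    case True
    let ?c = "curv p r"
    have s2: "slope r = 2" using True by (simp add: slope_def)
    have c2: "2 < ?c" using c s2 by simp
    \<comment> \<open>On \<open>v < u\<close> this gives \<open>v^2 \<le> u = 1 - 2 / c\<close> with
      \<open>c\<close> the curvature, so
      \<open>2 * artanh v < 2 v / (1 - v^2) \<le> c v\<close>.\<close>
    define u where "u = 1 - 2 / ?c"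
    have u: "0 < u" "u < 1" "u = 1 - 2 / ?c" using c2 by (auto simp: u_def field_simps)
    define x where "x = (1 - u) / 2"
    have "0 < x" "x < 1 / 2" using u(1,2) by (auto simp: x_def)
    then have x: "0 < x" "x < 1 / 2" "x < r" using True by linarith+
    let ?S = "\<lambda>x. (ent x + 2 * (x * (1 - x))) - (ent r + 2 * (r * (1 - r))) + (2 - ?c) * (x - r)\<^sup>2"
    have d: "DERIV ?S y :> ?c * (1 - 2 * y) - 2 * artanh (1 - 2 * y)" if "0 < y" "y < 1" for y
      unfolding artanh_real_eq[OF that(1)] using that DERIV_ent[OF that] True
      by (auto intro!: derivative_eq_intros simp: algebra_simps)
    have "?S x < ?S r"
    proof (rule DERIV_pos_imp_increasing_open[OF x(3)])
      fix y assume y: "x < y" "y < r"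
      define v where "v = 1 - 2 * y"
      have v: "0 < v" "v < u" using y True by (auto simp: v_def x_def)
      have v1: "v < 1" using v u by linarith
      have "v * v \<le> u * 1" using v v1 by (intro mult_mono) auto
      then have "2 / ?c \<le> 1 - v\<^sup>2" using u(3) by (simp add: power2_eq_square)
      then have "v * (2 / (1 - v\<^sup>2)) \<le> v * ?c"
      proof (intro mult_left_mono)
        assume a: "2 / ?c \<le> 1 - v\<^sup>2"
        moreover have "0 < 2 / ?c" using c2 by simp
        ultimately have "0 < 1 - v\<^sup>2" by linarith
        then show "2 / (1 - v\<^sup>2) \<le> ?c" using a c2 by (simp add: field_simps)
      qed (use v in simp)
      moreover have "v * (2 / (1 - v\<^sup>2)) = 2 * (v / (1 - v\<^sup>2))" by simp
      ultimately have "2 * artanh v < v * ?c" using artanh_bounds(2)[OF v(1) v1] by linarith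
      then have "2 * artanh (1 - 2 * y) < ?c * (1 - 2 * y)" by (simp add: v_def mult.commute)
      then show "\<exists>z. DERIV ?S y :> z \<and> 0 < z" using d[of y] y x True by force
    next
      show "continuous_on {x..r} ?S"
        by (intro continuous_intros continuous_on_subset[OF continuous_on_ent]) (use x True in auto)
    qed
    moreover have "excess p r x = ?S x" using excess_eq[OF p r, of x] x unfolding s2 by simp
    ultimately have "excess p r x < 0" by simp
    then show ?thesis using x by (intro exI[of _ x]) auto
  qed
qed

text \<open>Where \<open>G\<close> reaches \<open>\<eta>\<close> the function \<open>S\<close> has
  no zero, so by compactness it is bounded below there and a large multiple of it dominates
  \<open>G\<close>.\<close>

lemma compact_penalty:
  fixes S G :: "real \<Rightarrow> real"
  assumes S: "continuous_on {0..1} S" "\<And>x. x \<in> {0..1} \<Longrightarrow> 0 \<le> S x" and G: "continuous_on {0..1} G"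
    and zero: "\<And>x. x \<in> {0..1} \<Longrightarrow> S x = 0 \<Longrightarrow> G x \<le> 0" and \<eta>: "0 < \<eta>"
  shows "\<exists>K\<ge>0. \<forall>x\<in>{0..1}. G x \<le> \<eta> + K * S x"
proof -
  let ?Z = "{0..1} \<inter> G -` {\<eta>..}"
  have "closed ?Z" by (rule continuous_closed_preimage[OF G]) auto
  then have Z: "compact ?Z" using compact_Int_closed[of "{0..1}" ?Z] by (simp add: Int_absorb1)
  show ?thesis
  proof (cases "?Z = {}")
    case True
    then have "G x \<le> \<eta> + 0 * S x" if "x \<in> {0..1}" for x using that by force
    then show ?thesis by blast
  next
    case False
    obtain z where z: "z \<in> ?Z" "\<And>x. x \<in> ?Z \<Longrightarrow> S z \<le> S x"
      using continuous_attains_inf[OF Z False continuous_on_subset[OF S(1)]] by blast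
    have "S z \<noteq> 0" using zero[of z] z(1) \<eta> by force
    then have Sz: "0 < S z" using S(2)[of z] z(1) by force
    obtain w where w: "\<And>x. x \<in> {0..1} \<Longrightarrow> G x \<le> G w"
      using continuous_attains_sup[OF _ _ G] by force
    have Gw: "\<eta> \<le> G w" using w[of z] z(1) by force
    have "G x \<le> \<eta> + G w / S z * S x" if x: "x \<in> {0..1}" for x
    proof (cases "x \<in> ?Z")
      case True
      then have "G w / S z * S z \<le> G w / S z * S x"
        using z(2) Sz Gw \<eta> by (intro mult_left_mono) auto
      then show ?thesis using w[OF x] Sz \<eta> by simp
    next
      case False
      moreover have "0 \<le> G w / S z * S x" using Gw \<eta> Sz S(2)[OF x] by simp
      ultimately show ?thesis using x by simp
    qed
    then show ?thesis using Gw \<eta> Sz by (intro exI[of _ "G w / S z"]) auto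
  qed
qed

section \<open>Exponential tilts of Bernoulli laws\<close>

definition tilt :: "real \<Rightarrow> real \<Rightarrow> real" where
  "tilt p t = p * exp t / (p * exp t + (1 - p))"

lemma tilt_bounds:
  assumes "0 < p" "p < 1"
  shows "0 < tilt p t" "tilt p t < 1"
proof -
  have Z: "0 < p * exp t + (1 - p)" using assms by (intro add_pos_pos) auto
  show "0 < tilt p t" unfolding tilt_def using assms by (intro divide_pos_pos Z) auto
  show "tilt p t < 1" unfolding tilt_def by (subst pos_divide_less_eq[OF Z]) (use assms in simp)
qed

text \<open>Legendre duality: \<open>t \<mapsto> ln (p * exp t + (1 - p))\<close> is the convex conjugate of \<open>h p\<close>, attained
  at \<open>tilt p t\<close>.\<close>

lemma log_mgf_eq:
  assumes p: "0 < p" "p < 1"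
  shows "ln (p * exp t + (1 - p)) = tilt p t * t - h p (tilt p t)"
proof -
  let ?Z = "p * exp t + (1 - p)"
  have Z: "0 < ?Z" using p by (simp add: add_pos_pos)
  have "tilt p t / p = exp t / ?Z" using p by (simp add: tilt_def)
  moreover have "(1 - tilt p t) / (1 - p) = 1 / ?Z"
    using p Z by (simp add: tilt_def diff_divide_eq_iff)
  ultimately show ?thesis using Z by (simp add: h_def ln_div algebra_simps)
qed

text \<open>Completing the square with coefficient \<open>c\<close> turns Legendre duality into
  \<open>c * Y^2\<close> plus a constant minus a deficit. Above the threshold the deficit is
  nonnegative, and the tilt of the discrepancy is paid from it.\<close>

lemma log_mgf_eq_excess:
  fixes p r Y :: real
  assumes p: "0 < p" "p < 1"
  defines "c \<equiv> curv p r"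
  shows "ln (p * exp (2 * c * Y) + (1 - p))
    = c * Y\<^sup>2 + c * r\<^sup>2 - h p r - (excess p r (tilt p (2 * c * Y)) + c * (tilt p (2 * c * Y) - Y)\<^sup>2)"
  unfolding log_mgf_eq[OF p] excess_def c_def by (simp add: power2_eq_square algebra_simps)

lemma continuous_on_excess:
  assumes "0 < p" "p < 1"
  shows "continuous_on {0..1} (excess p r)"
proof -
  have "continuous_on {0..1} (\<lambda>x. (ent x + x * ln ((1 - p) / p) - ln (1 - p)) - h p r - curv p r * (x\<^sup>2 - r\<^sup>2))"
    by (intro continuous_intros continuous_on_ent)
  then show ?thesis
    by (rule continuous_on_eq) (use assms in \<open>auto simp: excess_def h_eq_ent\<close>)
qed

text \<open>\<open>Y\<close> stands for the weight \<open>n r y_i y_j\<close> of a pair and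
  \<open>x\<close> for its edge density after tilting. The deviation of \<open>x\<close> from
  \<open>r\<close> is charged to affordable quantities: the deficit of
  \<open>log_mgf_eq_excess\<close>, and \<open>r^2 - Y^2\<close>, which sums to O(n) by
  \<open>grid_vector_squares\<close>.\<close>

definition tilt_close :: "real \<Rightarrow> real \<Rightarrow> real \<Rightarrow> real \<Rightarrow> real \<Rightarrow> bool" where
  "tilt_close p r \<eta> K K' \<longleftrightarrow> (\<forall>Y\<in>{0..1 / r}. let x = tilt p (2 * curv p r * Y) in
     \<bar>x - r\<bar> \<le> \<eta> + K * (excess p r x + curv p r * (x - Y)\<^sup>2) + K' * (r\<^sup>2 - Y\<^sup>2))"

text \<open>At the threshold itself \<open>excess p r\<close> also vanishes at \<open>1 - r\<close>; there the last term, whose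
  sum over all pairs is negligible, takes over.\<close>

lemma tilt_deviation_bound:
  assumes p: "0 < p" "p < 1" and r: "0 < r" "r < 1" and pr: "p \<le> r" and t: "threshold r \<le> p" and \<eta>: "0 < \<eta>"
  shows "\<exists>K\<ge>0. \<exists>K'. tilt_close p r \<eta> K K'"
proof -
  define c where "c = curv p r"
  \<comment> \<open>At the second contact point \<open>1 - r\<close> the choice gives
    \<open>K' * (r^2 - (1 - r)^2) = 1\<close>, more than the deviation of \<open>1 - r\<close> from
    \<open>r\<close>.\<close>
  define K' where "K' = (if c = slope r \<and> r \<noteq> 1 / 2 then 1 / (2 * r - 1) else 0)"
  let ?G = "\<lambda>x. \<bar>x - r\<bar> - K' * (r\<^sup>2 - x\<^sup>2)"
  have c: "0 \<le> c" unfolding c_def using p pr r by (intro curv_nonneg) auto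
  have "\<exists>K\<ge>0. \<forall>x\<in>{0..1}. ?G x \<le> \<eta> / 2 + K * excess p r x"
  proof (rule compact_penalty)
    show "continuous_on {0..1} (excess p r)" by (rule continuous_on_excess[OF p])
    show "continuous_on {0..1} ?G" by (intro continuous_intros)
    fix x :: real assume x: "x \<in> {0..1}"
    then show "0 \<le> excess p r x" using excess_nonneg(1)[OF p r t] by simp
    assume "excess p r x = 0"
    then have "x = r \<or> x = 1 - r \<and> c = slope r"
      unfolding c_def using x by (intro excess_nonneg(2)[OF p r t]) auto
    moreover have "?G (1 - r) \<le> 0" if "c = slope r" "r \<noteq> 1 / 2"
    proof -
      have "r\<^sup>2 - (1 - r)\<^sup>2 = 2 * r - 1" by (simp add: power2_eq_square algebra_simps)
      then have "K' * (r\<^sup>2 - (1 - r)\<^sup>2) = 1" using that by (simp add: K'_def)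
      then show ?thesis using r by simp
    qed
    ultimately show "?G x \<le> 0" by (cases "x = r") auto
  qed (use \<eta> in simp)
  then obtain K where K: "0 \<le> K" "\<And>x. x \<in> {0..1} \<Longrightarrow> ?G x \<le> \<eta> / 2 + K * excess p r x" by blast
  \<comment> \<open>Replacing \<open>x^2\<close> by \<open>Y^2\<close> in the penalty costs at most
    \<open>b\<close> times the distance of \<open>x\<close> and \<open>Y\<close>; Young's inequality
    splits this into \<open>\<eta> / 2\<close> and a multiple of \<open>c * (x - Y)^2\<close>. If
    \<open>K' \<noteq> 0\<close> then \<open>c = slope r\<close> is positive, so the division by
    \<open>c\<close> is sound.\<close>
  define b where "b = \<bar>K'\<bar> * (1 + 1 / r)"
  define K2 where "K2 = (if K' = 0 then 0 else b\<^sup>2 / (2 * \<eta> * c))"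
  have c_pos: "0 < c" if "K' \<noteq> 0" using that slope_pos[OF r] by (auto simp: K'_def split: if_splits)
  have K2: "0 \<le> K2" using c \<eta> by (auto simp: K2_def)
  show ?thesis
    unfolding tilt_close_def c_def[symmetric] Let_def
  proof (rule exI[of _ "K + K2"], rule conjI, use K K2 in simp, rule exI[of _ K'], rule ballI)
    fix Y :: real assume Y: "Y \<in> {0..1 / r}"
    define x where "x = tilt p (2 * c * Y)"
    have x: "0 < x" "x < 1" unfolding x_def using tilt_bounds[OF p] by blast+
    have ex: "0 \<le> excess p r x" using excess_nonneg(1)[OF p r t] x by simp
    have 1: "\<bar>x - r\<bar> \<le> \<eta> / 2 + K * excess p r x + K' * (r\<^sup>2 - Y\<^sup>2) + K' * (Y\<^sup>2 - x\<^sup>2)"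
      using K(2)[of x] x by (simp add: algebra_simps)
    have 2: "K' * (Y\<^sup>2 - x\<^sup>2) \<le> \<eta> / 2 + K2 * (c * (x - Y)\<^sup>2)"
    proof (cases "K' = 0")
      case True
      then show ?thesis using \<eta> by (simp add: K2_def)
    next
      case False
      have "K' * (Y\<^sup>2 - x\<^sup>2) \<le> \<bar>K' * (Y\<^sup>2 - x\<^sup>2)\<bar>" by simp
      also have "\<dots> = \<bar>K'\<bar> * ((x + Y) * \<bar>x - Y\<bar>)"
      proof -
        have "Y\<^sup>2 - x\<^sup>2 = - ((x + Y) * (x - Y))" by (simp add: power2_eq_square algebra_simps)
        then show ?thesis using x Y by (simp add: abs_mult)
      qed
      also have "\<dots> \<le> \<bar>K'\<bar> * ((1 + 1 / r) * \<bar>x - Y\<bar>)"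
        using x Y by (intro mult_left_mono mult_right_mono add_mono) auto
      also have "\<dots> = b * \<bar>x - Y\<bar>" by (simp add: b_def mult.assoc)
      also have "\<dots> \<le> \<eta> / 2 + b\<^sup>2 / (2 * \<eta>) * (x - Y)\<^sup>2"
      proof -
        have "0 \<le> (\<eta> - b * \<bar>x - Y\<bar>)\<^sup>2" by simp
        then have "2 * \<eta> * (b * \<bar>x - Y\<bar>) \<le> \<eta>\<^sup>2 + b\<^sup>2 * (x - Y)\<^sup>2"
          by (simp add: power2_diff power_mult_distrib algebra_simps)
        then have "b * \<bar>x - Y\<bar> \<le> (\<eta>\<^sup>2 + b\<^sup>2 * (x - Y)\<^sup>2) / (2 * \<eta>)"
          using \<eta> by (subst pos_le_divide_eq) (auto simp: mult_ac)
        also have "\<dots> = \<eta> / 2 + b\<^sup>2 / (2 * \<eta>) * (x - Y)\<^sup>2"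
          using \<eta> by (simp add: add_divide_distrib power2_eq_square)
        finally show ?thesis .
      qed
      also have "b\<^sup>2 / (2 * \<eta>) * (x - Y)\<^sup>2 = K2 * (c * (x - Y)\<^sup>2)"
        using c_pos[OF False] False by (simp add: K2_def)
      finally show ?thesis by simp
    qed
    have "0 \<le> K * (c * (x - Y)\<^sup>2)" "0 \<le> K2 * excess p r x"
      using K K2 c ex by auto
    then show "\<bar>tilt p (2 * c * Y) - r\<bar>
        \<le> \<eta> + (K + K2) * (excess p r (tilt p (2 * c * Y)) + c * (tilt p (2 * c * Y) - Y)\<^sup>2) + K' * (r\<^sup>2 - Y\<^sup>2)"
      using 1 2 unfolding x_def[symmetric] by (simp add: algebra_simps)
  qed
qed

section \<open>Upper bounds above the threshold\<close>

lemma sum_pairs_square: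
  fixes y :: "nat \<Rightarrow> real"
  shows "2 * (\<Sum>e\<in>all_pairs n. (prod y e)\<^sup>2) = (\<Sum>i<n. (y i)\<^sup>2)\<^sup>2 - (\<Sum>i<n. (y i) ^ 4)"
proof -
  have "2 * (\<Sum>e\<in>all_pairs n. (prod y e)\<^sup>2) = (\<Sum>i<n. \<Sum>j<n. if i \<noteq> j then (prod y {i, j})\<^sup>2 else 0)"
    by (rule sum_ordered_pairs_sym[symmetric])
  also have "\<dots> = (\<Sum>i<n. \<Sum>j<n. (y i)\<^sup>2 * (y j)\<^sup>2 - (if i = j then (y i) ^ 4 else 0))"
    by (intro sum.cong refl) (auto simp: power_mult_distrib power2_eq_square power4_eq_xxxx)
  also have "\<dots> = (\<Sum>i<n. \<Sum>j<n. (y i)\<^sup>2 * (y j)\<^sup>2) - (\<Sum>i<n. (y i) ^ 4)"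
    by (simp add: sum_subtractf)
  finally show ?thesis by (simp add: power2_eq_square[of "\<Sum>i<n. (y i)\<^sup>2"] sum_product)
qed

text \<open>The norm fixes the sum of all \<open>Y^2\<close> up to the diagonal, and the diagonal
  involves the sum of \<open>y^4\<close>, which is O(1 / n) since the entries are O(1 / sqrt n).
  Single terms \<open>r^2 - Y^2\<close> need not be small; only their sum is.\<close>

lemma grid_vector_squares:
  fixes y :: "nat \<Rightarrow> real"
  assumes n: "0 < n" and r: "0 < r" "r < 1"
    and y: "\<forall>i<n. 0 \<le> y i \<and> y i \<le> 1 / (r * sqrt n)" "(\<Sum>i<n. (y i)\<^sup>2) \<le> 1" "1 - 2 / real n \<le> (\<Sum>i<n. (y i)\<^sup>2)"
  defines "Y \<equiv> \<lambda>e. real n * r * prod y e"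
  shows "\<And>e. e \<in> all_pairs n \<Longrightarrow> 0 \<le> Y e \<and> Y e \<le> 1 / r"
    and "(\<Sum>e\<in>all_pairs n. (Y e)\<^sup>2) \<le> (real n)\<^sup>2 * r\<^sup>2 / 2"
    and "\<bar>\<Sum>e\<in>all_pairs n. r\<^sup>2 - (Y e)\<^sup>2\<bar> \<le> 3 * real n"
proof -
  let ?s = "\<Sum>i<n. (y i)\<^sup>2" and ?f = "\<Sum>i<n. (y i) ^ 4"
  have n': "1 \<le> real n" using n by simp
  show "0 \<le> Y e \<and> Y e \<le> 1 / r" if "e \<in> all_pairs n" for e
  proof -
    have b: "0 \<le> y (Min e)" "y (Min e) \<le> 1 / (r * sqrt n)" "0 \<le> y (Max e)" "y (Max e) \<le> 1 / (r * sqrt n)"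
      using y(1) pair_Min_Max(2,3)[OF that] by auto
    then have "prod y e \<le> 1 / (r * sqrt n) * (1 / (r * sqrt n))"
      unfolding prod_pair[OF that] using r by (intro mult_mono) auto
    also have "\<dots> = 1 / (r * r * real n)" by simp
    finally have "real n * r * prod y e \<le> real n * r * (1 / (r * r * real n))"
      using r by (intro mult_left_mono) auto
    also have "\<dots> = 1 / r" using n r by simp
    finally show ?thesis using b r by (simp add: Y_def prod_pair[OF that])
  qed
  have sq: "(\<Sum>e\<in>all_pairs n. (Y e)\<^sup>2) = (real n)\<^sup>2 * r\<^sup>2 / 2 * (?s\<^sup>2 - ?f)"
  proof -
    have "(\<Sum>e\<in>all_pairs n. (Y e)\<^sup>2) = (real n)\<^sup>2 * r\<^sup>2 * (\<Sum>e\<in>all_pairs n. (prod y e)\<^sup>2)"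
      unfolding Y_def power_mult_distrib sum_distrib_left ..
    moreover have "(\<Sum>e\<in>all_pairs n. (prod y e)\<^sup>2) = (?s\<^sup>2 - ?f) / 2" using sum_pairs_square[where y = y and n = n] by simp
    ultimately show ?thesis by simp
  qed
  have s0: "0 \<le> ?s" by (intro sum_nonneg) auto
  have f0: "0 \<le> ?f" by (intro sum_nonneg) auto
  have s1: "?s\<^sup>2 \<le> 1" using y(2) s0 by (simp add: abs_square_le_1)
  have f1: "?f \<le> 1 / (r\<^sup>2 * real n)"
  proof -
    have "?f \<le> (\<Sum>i<n. 1 / (r\<^sup>2 * real n) * (y i)\<^sup>2)"
    proof (rule sum_mono)
      fix i assume "i \<in> {..<n}"
      then have "(y i)\<^sup>2 \<le> (1 / (r * sqrt n))\<^sup>2" using y(1) by (intro power_mono) auto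
      also have "\<dots> = 1 / (r\<^sup>2 * real n)" by (simp add: power_divide power_mult_distrib)
      finally have "(y i)\<^sup>2 * (y i)\<^sup>2 \<le> 1 / (r\<^sup>2 * real n) * (y i)\<^sup>2" by (intro mult_right_mono) auto
      then show "(y i) ^ 4 \<le> 1 / (r\<^sup>2 * real n) * (y i)\<^sup>2" by (simp add: power2_eq_square power4_eq_xxxx mult.assoc)
    qed
    also have "\<dots> = 1 / (r\<^sup>2 * real n) * ?s" by (rule sum_distrib_left[symmetric])
    also have "\<dots> \<le> 1 / (r\<^sup>2 * real n) * 1" using y(2) by (intro mult_left_mono) auto
    finally show ?thesis by simp
  qed
  have s2: "1 - 4 / real n \<le> ?s\<^sup>2"
  proof -
    have "0 \<le> (?s - 1)\<^sup>2" by simp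
    then have "2 * ?s - 1 \<le> ?s\<^sup>2" by (simp add: power2_diff)
    then show ?thesis using y(3) by simp
  qed
  have A: "0 \<le> (real n)\<^sup>2 * r\<^sup>2 / 2" by simp
  have "(real n)\<^sup>2 * r\<^sup>2 / 2 * (?s\<^sup>2 - ?f) \<le> (real n)\<^sup>2 * r\<^sup>2 / 2 * 1"
    using s1 f0 by (intro mult_left_mono A) auto
  then show up: "(\<Sum>e\<in>all_pairs n. (Y e)\<^sup>2) \<le> (real n)\<^sup>2 * r\<^sup>2 / 2" unfolding sq by simp
  have rr: "r\<^sup>2 \<le> 1" using r by (simp add: abs_square_le_1)
  have sub: "(\<Sum>e\<in>all_pairs n. r\<^sup>2 - (Y e)\<^sup>2) = (real n)\<^sup>2 * r\<^sup>2 / 2 - real n * r\<^sup>2 / 2 - (\<Sum>e\<in>all_pairs n. (Y e)\<^sup>2)"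
    by (simp add: sum_subtractf card_all_pairs real_choose_two power2_eq_square field_simps)
  have "(real n)\<^sup>2 * r\<^sup>2 / 2 * (1 - (4 / real n + 1 / (r\<^sup>2 * real n))) \<le> (real n)\<^sup>2 * r\<^sup>2 / 2 * (?s\<^sup>2 - ?f)"
    using s2 f1 by (intro mult_left_mono A) auto
  moreover have "(real n)\<^sup>2 * r\<^sup>2 / 2 * (1 - (4 / real n + 1 / (r\<^sup>2 * real n)))
      = (real n)\<^sup>2 * r\<^sup>2 / 2 - 2 * real n * r\<^sup>2 - real n / 2"
    using n r by (simp add: field_simps power2_eq_square)
  moreover have "real n * r\<^sup>2 \<le> real n * 1" using rr by (intro mult_left_mono) auto
  moreover have "0 \<le> real n * r\<^sup>2" by simp
  ultimately show "\<bar>\<Sum>e\<in>all_pairs n. r\<^sup>2 - (Y e)\<^sup>2\<bar> \<le> 3 * real n"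
    using up n' unfolding sub sq by linarith
qed

text \<open>The discrepancy centred at density \<open>r\<close>, with arbitrary weights on pairs:
  signed cut weights give the cut distance, zero weights the plain eigenvalue bound.\<close>

definition cut_sum :: "nat \<Rightarrow> real \<Rightarrow> (nat set \<Rightarrow> real) \<Rightarrow> nat set set \<Rightarrow> real" where
  "cut_sum n r w G = (\<Sum>e\<in>all_pairs n. w e * (if e \<in> G then 1 - r else - r))"

text \<open>The Chernoff weights \<open>2 * c * Y e\<close> produce the cost \<open>h p r\<close>
  per pair, and \<open>\<theta> * w e\<close> tests the discrepancy. After the first tilt the edge
  density is \<open>x\<close> and not \<open>r\<close>; \<open>tilt_close\<close> pays for this
  shift.\<close>

lemma vector_tail:
  assumes n: "0 < n" and p: "0 < p" "p < 1" and r: "0 < r" "r < 1" and pr: "p \<le> r"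
    and \<theta>: "0 \<le> \<theta>" "\<theta> \<le> 1 / 2" "2 * \<theta> * K \<le> 1" and w: "\<And>e. e \<in> all_pairs n \<Longrightarrow> \<bar>w e\<bar> \<le> 2"
    and t: "threshold r \<le> p"
    and dev: "tilt_close p r \<eta> K K'" and \<eta>: "0 \<le> \<eta>"
  shows "prb (all_pairs n) (\<lambda>_. p) (\<lambda>G. grid_event r n y G \<and> b \<le> cut_sum n r w G)
    \<le> exp (- real (n choose 2) * h p r + (2 * curv p r * r + 6 * \<theta> * \<bar>K'\<bar>) * real n
        + (\<theta> * \<eta> + 2 * \<theta>\<^sup>2) * (real n)\<^sup>2 - \<theta> * b)"
    (is "?P \<le> ?R")
\<comment> \<open>A graph in the event certifies the conditions on \<open>y\<close>; without one the
  probability is 0.\<close>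
proof (cases "\<exists>G. grid_event r n y G")
  case False
  then have "?P = 0" unfolding prb_def by simp
  then show ?thesis by simp
next
  case True
  then have y: "\<forall>i<n. 0 \<le> y i \<and> y i \<le> 1 / (r * sqrt n)" "(\<Sum>i<n. (y i)\<^sup>2) \<le> 1" "1 - 2 / real n \<le> (\<Sum>i<n. (y i)\<^sup>2)"
    by (auto simp: grid_event_def)
  define c where "c = curv p r"
  have c: "0 \<le> c" unfolding c_def using p(1) pr r(2) by (rule curv_nonneg)
  define Y where "Y e = real n * r * prod y e" for e
  note Y = grid_vector_squares[OF n r y, folded Y_def]
  define u where "u e = 2 * c * Y e + \<theta> * w e * (1 - r)" for e
  define v where "v e = - (\<theta> * w e * r)" for e
  let ?E = "all_pairs n"
  have "?P \<le> exp (- (c * r\<^sup>2 * (real n)\<^sup>2 - 2 * c * r * real n + \<theta> * b))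
      * (\<Prod>e\<in>?E. p * exp (u e) + (1 - p) * exp (v e))"
  proof (rule chernoff[OF finite_all_pairs])
    fix G assume G: "G \<subseteq> ?E" and ev: "grid_event r n y G \<and> b \<le> cut_sum n r w G"
    have "c * real n * r * (real n * r - 2) \<le> c * real n * r * bil n G y y"
      using ev c r by (intro mult_left_mono) (auto simp: grid_event_def)
    moreover have "c * real n * r * bil n G y y = (\<Sum>e\<in>?E. if e \<in> G then 2 * c * Y e else 0)"
      unfolding quadratic_eq_sum_pairs[OF G] sum_distrib_left Y_def by (intro sum.cong) auto
    moreover have "\<theta> * b \<le> \<theta> * cut_sum n r w G" using ev \<theta> by (intro mult_left_mono) auto
    moreover have "(\<Sum>e\<in>?E. if e \<in> G then u e else v e)
        = (\<Sum>e\<in>?E. if e \<in> G then 2 * c * Y e else 0) + \<theta> * cut_sum n r w G"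
      unfolding cut_sum_def sum_distrib_left sum.distrib[symmetric] u_def v_def by (intro sum.cong) auto
    ultimately show "c * r\<^sup>2 * (real n)\<^sup>2 - 2 * c * r * real n + \<theta> * b \<le> (\<Sum>e\<in>?E. if e \<in> G then u e else v e)"
      by (simp add: power2_eq_square algebra_simps)
  qed (use p in auto)
  also have "(\<Prod>e\<in>?E. p * exp (u e) + (1 - p) * exp (v e))
      \<le> (\<Prod>e\<in>?E. exp (c * (Y e)\<^sup>2 + (c * r\<^sup>2 - h p r + 2 * \<theta> * \<eta> + 4 * \<theta>\<^sup>2) + 2 * \<theta> * K' * (r\<^sup>2 - (Y e)\<^sup>2)))"
  proof (intro prod_mono conjI)
    fix e assume e: "e \<in> ?E"
    show "0 \<le> p * exp (u e) + (1 - p) * exp (v e)" using p by simp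
    define Z where "Z = p * exp (2 * c * Y e) + (1 - p)"
    define x where "x = tilt p (2 * c * Y e)"
    define D where "D = excess p r x + c * (x - Y e)\<^sup>2"
    have Z: "0 < Z" unfolding Z_def using p by (intro add_pos_pos) auto
    have x: "0 < x" "x < 1" unfolding x_def using tilt_bounds[OF p] by blast+
    have D: "0 \<le> D" unfolding D_def using excess_nonneg(1)[OF p r t] x c by simp
    have tw: "\<bar>\<theta> * w e\<bar> \<le> 2 * \<theta>" using \<theta>(1) mult_left_mono[OF w[OF e] \<theta>(1)] by (simp add: abs_mult mult.commute)
    \<comment> \<open>Dividing by \<open>Z\<close> turns the factor into the moment generating
      function of a Bernoulli variable of mean \<open>x\<close>.\<close>
    have xZ: "x * Z = p * exp (2 * c * Y e)" "(1 - x) * Z = 1 - p"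
      using Z unfolding x_def tilt_def Z_def[symmetric] by (simp_all add: left_diff_distrib) (simp add: Z_def)
    have "p * exp (u e) + (1 - p) * exp (v e)
        = exp (v e) * (p * exp (2 * c * Y e) * exp (\<theta> * w e) + (1 - p))"
    proof -
      have "u e = v e + 2 * c * Y e + \<theta> * w e" by (simp add: u_def v_def algebra_simps)
      then show ?thesis by (simp add: exp_add algebra_simps)
    qed
    also have "\<dots> = exp (v e) * (Z * (x * exp (\<theta> * w e) + (1 - x)))"
      unfolding xZ(1)[symmetric] xZ(2)[symmetric] by (simp add: algebra_simps)
    also have "\<dots> \<le> exp (v e) * (Z * exp (x * (\<theta> * w e) + (\<theta> * w e)\<^sup>2))"
      using x Z tw \<theta> by (intro mult_left_mono bernoulli_mgf_le) auto
    also have "\<dots> = exp (ln Z + (x - r) * (\<theta> * w e) + (\<theta> * w e)\<^sup>2)"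
      using Z by (simp add: exp_add v_def left_diff_distrib exp_diff exp_minus field_simps)
    also have "\<dots> \<le> exp (c * (Y e)\<^sup>2 + (c * r\<^sup>2 - h p r + 2 * \<theta> * \<eta> + 4 * \<theta>\<^sup>2) + 2 * \<theta> * K' * (r\<^sup>2 - (Y e)\<^sup>2))"
    proof (simp only: exp_le_cancel_iff)
      have lnZ: "ln Z = c * (Y e)\<^sup>2 + c * r\<^sup>2 - h p r - D"
        unfolding Z_def D_def x_def c_def by (rule log_mgf_eq_excess[OF p])
      have "(\<theta> * w e)\<^sup>2 \<le> (2 * \<theta>)\<^sup>2" using tw by (metis abs_ge_zero power2_abs power_mono)
      then have sq: "(\<theta> * w e)\<^sup>2 \<le> 4 * \<theta>\<^sup>2" by (simp add: power_mult_distrib)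
      have "(x - r) * (\<theta> * w e) \<le> \<bar>(x - r) * (\<theta> * w e)\<bar>" by simp
      also have "\<dots> = \<bar>x - r\<bar> * \<bar>\<theta> * w e\<bar>" by (rule abs_mult)
      also have "\<dots> \<le> \<bar>x - r\<bar> * (2 * \<theta>)" using tw by (intro mult_left_mono) auto
      also have "\<dots> \<le> (\<eta> + K * D + K' * (r\<^sup>2 - (Y e)\<^sup>2)) * (2 * \<theta>)"
      proof (rule mult_right_mono)
        have "Y e \<in> {0..1 / r}" using Y(1)[OF e] by simp
        then show "\<bar>x - r\<bar> \<le> \<eta> + K * D + K' * (r\<^sup>2 - (Y e)\<^sup>2)"
          using dev unfolding tilt_close_def Let_def x_def D_def c_def by blast
      qed (use \<theta> in simp)
      also have "\<dots> = 2 * \<theta> * \<eta> + (2 * \<theta> * K) * D + 2 * \<theta> * K' * (r\<^sup>2 - (Y e)\<^sup>2)"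
        by (simp add: algebra_simps)
      finally have lin: "(x - r) * (\<theta> * w e) \<le> 2 * \<theta> * \<eta> + (2 * \<theta> * K) * D + 2 * \<theta> * K' * (r\<^sup>2 - (Y e)\<^sup>2)" .
      \<comment> \<open>The deficit \<open>D\<close> subtracted in \<open>ln Z\<close> absorbs the
        penalty.\<close>
      have "(2 * \<theta> * K) * D \<le> 1 * D" using \<theta>(3) D by (rule mult_right_mono)
      then show "ln Z + (x - r) * (\<theta> * w e) + (\<theta> * w e)\<^sup>2
          \<le> c * (Y e)\<^sup>2 + (c * r\<^sup>2 - h p r + 2 * \<theta> * \<eta> + 4 * \<theta>\<^sup>2) + 2 * \<theta> * K' * (r\<^sup>2 - (Y e)\<^sup>2)"
        using lin sq unfolding lnZ by linarith
    qed
    finally show "p * exp (u e) + (1 - p) * exp (v e)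
      \<le> exp (c * (Y e)\<^sup>2 + (c * r\<^sup>2 - h p r + 2 * \<theta> * \<eta> + 4 * \<theta>\<^sup>2) + 2 * \<theta> * K' * (r\<^sup>2 - (Y e)\<^sup>2))" .
  qed
  also have "\<dots> = exp (c * (\<Sum>e\<in>?E. (Y e)\<^sup>2) + real (n choose 2) * (c * r\<^sup>2 - h p r + 2 * \<theta> * \<eta> + 4 * \<theta>\<^sup>2)
      + 2 * \<theta> * (K' * (\<Sum>e\<in>?E. r\<^sup>2 - (Y e)\<^sup>2)))"
    unfolding exp_sum[OF finite_all_pairs, symmetric] sum.distrib sum_distrib_left
    by (simp add: card_all_pairs mult.assoc distrib_left right_diff_distrib)
  \<comment> \<open>Only nonnegative terms are enlarged by \<open>choose_two_le\<close>; the
    negative term with \<open>h p r\<close> keeps its exact factor.\<close>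
  also have "\<dots> \<le> exp (c * ((real n)\<^sup>2 * r\<^sup>2 / 2) + ((real n)\<^sup>2 / 2 * (c * r\<^sup>2 + 2 * \<theta> * \<eta> + 4 * \<theta>\<^sup>2) - real (n choose 2) * h p r)
      + 2 * \<theta> * (\<bar>K'\<bar> * (3 * real n)))"
  proof (simp only: exp_le_cancel_iff, intro add_mono mult_left_mono)
    show "(\<Sum>e\<in>?E. (Y e)\<^sup>2) \<le> (real n)\<^sup>2 * r\<^sup>2 / 2" by (rule Y(2))
    have "real (n choose 2) * (c * r\<^sup>2 + 2 * \<theta> * \<eta> + 4 * \<theta>\<^sup>2) \<le> (real n)\<^sup>2 / 2 * (c * r\<^sup>2 + 2 * \<theta> * \<eta> + 4 * \<theta>\<^sup>2)"
      using c \<theta> \<eta> by (intro mult_right_mono choose_two_le) auto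
    then show "real (n choose 2) * (c * r\<^sup>2 - h p r + 2 * \<theta> * \<eta> + 4 * \<theta>\<^sup>2)
        \<le> (real n)\<^sup>2 / 2 * (c * r\<^sup>2 + 2 * \<theta> * \<eta> + 4 * \<theta>\<^sup>2) - real (n choose 2) * h p r"
      by (simp add: algebra_simps)
    have "K' * (\<Sum>e\<in>?E. r\<^sup>2 - (Y e)\<^sup>2) \<le> \<bar>K'\<bar> * \<bar>\<Sum>e\<in>?E. r\<^sup>2 - (Y e)\<^sup>2\<bar>"
      by (metis abs_ge_self abs_mult)
    also have "\<dots> \<le> \<bar>K'\<bar> * (3 * real n)" using Y(3) by (intro mult_left_mono) auto
    finally show "K' * (\<Sum>e\<in>?E. r\<^sup>2 - (Y e)\<^sup>2) \<le> \<bar>K'\<bar> * (3 * real n)" .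
  qed (use c \<theta> in auto)
  also have "exp (- (c * r\<^sup>2 * (real n)\<^sup>2 - 2 * c * r * real n + \<theta> * b))
      * exp (c * ((real n)\<^sup>2 * r\<^sup>2 / 2) + ((real n)\<^sup>2 / 2 * (c * r\<^sup>2 + 2 * \<theta> * \<eta> + 4 * \<theta>\<^sup>2) - real (n choose 2) * h p r)
      + 2 * \<theta> * (\<bar>K'\<bar> * (3 * real n))) = ?R"
    unfolding exp_add[symmetric] c_def[symmetric] by (simp add: algebra_simps add_divide_distrib[symmetric])
  finally show ?thesis by simp
qed

lemma eig_prob_upper:
  assumes n: "0 < n" and p: "0 < p" "p < 1" and r: "0 < r" "r < 1" and pr: "p \<le> r" and t: "threshold r \<le> p"
  shows "eig_prob p r n \<le> ((real n)\<^sup>2 + 1) ^ n * exp (- real (n choose 2) * h p r + 2 * curv p r * r * real n)"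
proof -
  let ?P = "\<lambda>Q. prb (all_pairs n) (\<lambda>_. p) Q"
  let ?B = "exp (- real (n choose 2) * h p r + 2 * curv p r * r * real n)"
  have one: "(0::real) < 1" by simp
  \<comment> \<open>With \<open>\<theta> = 0\<close> the discrepancy drops out of
    \<open>vector_tail\<close>, so any \<open>\<eta>\<close> and the resulting constants will
    do.\<close>
  obtain K K' where "0 \<le> K" and dev: "tilt_close p r 1 K K'"
    using tilt_deviation_bound[OF p r pr t one] by blast
  have "eig_prob p r n \<le> ?P (\<lambda>G. \<exists>y\<in>grid n. grid_event r n y G \<and> 0 \<le> cut_sum n r (\<lambda>_. 0) G)"
    unfolding eig_prob_def using p grid_vector_exists[OF n r(1)]
    by (intro prb_mono finite_all_pairs) (auto simp: cut_sum_def)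
  also have "\<dots> \<le> (\<Sum>y\<in>grid n. ?P (\<lambda>G. grid_event r n y G \<and> 0 \<le> cut_sum n r (\<lambda>_. 0) G))"
    using p by (intro prb_Bex_le finite_all_pairs finite_grid) auto
  also have "\<dots> \<le> (\<Sum>y\<in>grid n. ?B)"
  proof (rule sum_mono)
    fix y
    show "?P (\<lambda>G. grid_event r n y G \<and> 0 \<le> cut_sum n r (\<lambda>_. 0) G) \<le> ?B"
      using vector_tail[OF n p r pr, of 0 K "\<lambda>_. 0" 1 K' y 0] dev t by simp
  qed
  also have "\<dots> = real (card (grid n)) * ?B" by simp
  also have "\<dots> \<le> real ((n\<^sup>2 + 1) ^ n) * ?B"
    using of_nat_mono[OF card_grid_le[of n]] by (intro mult_right_mono) auto
  finally show ?thesis by (simp add: add.commute)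
qed

section \<open>The cut distance\<close>

definition cut_weight :: "nat set \<Rightarrow> nat set \<Rightarrow> nat set \<Rightarrow> real" where
  "cut_weight A B e = indicator A (Min e) * indicator B (Max e) + indicator A (Max e) * indicator B (Min e)"

lemma edge_count_eq_bil:
  assumes "A \<subseteq> {..<n}" "B \<subseteq> {..<n}"
  shows "real (edge_count G A B) = bil n G (indicator A) (indicator B)"
proof -
  have eq: "{(a, b). a \<in> A \<and> b \<in> B \<and> {a, b} \<in> G}
      = {x \<in> {..<n} \<times> {..<n}. fst x \<in> A \<and> snd x \<in> B \<and> {fst x, snd x} \<in> G}"
    using assms by auto
  have "real (edge_count G A B)
      = (\<Sum>x\<in>{..<n} \<times> {..<n}. if fst x \<in> A \<and> snd x \<in> B \<and> {fst x, snd x} \<in> G then 1 else 0)"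
    unfolding edge_count_def eq by (simp add: sum.inter_filter[symmetric])
  also have "\<dots> = (\<Sum>i<n. \<Sum>j<n. if i \<in> A \<and> j \<in> B \<and> {i, j} \<in> G then 1 else 0)"
    by (simp add: sum.cartesian_product case_prod_beta)
  also have "\<dots> = bil n G (indicator A) (indicator B)"
    unfolding bil_def by (intro sum.cong refl) (auto simp: indicator_def)
  finally show ?thesis .
qed

lemma card_mult_eq:
  assumes "A \<subseteq> {..<n}" "B \<subseteq> {..<n}"
  shows "real (card A) * real (card B) = (\<Sum>e\<in>all_pairs n. cut_weight A B e) + real (card (A \<inter> B))"
proof -
  have c: "real (card A) = (\<Sum>i<n. indicator A i)" if "A \<subseteq> {..<n}" for A
    using that by (simp add: indicator_def sum.If_cases Int_absorb1)
  let ?H = "\<lambda>i j. indicator A i * indicator B j :: real"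
  have "real (card A) * real (card B) = (\<Sum>i<n. \<Sum>j<n. ?H i j)"
    unfolding c[OF assms(1)] c[OF assms(2)] by (rule sum_product)
  also have "\<dots> = (\<Sum>i<n. \<Sum>j<n. (if i \<noteq> j then ?H i j else 0) + (if i = j then ?H i i else 0))"
    by (intro sum.cong refl) auto
  also have "\<dots> = (\<Sum>i<n. \<Sum>j<n. if i \<noteq> j then ?H i j else 0) + (\<Sum>i<n. ?H i i)"
    by (simp add: sum.distrib)
  also have "(\<Sum>i<n. \<Sum>j<n. if i \<noteq> j then ?H i j else 0) = (\<Sum>e\<in>all_pairs n. cut_weight A B e)"
    unfolding cut_weight_def by (rule sum_ordered_pairs)
  also have "(\<Sum>i<n. ?H i i) = real (card (A \<inter> B))"
    using assms by (subst c) (auto simp: indicator_inter_arith)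
  finally show ?thesis .
qed

text \<open>The product of the cardinalities counts diagonal pairs, while the graph has no loops;
  the correction is at most \<open>n\<close> and so negligible on the scale
  \<open>n^2\<close>.\<close>

lemma cut_difference_eq:
  assumes G: "G \<subseteq> all_pairs n" and AB: "A \<subseteq> {..<n}" "B \<subseteq> {..<n}"
  shows "real (edge_count G A B) - r * real (card A) * real (card B)
    = cut_sum n r (cut_weight A B) G - r * real (card (A \<inter> B))"
proof -
  have "cut_sum n r (cut_weight A B) G = (\<Sum>e\<in>all_pairs n. (if e \<in> G then cut_weight A B e else 0) - r * cut_weight A B e)"
    unfolding cut_sum_def by (intro sum.cong refl) (simp add: algebra_simps)
  also have "\<dots> = real (edge_count G A B) - r * (\<Sum>e\<in>all_pairs n. cut_weight A B e)"
    unfolding edge_count_eq_bil[OF AB] bil_eq_sum_pairs[OF G] cut_weight_def sum_subtractf sum_distrib_left ..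
  also have "\<dots> = real (edge_count G A B) - r * (real (card A) * real (card B) - real (card (A \<inter> B)))"
    unfolding card_mult_eq[OF AB] by simp
  finally show ?thesis by (simp add: algebra_simps)
qed

lemma cut_dist_bounds:
  assumes AB: "A \<subseteq> {..<n}" "B \<subseteq> {..<n}"
  shows "1 / (real n)\<^sup>2 * \<bar>real (edge_count G A B) - r * real (card A) * real (card B)\<bar> \<le> cut_dist {..<n} G r"
proof -
  let ?F = "\<lambda>(A, B). 1 / (real (card {..<n}))\<^sup>2 * \<bar>real (edge_count G A B) - r * real (card A) * real (card B)\<bar>"
  have "?F (A, B) \<le> (SUP x\<in>Pow {..<n} \<times> Pow {..<n}. ?F x)"
    using AB by (intro cSUP_upper bdd_above_finite finite_imageI) auto
  then show ?thesis by (simp add: cut_dist_def)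
qed

lemma cut_dist_attained:
  obtains A B where "A \<subseteq> {..<n}" "B \<subseteq> {..<n}"
    "cut_dist {..<n} G r = 1 / (real n)\<^sup>2 * \<bar>real (edge_count G A B) - r * real (card A) * real (card B)\<bar>"
proof -
  let ?F = "\<lambda>(A, B). 1 / (real (card {..<n}))\<^sup>2 * \<bar>real (edge_count G A B) - r * real (card A) * real (card B)\<bar>"
  let ?I = "?F ` (Pow {..<n} \<times> Pow {..<n})"
  have "cut_dist {..<n} G r = Max ?I"
    unfolding cut_dist_def by (rule cSup_eq_Max) auto
  also have "\<dots> \<in> ?I" by (rule Max_in) auto
  finally show thesis using that by auto
qed

text \<open>A union bound over grid vectors, pairs of vertex sets and the sign of the discrepancy,
  \<open>exp (O (n ln n))\<close> cases in total. The \<open>- real n\<close> in the exponent allows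
  for the diagonal.\<close>

lemma joint_upper:
  assumes n: "0 < n" and p: "0 < p" "p < 1" and r: "0 < r" "r < 1" and pr: "p \<le> r" and t: "threshold r \<le> p"
    and \<theta>: "0 \<le> \<theta>" "\<theta> \<le> 1 / 2" "2 * \<theta> * K \<le> 1"
    and dev: "tilt_close p r \<eta> K K'" and \<eta>: "0 \<le> \<eta>"
  shows "prb (all_pairs n) (\<lambda>_. p) (\<lambda>G. \<epsilon> \<le> cut_dist {..<n} G r \<and> real n * r \<le> lambda1 n G)
    \<le> 2 * 4 ^ n * ((real n)\<^sup>2 + 1) ^ n * exp (- real (n choose 2) * h p r + (2 * curv p r * r + 6 * \<theta> * \<bar>K'\<bar>) * real n
        + (\<theta> * \<eta> + 2 * \<theta>\<^sup>2) * (real n)\<^sup>2 - \<theta> * (\<epsilon> * (real n)\<^sup>2 - real n))"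
proof -
  let ?P = "\<lambda>Q. prb (all_pairs n) (\<lambda>_. p) Q"
  let ?B = "exp (- real (n choose 2) * h p r + (2 * curv p r * r + 6 * \<theta> * \<bar>K'\<bar>) * real n
        + (\<theta> * \<eta> + 2 * \<theta>\<^sup>2) * (real n)\<^sup>2 - \<theta> * (\<epsilon> * (real n)\<^sup>2 - real n))"
  let ?I = "grid n \<times> (Pow {..<n} \<times> Pow {..<n} \<times> {1, -1 :: real})"
  define W where "W i = (case i of (y, A, B, s) \<Rightarrow> \<lambda>e. (s::real) * cut_weight A B e)" for i :: "(nat \<Rightarrow> real) \<times> _"
  let ?Q = "\<lambda>i G. grid_event r n (fst i) G \<and> \<epsilon> * (real n)\<^sup>2 - real n \<le> cut_sum n r (W i) G"
  have fin: "finite ?I" by (intro finite_cartesian_product finite_grid) auto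
  have "?P (\<lambda>G. \<epsilon> \<le> cut_dist {..<n} G r \<and> real n * r \<le> lambda1 n G) \<le> ?P (\<lambda>G. \<exists>i\<in>?I. ?Q i G)"
  proof (rule prb_mono[OF finite_all_pairs])
    fix G assume G: "G \<subseteq> all_pairs n" and ev: "\<epsilon> \<le> cut_dist {..<n} G r \<and> real n * r \<le> lambda1 n G"
    obtain y where y: "y \<in> grid n" "grid_event r n y G" using grid_vector_exists[OF n r(1)] ev by blast
    obtain A B where AB: "A \<subseteq> {..<n}" "B \<subseteq> {..<n}"
      and cd: "cut_dist {..<n} G r = 1 / (real n)\<^sup>2 * \<bar>real (edge_count G A B) - r * real (card A) * real (card B)\<bar>"
      by (rule cut_dist_attained)
    let ?S = "cut_sum n r (cut_weight A B) G"
    have "\<epsilon> * (real n)\<^sup>2 \<le> \<bar>?S - r * real (card (A \<inter> B))\<bar>"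
      using ev n unfolding cd cut_difference_eq[OF G AB] by (simp add: le_divide_eq)
    moreover have "r * real (card (A \<inter> B)) \<le> 1 * real n"
    proof (rule mult_mono)
      have "card (A \<inter> B) \<le> card {..<n}" using AB by (intro card_mono) auto
      then show "real (card (A \<inter> B)) \<le> real n" by simp
    qed (use r in auto)
    moreover have "0 \<le> r * real (card (A \<inter> B))" using r by simp
    ultimately have "\<epsilon> * (real n)\<^sup>2 - real n \<le> \<bar>?S\<bar>" by linarith
    then have "\<epsilon> * (real n)\<^sup>2 - real n \<le> 1 * ?S \<or> \<epsilon> * (real n)\<^sup>2 - real n \<le> - 1 * ?S" by linarith
    then obtain s where s: "s \<in> {1, -1::real}" "\<epsilon> * (real n)\<^sup>2 - real n \<le> s * ?S" by blast
    have "s * ?S = cut_sum n r (W (y, A, B, s)) G"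
      by (simp add: W_def cut_sum_def sum_distrib_left mult.assoc)
    then show "\<exists>i\<in>?I. ?Q i G" using y AB s by (intro bexI[of _ "(y, A, B, s)"]) auto
  qed (use p in auto)
  also have "\<dots> \<le> (\<Sum>i\<in>?I. ?P (?Q i))"
    using p by (intro prb_Bex_le finite_all_pairs fin) auto
  also have "\<dots> \<le> (\<Sum>i\<in>?I. ?B)"
  proof (rule sum_mono)
    fix i assume "i \<in> ?I"
    then have "\<bar>W i e\<bar> \<le> 2" for e
      by (auto simp: W_def cut_weight_def indicator_def)
    then show "?P (?Q i) \<le> ?B" using \<theta> dev \<eta> t by (intro vector_tail[OF n p r pr]) auto
  qed
  also have "\<dots> = real (card ?I) * ?B" by simp
  also have "\<dots> \<le> (2 * 4 ^ n * ((real n)\<^sup>2 + 1) ^ n) * ?B"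
  proof (rule mult_right_mono)
    have "card ?I = card (grid n) * (2 ^ n * (2 ^ n * 2))"
      by (simp add: card_cartesian_product card_Pow)
    also have "\<dots> \<le> (n\<^sup>2 + 1) ^ n * (2 ^ n * (2 ^ n * 2))" by (intro mult_right_mono card_grid_le) auto
    also have "\<dots> = 2 * 4 ^ n * (n\<^sup>2 + 1) ^ n" by (simp add: power_mult_distrib[symmetric])
    finally have "real (card ?I) \<le> real (2 * 4 ^ n * (n\<^sup>2 + 1) ^ n)" by (rule of_nat_mono)
    then show "real (card ?I) \<le> 2 * 4 ^ n * ((real n)\<^sup>2 + 1) ^ n" by (simp add: add.commute)
  qed simp
  finally show ?thesis .
qed

section \<open>The value of the rate\<close>

lemma prb_split:
  assumes "finite E"
  shows "prb E f Q = prb E f (\<lambda>G. R G \<and> Q G) + prb E f (\<lambda>G. \<not> R G \<and> Q G)"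
proof -
  have "prb E f (\<lambda>G. R G \<and> Q G) + prb E f (\<lambda>G. \<not> R G \<and> Q G)
      = (\<Sum>G\<in>{G. G \<subseteq> E \<and> R G \<and> Q G} \<union> {G. G \<subseteq> E \<and> \<not> R G \<and> Q G}. weight E f G)"
    unfolding prb_def using assms by (intro sum.union_disjoint[symmetric]) auto
  also have "{G. G \<subseteq> E \<and> R G \<and> Q G} \<union> {G. G \<subseteq> E \<and> \<not> R G \<and> Q G} = {G. G \<subseteq> E \<and> Q G}" by auto
  finally show ?thesis unfolding prb_def by simp
qed

text \<open>Lubetzky and Zhao's perturbation: a strip of \<open>\<alpha> n\<close> vertices of density \<open>r1\<close> in a graph of
  density \<open>r0\<close>, tested against the vector that equals \<open>x1\<close> on the strip.\<close>

lemma strip_bound: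
  assumes p: "0 < p" "p < 1" and lim: "rate p r \<longlonglongrightarrow> \<l>"
    and \<alpha>: "0 \<le> \<alpha>" "\<alpha> \<le> 1" and r0: "0 \<le> r0" "r0 \<le> 1" and r1: "0 \<le> r1" "r1 \<le> 1" and x1: "0 \<le> x1"
    and gain: "r * (\<alpha> * x1\<^sup>2 + (1 - \<alpha>)) < r1 * (\<alpha> * x1 + (1 - \<alpha>))\<^sup>2 + (r0 - r1) * (1 - \<alpha>)\<^sup>2"
  shows "2 * \<l> \<le> h p r1 + (h p r0 - h p r1) * (1 - \<alpha>)\<^sup>2"
proof -
  define C where "C = h p r1 + (h p r0 - h p r1) * (1 - \<alpha>)\<^sup>2"
  \<comment> \<open>The surplus of the form over \<open>r n\<close> times the squared norm, divided
    by \<open>n^2\<close>, for a strip fraction \<open>b\<close> and without the diagonal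
    correction.\<close>
  define g where "g b = r1 * (b * x1 + (1 - b))\<^sup>2 + (r0 - r1) * (1 - b)\<^sup>2 - r * (b * x1\<^sup>2 + (1 - b))" for b
  define \<tau> where "\<tau> = g \<alpha> / 2"
  have \<tau>: "0 < \<tau>" "\<tau> < g \<alpha>" using gain by (auto simp: \<tau>_def g_def)
  define k where "k n = nat \<lfloor>\<alpha> * real n\<rfloor>" for n
  define b where "b n = real (k n) / real n" for n
  have "b N = real (1 * nat \<lfloor>\<alpha> * real N / real 1\<rfloor>) / real N" for N by (simp add: b_def k_def)
  then have "b = (\<lambda>N. real (1 * nat \<lfloor>\<alpha> * real N / real 1\<rfloor>) / real N)" by (rule ext)
  moreover have "(0::nat) < 1" by simp
  ultimately have b: "b \<longlonglongrightarrow> \<alpha>" using floor_multiple_tendsto[OF _ \<alpha>(1), of 1] by (simp only:)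
  have k_le: "k n \<le> n" for n
  proof -
    have "real (k n) \<le> \<alpha> * real n" using \<alpha> unfolding k_def by (intro of_nat_floor) simp
    also have "\<dots> \<le> 1 * real n" using \<alpha> by (intro mult_right_mono) auto
    finally show ?thesis by simp
  qed
  have "(\<lambda>n. g (b n) - (1 + x1\<^sup>2) / real n) \<longlonglongrightarrow> g \<alpha> - 0"
    unfolding g_def by (intro tendsto_diff tendsto_add tendsto_mult tendsto_power tendsto_const b) real_asymp
  then have ev: "\<forall>\<^sub>F n in sequentially. \<tau> < g (b n) - (1 + x1\<^sup>2) / real n"
    using \<tau> by (intro order_tendstoD) auto
  have "2 * \<l> \<le> (1 + \<kappa>) * C" if \<kappa>: "0 < \<kappa>" for \<kappa>
  proof -
    let ?M = "1 + x1"
    have M: "0 < ?M" using x1 by simp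
    have "\<forall>\<^sub>F n in sequentially. rate p r n
        \<le> (1 + \<kappa>) * ((h p r1 + (h p r0 - h p r1) * (1 - b n)\<^sup>2) / 2 + 2 / (real n)\<^sup>2)"
      using variational_lower_bound[OF p M \<tau>(1) \<kappa>, of r] ev eventually_gt_at_top[of 0]
    proof eventually_elim
      case (elim n)
      let ?f = "\<lambda>e. if \<exists>i\<in>e. i < k n then r1 else r0"
      let ?x = "\<lambda>i. if i < k n then x1 else 1"
      have n: "0 < real n" using elim by simp
      have nk: "real (n - k n) = real n - real (k n)" using k_le[of n] by (simp add: of_nat_diff)
      have kb: "real (k n) = b n * real n" using n by (simp add: b_def)
      have two: "(\<Sum>i<n. \<Sum>j<n. if k n \<le> i then if k n \<le> j then c else 0 else 0) = (real n - real (k n))\<^sup>2 * c" for c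
      proof -
        have "(\<Sum>j<n. if k n \<le> i then if k n \<le> j then c else 0 else 0)
            = (if k n \<le> i then real (n - k n) * c else 0)" for i
          using sum_if_ge[OF k_le[of n], of c] by simp
        then show ?thesis using sum_if_ge[OF k_le[of n], of "real (n - k n) * c"]
          by (simp add: nk power2_eq_square mult.assoc)
      qed
      have sx: "(\<Sum>i<n. ?x i) = real (k n) * x1 + (real n - real (k n))"
      proof -
        have "(\<Sum>i<n. ?x i) = (\<Sum>i<n. (if i < k n then x1 else 0) + (if k n \<le> i then 1 else 0))"
          by (intro sum.cong) auto
        then show ?thesis unfolding sum.distrib sum_if_less[OF k_le[of n]] sum_if_ge[OF k_le[of n]] by (simp add: nk)
      qed
      have sx2: "(\<Sum>i<n. (?x i)\<^sup>2) = real (k n) * x1\<^sup>2 + (real n - real (k n))"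
      proof -
        have "(\<Sum>i<n. (?x i)\<^sup>2) = (\<Sum>i<n. (if i < k n then x1\<^sup>2 else 0) + (if k n \<le> i then 1 else 0))"
          by (intro sum.cong) auto
        then show ?thesis unfolding sum.distrib sum_if_less[OF k_le[of n]] sum_if_ge[OF k_le[of n]] by (simp add: nk)
      qed
      \<comment> \<open>The density is \<open>r1\<close>, plus \<open>r0 - r1\<close> when both ends
        avoid the strip. The diagonal is absent from the graph; subtracting \<open>1 + x1^2\<close>
        per vertex covers it.\<close>
      have "r1 * (\<Sum>i<n. ?x i)\<^sup>2 + (r0 - r1) * (real n - real (k n))\<^sup>2 - real n * (1 + x1\<^sup>2)
          = (\<Sum>i<n. \<Sum>j<n. r1 * (?x i * ?x j) + (if k n \<le> i then if k n \<le> j then r0 - r1 else 0 else 0)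
              - (if i = j then 1 + x1\<^sup>2 else 0))"
        unfolding sum.distrib sum_subtractf two
        by (simp add: power2_eq_square[of "sum ?x {..<n}"] sum_product sum_distrib_left mult.commute)
      also have "\<dots> \<le> (\<Sum>i<n. \<Sum>j<n. if i \<noteq> j then ?f {i, j} * prod ?x {i, j} else 0)"
      proof (intro sum_mono)
        fix i j
        have 1: "r1 * x1\<^sup>2 \<le> 1 * x1\<^sup>2" using r1 by (intro mult_right_mono) auto
        have 2: "r0 \<le> 1 + x1 * x1" using r0 zero_le_square[of x1] by linarith
        show "r1 * (?x i * ?x j) + (if k n \<le> i then if k n \<le> j then r0 - r1 else 0 else 0) - (if i = j then 1 + x1\<^sup>2 else 0)
            \<le> (if i \<noteq> j then ?f {i, j} * prod ?x {i, j} else 0)"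
          using 1 2 r0 r1 by (auto simp: power2_eq_square)
      qed
      also have "\<dots> = 2 * (\<Sum>e\<in>all_pairs n. ?f e * prod ?x e)" by (rule sum_ordered_pairs_sym)
      finally have form: "r1 * (\<Sum>i<n. ?x i)\<^sup>2 + (r0 - r1) * (real n - real (k n))\<^sup>2 - real n * (1 + x1\<^sup>2)
          \<le> 2 * (\<Sum>e\<in>all_pairs n. ?f e * prod ?x e)" .
      have "\<tau> * (real n)\<^sup>2 \<le> (g (b n) - (1 + x1\<^sup>2) / real n) * (real n)\<^sup>2"
        using elim(2) by (intro mult_right_mono) auto
      also have "\<dots> = g (b n) * (real n)\<^sup>2 - real n * (1 + x1\<^sup>2)"
        using n by (simp add: left_diff_distrib power2_eq_square)
      also have "g (b n) * (real n)\<^sup>2 = r1 * (real (k n) * x1 + (real n - real (k n)))\<^sup>2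
          + (r0 - r1) * (real n - real (k n))\<^sup>2 - r * real n * (real (k n) * x1\<^sup>2 + (real n - real (k n)))"
      proof -
        have "real (k n) * x1 + (real n - real (k n)) = real n * (b n * x1 + (1 - b n))"
          "real n - real (k n) = real n * (1 - b n)"
          "real (k n) * x1\<^sup>2 + (real n - real (k n)) = real n * (b n * x1\<^sup>2 + (1 - b n))"
          unfolding kb by (simp_all add: algebra_simps)
        then show ?thesis by (simp only: g_def power_mult_distrib) (simp add: power2_eq_square algebra_simps)
      qed
      finally have gap: "r * real n * (\<Sum>i<n. (?x i)\<^sup>2) + \<tau> * (real n)\<^sup>2 \<le> 2 * (\<Sum>e\<in>all_pairs n. ?f e * prod ?x e)"
        using form unfolding sx sx2 by linarith
      have fb: "\<forall>e\<in>all_pairs n. 0 \<le> ?f e \<and> ?f e \<le> 1" using r0 r1 by auto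
      have xb: "\<forall>i<n. 0 \<le> ?x i \<and> ?x i \<le> ?M" using x1 by auto
      have vb: "- ln (eig_prob p r n) \<le> (1 + \<kappa>) * ((\<Sum>e\<in>all_pairs n. h p (?f e)) + 2)"
        using mp[OF mp[OF mp[OF spec[OF spec[OF elim(1), of ?f], of ?x] fb] xb] gap] by (rule conjunct2)
      have h0: "0 \<le> h p r0" "0 \<le> h p r1" using relative_entropy_nonneg[OF p] r0 r1 by auto
      have "2 * (\<Sum>e\<in>all_pairs n. h p (?f e)) = (\<Sum>i<n. \<Sum>j<n. if i \<noteq> j then h p (?f {i, j}) else 0)"
        by (rule sum_ordered_pairs_sym[symmetric])
      also have "\<dots> \<le> (\<Sum>i<n. \<Sum>j<n. h p r1 + (if k n \<le> i then if k n \<le> j then h p r0 - h p r1 else 0 else 0))"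
        using h0 by (intro sum_mono) auto
      also have "\<dots> = (real n)\<^sup>2 * h p r1 + (real n - real (k n))\<^sup>2 * (h p r0 - h p r1)"
        unfolding sum.distrib two by (simp add: power2_eq_square)
      also have "(real n - real (k n))\<^sup>2 = (real n)\<^sup>2 * (1 - b n)\<^sup>2"
        unfolding kb power_mult_distrib[symmetric] by (simp add: algebra_simps)
      finally have cost: "(\<Sum>e\<in>all_pairs n. h p (?f e)) + 2
          \<le> ((h p r1 + (h p r0 - h p r1) * (1 - b n)\<^sup>2) / 2 + 2 / (real n)\<^sup>2) * (real n)\<^sup>2"
        using n by (simp add: distrib_right algebra_simps)
      have "- ln (eig_prob p r n) \<le> (1 + \<kappa>) * (((h p r1 + (h p r0 - h p r1) * (1 - b n)\<^sup>2) / 2 + 2 / (real n)\<^sup>2) * (real n)\<^sup>2)"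
        using vb mult_left_mono[OF cost, of "1 + \<kappa>"] \<kappa> by linarith
      then show ?case
        using n unfolding rate_def by (subst pos_divide_le_eq) (simp_all only: zero_less_power mult.assoc)
    qed
    moreover have "(\<lambda>n. (1 + \<kappa>) * ((h p r1 + (h p r0 - h p r1) * (1 - b n)\<^sup>2) / 2 + 2 / (real n)\<^sup>2)) \<longlonglongrightarrow> (1 + \<kappa>) * (C / 2 + 0)"
      unfolding C_def
      by (intro tendsto_mult tendsto_add tendsto_divide tendsto_power tendsto_diff tendsto_const b) (real_asymp | simp)+
    ultimately have "\<l> \<le> (1 + \<kappa>) * (C / 2 + 0)"
      by (intro tendsto_le[OF sequentially_bot _ lim]) auto
    then show ?thesis by simp
  qed
  then have "\<forall>\<^sub>F \<kappa> in at_right 0. 2 * \<l> \<le> (1 + \<kappa>) * C"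
    by (auto simp: eventually_at_filter)
  moreover have "((\<lambda>\<kappa>. (1 + \<kappa>) * C) \<longlongrightarrow> (1 + 0) * C) (at_right 0)"
    by (intro tendsto_intros)
  ultimately have "2 * \<l> \<le> (1 + 0) * C"
    by (intro tendsto_lowerbound[OF _ _ trivial_limit_at_right_real]) auto
  then show ?thesis by (simp add: C_def)
qed

lemma DERIV_relative_entropy:
  assumes p: "0 < p" "p < 1" and r: "0 < r" "r < 1"
  shows "DERIV (h p) r :> 2 * r * curv p r"
proof -
  let ?q = "\<lambda>x. ent x + x * ln ((1 - p) / p) - ln (1 - p)"
  have "DERIV ?q r :> - ln ((1 - r) / r) + ln ((1 - p) / p)"
    using DERIV_ent[OF r] by (auto intro!: derivative_eq_intros)
  moreover have "- ln ((1 - r) / r) + ln ((1 - p) / p) = 2 * r * curv p r"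
    using r by (simp add: curv_def)
  ultimately have "DERIV ?q r :> 2 * r * curv p r" by simp
  then show ?thesis
  proof (rule has_field_derivative_transform_within_open)
    show "open {0<..<1::real}" by simp
    show "r \<in> {0<..<1}" using r by simp
    show "?q x = h p x" if "x \<in> {0<..<1}" for x using that h_eq_ent[OF p, of x] by simp
  qed
qed

text \<open>Constant densities \<open>x > r\<close>, that is \<open>strip_bound\<close> with an
  empty strip, followed by the limit \<open>x\<close> to \<open>r\<close>; strictness is needed for
  the gain.\<close>

lemma rate_limit_le:
  assumes p: "0 < p" "p < 1" and r: "0 < r" "r < 1" and lim: "rate p r \<longlonglongrightarrow> \<l>"
  shows "2 * \<l> \<le> h p r"
proof -
  have "2 * \<l> \<le> h p x" if "r < x" "x < 1" for x
    using strip_bound[OF p lim, of 0 x x 1] that r by simp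
  then have "\<forall>\<^sub>F x in at_right r. 2 * \<l> \<le> h p x"
    using r by (intro eventually_at_rightI[of r 1]) auto
  moreover have "(h p \<longlongrightarrow> h p r) (at_right r)"
    using DERIV_isCont[OF DERIV_relative_entropy[OF p r]] by (simp add: isCont_def filterlim_at_split)
  ultimately show ?thesis
    by (intro tendsto_lowerbound[OF _ _ trivial_limit_at_right_real]) auto
qed

lemma rate_limit_above_threshold:
  assumes p: "0 < p" "p < 1" and r: "0 < r" "r < 1" and pr: "p \<le> r" and t: "threshold r \<le> p"
    and lim: "rate p r \<longlonglongrightarrow> \<l>"
  shows "\<l> = h p r / 2"
proof (rule antisym)
  show "\<l> \<le> h p r / 2" using rate_limit_le[OF p r lim] by simp
  define C where "C = 2 * curv p r * r"
  have "\<forall>\<^sub>F n in sequentially. real (n choose 2) / (real n)\<^sup>2 * h p r - C / real n - ln ((real n)\<^sup>2 + 1) / real n \<le> rate p r n"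
    using rate_bounded[OF p r(2)] eventually_gt_at_top[of 0]
  proof eventually_elim
    case (elim n)
    have n: "0 < real n" using elim by simp
    have "ln (eig_prob p r n) \<le> ln (((real n)\<^sup>2 + 1) ^ n * exp (- real (n choose 2) * h p r + C * real n))"
      using eig_prob_upper[OF elim(2) p r pr t] elim unfolding C_def by (intro ln_mono) auto
    also have "\<dots> = real n * ln ((real n)\<^sup>2 + 1) - real (n choose 2) * h p r + C * real n"
      by (subst ln_mult) (auto simp: ln_realpow add_nonneg_pos add_nonneg_eq_0_iff)
    finally have "(real (n choose 2) * h p r - C * real n - real n * ln ((real n)\<^sup>2 + 1)) / (real n)\<^sup>2 \<le> rate p r n"
      unfolding rate_def by (intro divide_right_mono) auto
    moreover have "(real (n choose 2) * h p r - C * real n - real n * ln ((real n)\<^sup>2 + 1)) / (real n)\<^sup>2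
        = real (n choose 2) / (real n)\<^sup>2 * h p r - C / real n - ln ((real n)\<^sup>2 + 1) / real n"
      using n by (simp add: diff_divide_distrib power2_eq_square)
    ultimately show ?case by simp
  qed
  moreover have "(\<lambda>n. real (n choose 2) / (real n)\<^sup>2 * h p r - C / real n - ln ((real n)\<^sup>2 + 1) / real n)
      \<longlonglongrightarrow> 1 / 2 * h p r - 0 - 0"
  proof (intro tendsto_diff tendsto_mult tendsto_const)
    show "(\<lambda>n. real (n choose 2) / (real n)\<^sup>2) \<longlonglongrightarrow> 1 / 2" unfolding real_choose_two by real_asymp
  qed real_asymp+
  ultimately show "h p r / 2 \<le> \<l>"
    using tendsto_le[OF sequentially_bot lim] by fastforce
qed

text \<open>First-order expansion in the strip width \<open>\<alpha>\<close>. Moving the background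
  density to \<open>r + \<alpha> * \<nu>\<close> compensates the effect of the strip on the
  eigenvalue, and the derivative of the cost is then twice the excess at \<open>r1\<close> plus the
  price of the slack \<open>\<omega>\<close>.\<close>

lemma rate_limit_below_threshold:
  assumes p: "0 < p" "p < 1" and r: "0 < r" "r < 1" and pr: "p \<le> r" and t: "p < threshold r"
    and lim: "rate p r \<longlonglongrightarrow> \<l>"
  shows "2 * \<l> < h p r"
proof -
  define c where "c = curv p r"
  have c: "0 \<le> c" unfolding c_def using p pr r by (intro curv_nonneg) auto
  obtain r1 where r1: "0 < r1" "r1 < 1" and neg: "excess p r r1 < 0"
    using excess_neg_exists[OF p r t] by blast
  define S where "S = excess p r r1"
  \<comment> \<open>Small enough that the price \<open>2 * (r * c) * \<omega>\<close> uses at most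
    half of the saving \<open>- 2 * S\<close>.\<close>
  define \<omega> where "\<omega> = - S / (2 * (r * c + 1))"
  have rc: "0 \<le> r * c" using r c by simp
  have \<omega>: "0 < \<omega>" "2 * (r * c) * \<omega> \<le> - S"
  proof -
    show "0 < \<omega>" using neg rc unfolding \<omega>_def S_def by (intro divide_pos_pos) auto
    have "2 * (r * c) * \<omega> \<le> 2 * (r * c + 1) * \<omega>" using \<open>0 < \<omega>\<close> by simp
    also have "\<dots> = - S" using rc by (simp add: \<omega>_def)
    finally show "2 * (r * c) * \<omega> \<le> - S" .
  qed
  \<comment> \<open>Solves for the derivative of \<open>u\<close> at 0 to equal
    \<open>\<omega>\<close>.\<close>
  define \<nu> where "\<nu> = r - r1\<^sup>2 / r + \<omega>"
  \<comment> \<open>Maximises \<open>2 * r1 * x1 - r * x1^2\<close>, the part of that derivative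
    that depends on the test vector.\<close>
  define x1 where "x1 = r1 / r"
  define u where "u \<alpha> = r1 * (\<alpha> * x1 + (1 - \<alpha>))\<^sup>2 + (r + \<alpha> * \<nu> - r1) * (1 - \<alpha>)\<^sup>2 - r * (\<alpha> * x1\<^sup>2 + (1 - \<alpha>))" for \<alpha>
  define v where "v \<alpha> = h p r1 + (h p (r + \<alpha> * \<nu>) - h p r1) * (1 - \<alpha>)\<^sup>2" for \<alpha>
  have du: "DERIV u 0 :> \<omega>"
  proof -
    have "DERIV u 0 :> r1 * (2 * (x1 - 1)) + (\<nu> - 2 * (r - r1)) - r * (x1\<^sup>2 - 1)"
      unfolding u_def by (auto intro!: derivative_eq_intros)
    moreover have "r1 * (2 * (x1 - 1)) + (\<nu> - 2 * (r - r1)) - r * (x1\<^sup>2 - 1) = \<omega>"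
      using r by (simp add: x1_def \<nu>_def field_simps power2_eq_square)
    ultimately show ?thesis by simp
  qed
  have dv: "DERIV v 0 :> 2 * S + 2 * (r * c) * \<omega>"
  proof -
    have "DERIV (\<lambda>\<alpha>. h p (r + \<alpha> * \<nu>)) 0 :> 2 * r * c * \<nu>"
    proof (rule DERIV_chain2[where f = "h p" and g = "\<lambda>\<alpha>. r + \<alpha> * \<nu>"])
      show "DERIV (h p) (r + 0 * \<nu>) :> 2 * r * c"
        using DERIV_relative_entropy[OF p r] by (simp add: c_def)
    qed (auto intro!: derivative_eq_intros)
    then have "DERIV v 0 :> 2 * r * c * \<nu> - 2 * (h p r - h p r1)"
      unfolding v_def by (auto intro!: derivative_eq_intros)
    moreover have "2 * r * c * \<nu> - 2 * (h p r - h p r1) = 2 * S + 2 * (r * c) * \<omega>"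
      using r by (simp add: S_def excess_def c_def[symmetric] \<nu>_def field_simps power2_eq_square)
    ultimately show ?thesis by simp
  qed
  obtain d1 where d1: "0 < d1" "\<And>\<alpha>. 0 < \<alpha> \<Longrightarrow> \<alpha> < d1 \<Longrightarrow> u 0 < u (0 + \<alpha>)"
    using DERIV_pos_inc_right[OF du \<omega>(1)] by blast
  have "2 * S + 2 * (r * c) * \<omega> < 0" using \<omega>(2) neg by (simp add: S_def)
  then obtain d2 where d2: "0 < d2" "\<And>\<alpha>. 0 < \<alpha> \<Longrightarrow> \<alpha> < d2 \<Longrightarrow> v (0 + \<alpha>) < v 0"
    using DERIV_neg_dec_right[OF dv] by blast
  define d3 where "d3 = min r (1 - r) / (\<bar>\<nu>\<bar> + 1)"
  have d3: "0 < d3" using r by (simp add: d3_def)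
  define \<alpha> where "\<alpha> = min (min d1 d2) (min d3 1) / 2"
  have \<alpha>: "0 < \<alpha>" "\<alpha> < d1" "\<alpha> < d2" "\<alpha> < d3" "\<alpha> < 1"
    using d1(1) d2(1) d3 by (auto simp: \<alpha>_def min_def)
  have "\<bar>\<alpha> * \<nu>\<bar> \<le> \<alpha> * (\<bar>\<nu>\<bar> + 1)" using \<alpha>(1) by (simp add: abs_mult)
  also have "\<dots> \<le> d3 * (\<bar>\<nu>\<bar> + 1)" using \<alpha>(4) by (intro mult_right_mono) auto
  also have "\<dots> = min r (1 - r)" by (simp add: d3_def)
  finally have r0: "0 \<le> r + \<alpha> * \<nu>" "r + \<alpha> * \<nu> \<le> 1" by auto
  have "0 < u \<alpha>" using d1(2)[OF \<alpha>(1,2)] by (simp add: u_def)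
  then have "r * (\<alpha> * x1\<^sup>2 + (1 - \<alpha>)) < r1 * (\<alpha> * x1 + (1 - \<alpha>))\<^sup>2 + ((r + \<alpha> * \<nu>) - r1) * (1 - \<alpha>)\<^sup>2"
    by (simp add: u_def)
  then have "2 * \<l> \<le> v \<alpha>"
    unfolding v_def using \<alpha> r0 r1 r
    by (intro strip_bound[OF p lim, where ?r0.0 = "r + \<alpha> * \<nu>" and ?x1.0 = x1]) (auto simp: x1_def)
  also have "\<dots> < v 0" using d2(2)[OF \<alpha>(1,3)] by simp
  also have "v 0 = h p r" by (simp add: v_def)
  finally show ?thesis .
qed

section \<open>Graphs close to a constant\<close>

lemma sum_mult_le_indicator:
  fixes a c :: "nat \<Rightarrow> real"
  assumes "\<And>i. i < n \<Longrightarrow> 0 \<le> a i \<and> a i \<le> 1"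
  shows "(\<Sum>i<n. a i * c i) \<le> (\<Sum>i<n. indicator {i. i < n \<and> 0 \<le> c i} i * c i)"
proof (rule sum_mono)
  fix i assume i: "i \<in> {..<n}"
  show "a i * c i \<le> indicator {i. i < n \<and> 0 \<le> c i} i * c i"
  proof (cases "0 \<le> c i")
    case True
    then show ?thesis using assms[of i] i mult_right_mono[of "a i" 1 "c i"] by simp
  next
    case False
    then show ?thesis using assms[of i] i by (simp add: mult_nonneg_nonpos)
  qed
qed

text \<open>A bilinear form on a product of cubes is largest at vertices: it is linear in
  \<open>a\<close> for fixed \<open>b\<close>, so rounding \<open>a\<close> by the signs of its
  coefficients does not decrease it; then \<open>b\<close> is rounded in the same way.\<close>

lemma bilinear_le_cut:
  fixes M :: "nat \<Rightarrow> nat \<Rightarrow> real"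
  assumes a: "\<And>i. i < n \<Longrightarrow> 0 \<le> a i \<and> a i \<le> 1" and b: "\<And>i. i < n \<Longrightarrow> 0 \<le> b i \<and> b i \<le> 1"
  obtains A B where "A \<subseteq> {..<n}" "B \<subseteq> {..<n}"
    "(\<Sum>i<n. \<Sum>j<n. M i j * (a i * b j)) \<le> (\<Sum>i<n. \<Sum>j<n. M i j * (indicator A i * indicator B j))"
proof -
  define c where "c i = (\<Sum>j<n. M i j * b j)" for i
  define A where "A = {i. i < n \<and> 0 \<le> c i}"
  define d where "d j = (\<Sum>i<n. M i j * indicator A i)" for j
  define B where "B = {j. j < n \<and> 0 \<le> d j}"
  have "(\<Sum>i<n. \<Sum>j<n. M i j * (a i * b j)) = (\<Sum>i<n. a i * c i)"
    unfolding c_def sum_distrib_left by (intro sum.cong refl) simp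
  also have "\<dots> \<le> (\<Sum>i<n. indicator A i * c i)"
    unfolding A_def by (rule sum_mult_le_indicator[OF a])
  also have "\<dots> = (\<Sum>i<n. \<Sum>j<n. b j * (M i j * indicator A i))"
    unfolding c_def sum_distrib_left by (intro sum.cong refl) simp
  also have "\<dots> = (\<Sum>j<n. b j * d j)"
    unfolding d_def sum_distrib_left by (rule sum.swap)
  also have "\<dots> \<le> (\<Sum>j<n. indicator B j * d j)"
    unfolding B_def by (rule sum_mult_le_indicator[OF b])
  also have "\<dots> = (\<Sum>j<n. \<Sum>i<n. M i j * (indicator A i * indicator B j))"
    unfolding d_def sum_distrib_left by (intro sum.cong refl) simp
  also have "\<dots> = (\<Sum>i<n. \<Sum>j<n. M i j * (indicator A i * indicator B j))"
    by (rule sum.swap)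
  finally show thesis by (intro that[of A B]) (auto simp: A_def B_def)
qed

text \<open>Scaled by \<open>r * sqrt n\<close> the top vector lies in the unit cube, where
  \<open>bilinear_le_cut\<close> bounds the form of the adjacency matrix minus \<open>s\<close> by a
  cut. The scaling is the source of \<open>1 / r^2\<close>.\<close>

lemma near_constant_density:
  assumes n: "0 < n" and r: "0 < r" and ev: "real n * r \<le> lambda1 n G" and s: "0 \<le> s"
    and cut: "cut_dist {..<n} G s \<le> \<epsilon>"
  shows "r \<le> s + \<epsilon> / r\<^sup>2"
proof -
  obtain z where z: "(\<Sum>i<n. (z i)\<^sup>2) = 1" "\<forall>i. 0 \<le> z i" "real n * r \<le> bil n G z z"
    "\<forall>i<n. z i \<le> 1 / (r * sqrt n)"
    by (rule nonneg_top_vector[OF n r ev])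
  define m where "m = r * sqrt n"
  have m: "0 < m" "m\<^sup>2 = r\<^sup>2 * real n" using r n by (simp_all add: m_def power_mult_distrib)
  define a where "a i = m * z i" for i
  have a: "0 \<le> a i \<and> a i \<le> 1" if "i < n" for i
    using z(2,4) that m by (simp add: a_def m_def[symmetric] pos_le_divide_eq mult.commute)
  let ?M = "\<lambda>i j. (if {i, j} \<in> G then 1 else 0) - s"
  obtain A B where AB: "A \<subseteq> {..<n}" "B \<subseteq> {..<n}"
    and le: "(\<Sum>i<n. \<Sum>j<n. ?M i j * (a i * a j)) \<le> (\<Sum>i<n. \<Sum>j<n. ?M i j * (indicator A i * indicator B j))"
    using bilinear_le_cut[where a = a and b = a and M = ?M and n = n] a by blast
  have split: "(\<Sum>i<n. \<Sum>j<n. ?M i j * (x i * y j)) = bil n G x y - s * ((\<Sum>i<n. x i) * (\<Sum>j<n. y j))"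
    for x y :: "nat \<Rightarrow> real"
  proof -
    have "(\<Sum>i<n. \<Sum>j<n. ?M i j * (x i * y j))
        = (\<Sum>i<n. \<Sum>j<n. (if {i, j} \<in> G then x i * y j else 0) - s * (x i * y j))"
      by (intro sum.cong refl) (simp add: left_diff_distrib)
    then show ?thesis unfolding bil_def sum_product by (simp add: sum_subtractf sum_distrib_left)
  qed
  have card: "real (card A) = (\<Sum>i<n. indicator A i)" if "A \<subseteq> {..<n}" for A
    using that by (simp add: indicator_def sum.If_cases Int_absorb1)
  have "(\<Sum>i<n. \<Sum>j<n. ?M i j * (indicator A i * indicator B j))
      = real (edge_count G A B) - s * real (card A) * real (card B)"
    unfolding split edge_count_eq_bil[OF AB] card[OF AB(1)] card[OF AB(2)] by (simp add: mult.assoc)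
  also have "\<dots> \<le> \<epsilon> * (real n)\<^sup>2"
  proof -
    have "1 / (real n)\<^sup>2 * \<bar>real (edge_count G A B) - s * real (card A) * real (card B)\<bar> \<le> \<epsilon>"
      using cut_dist_bounds[OF AB, of G s] cut by linarith
    then show ?thesis using n by (simp add: divide_le_eq)
  qed
  finally have "bil n G a a - s * ((\<Sum>i<n. a i) * (\<Sum>j<n. a j)) \<le> \<epsilon> * (real n)\<^sup>2"
    using le unfolding split by linarith
  moreover have "bil n G a a = m\<^sup>2 * bil n G z z"
    unfolding bil_def sum_distrib_left a_def by (intro sum.cong refl) (simp add: power2_eq_square)
  moreover have "(\<Sum>i<n. a i) = m * (\<Sum>i<n. z i)" unfolding a_def by (simp add: sum_distrib_left)
  ultimately have "m\<^sup>2 * (bil n G z z - s * (\<Sum>i<n. z i)\<^sup>2) \<le> \<epsilon> * (real n)\<^sup>2"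
    by (simp add: power2_eq_square algebra_simps)
  moreover have "m\<^sup>2 * (real n * r - s * real n) \<le> m\<^sup>2 * (bil n G z z - s * (\<Sum>i<n. z i)\<^sup>2)"
  proof (intro mult_left_mono diff_mono z(3))
    have "(\<Sum>i<n. z i)\<^sup>2 \<le> real n"
      using Cauchy_Schwarz_ineq_sum[of "\<lambda>_. 1" z "{..<n}"] z(1) by simp
    then show "(\<Sum>i<n. z i)\<^sup>2 \<le> real n" .
  qed (use s in auto)
  ultimately have "r\<^sup>2 * (r - s) * (real n)\<^sup>2 \<le> \<epsilon> * (real n)\<^sup>2"
    unfolding m(2) by (simp add: power2_eq_square algebra_simps)
  then have "r\<^sup>2 * (r - s) \<le> \<epsilon>" using n by simp
  then have "r - s \<le> \<epsilon> / r\<^sup>2" using r by (simp add: le_divide_eq mult.commute)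
  then show ?thesis by simp
qed

lemma near_constant_edges:
  assumes n: "0 < n" and G: "G \<subseteq> all_pairs n" and cut: "cut_dist {..<n} G s \<le> \<epsilon>"
  shows "(s - \<epsilon>) * (real n)\<^sup>2 \<le> 2 * (\<Sum>e\<in>all_pairs n. if e \<in> G then 1 else 0)"
proof -
  have "1 / (real n)\<^sup>2 * \<bar>real (edge_count G {..<n} {..<n}) - s * real (card {..<n}) * real (card {..<n})\<bar> \<le> \<epsilon>"
    using cut_dist_bounds[OF subset_refl subset_refl, of n G s] cut by linarith
  then have "\<bar>real (edge_count G {..<n} {..<n}) - s * (real n)\<^sup>2\<bar> \<le> \<epsilon> * (real n)\<^sup>2"
    using n by (simp add: divide_le_eq power2_eq_square mult.assoc)
  then have "(s - \<epsilon>) * (real n)\<^sup>2 \<le> real (edge_count G {..<n} {..<n})"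
    by (simp add: left_diff_distrib abs_le_iff)
  also have "\<dots> = bil n G (indicator {..<n}) (indicator {..<n})"
    by (rule edge_count_eq_bil) auto
  also have "\<dots> = (\<Sum>e\<in>all_pairs n. if e \<in> G then 2 else 0)"
    unfolding bil_eq_sum_pairs[OF G]
  proof (intro sum.cong refl)
    fix e assume "e \<in> all_pairs n"
    then have "Min e < n" "Max e < n" using pair_Min_Max(2,3)[of e n] by auto
    then show "(if e \<in> G then indicator {..<n} (Min e) * indicator {..<n} (Max e)
        + indicator {..<n} (Max e) * indicator {..<n} (Min e) else 0 :: real) = (if e \<in> G then 2 else 0)"
      by simp
  qed
  also have "\<dots> = 2 * (\<Sum>e\<in>all_pairs n. if e \<in> G then 1 else 0)"
    unfolding sum_distrib_left by (intro sum.cong) auto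
  finally show ?thesis .
qed

text \<open>The derivative of \<open>h p\<close> at \<open>r\<close> is the tilt that moves the mean
  from \<open>p\<close> to \<open>r\<close>, hence the optimal Chernoff parameter in
  \<open>many_edges_upper\<close>.\<close>

lemma tilt_derivative_eq:
  assumes p: "0 < p" "p < 1" and r: "0 < r" "r < 1"
  shows "tilt p (2 * r * curv p r) = r"
proof -
  have "2 * r * curv p r = ln ((1 - p) / p / ((1 - r) / r))"
    using p r by (simp add: curv_def ln_div ln_mult)
  then have "exp (2 * r * curv p r) = (1 - p) / p / ((1 - r) / r)"
    using p r by (simp add: exp_ln)
  then have e: "p * exp (2 * r * curv p r) = (1 - p) * r / (1 - r)" using p r by (simp add: field_simps)
  have "(1 - p) * r / (1 - r) + (1 - p) = (1 - p) / (1 - r)" using r by (simp add: field_simps)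
  then show ?thesis unfolding tilt_def e using p r by simp
qed

lemma many_edges_upper:
  assumes p: "0 < p" "p < 1" and r: "0 < r" "r < 1" and pr: "p \<le> r"
  shows "prb (all_pairs n) (\<lambda>_. p) (\<lambda>G. (r - \<delta>) * (real n)\<^sup>2 \<le> 2 * (\<Sum>e\<in>all_pairs n. if e \<in> G then 1 else 0))
    \<le> exp (- ((h p r / 2 - r * curv p r * \<delta>) * (real n)\<^sup>2))"
proof -
  let ?E = "all_pairs n"
  define t where "t = 2 * r * curv p r"
  have t: "0 \<le> t" unfolding t_def using p pr r by (intro mult_nonneg_nonneg curv_nonneg) auto
  let ?Z = "p * exp t + (1 - p)"
  have Z0: "0 < ?Z" using p by (intro add_pos_pos) auto
  have lnZ: "ln ?Z = r * t - h p r"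
    using log_mgf_eq[OF p, of t] tilt_derivative_eq[OF p r] by (simp add: t_def)
  have "p * 1 \<le> p * exp t" using t p by (intro mult_left_mono) auto
  then have Z1: "0 \<le> ln ?Z" by (intro ln_ge_zero) simp
  have "prb ?E (\<lambda>_. p) (\<lambda>G. (r - \<delta>) * (real n)\<^sup>2 \<le> 2 * (\<Sum>e\<in>?E. if e \<in> G then 1 else 0))
      \<le> exp (- (t / 2 * ((r - \<delta>) * (real n)\<^sup>2))) * (\<Prod>e\<in>?E. p * exp t + (1 - p) * exp 0)"
  proof (rule chernoff[OF finite_all_pairs])
    fix G assume "(r - \<delta>) * (real n)\<^sup>2 \<le> 2 * (\<Sum>e\<in>?E. if e \<in> G then 1 else 0 :: real)"
    then have "t / 2 * ((r - \<delta>) * (real n)\<^sup>2) \<le> t / 2 * (2 * (\<Sum>e\<in>?E. if e \<in> G then 1 else 0))"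
      using t by (intro mult_left_mono) auto
    also have "\<dots> = (\<Sum>e\<in>?E. if e \<in> G then t else 0)"
      by (simp add: sum_distrib_left) (intro sum.cong, auto)
    finally show "t / 2 * ((r - \<delta>) * (real n)\<^sup>2) \<le> (\<Sum>e\<in>?E. if e \<in> G then t else 0)" .
  qed (use p in auto)
  also have "(\<Prod>e\<in>?E. p * exp t + (1 - p) * exp 0) = exp (real (n choose 2) * ln ?Z)"
    using Z0 by (simp add: card_all_pairs exp_of_nat_mult)
  also have "\<dots> \<le> exp ((real n)\<^sup>2 / 2 * ln ?Z)"
    using choose_two_le[of n] Z1 by (simp only: exp_le_cancel_iff) (intro mult_right_mono)
  also have "exp (- (t / 2 * ((r - \<delta>) * (real n)\<^sup>2))) * exp ((real n)\<^sup>2 / 2 * ln ?Z)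
      = exp (- ((h p r / 2 - r * curv p r * \<delta>) * (real n)\<^sup>2))"
    unfolding exp_add[symmetric] lnZ by (simp add: t_def algebra_simps diff_divide_distrib)
  finally show ?thesis by simp
qed

text \<open>Handles the finitely many small \<open>n\<close> in the second part. A graph in the
  event has an edge \<open>{a, b}\<close>: for \<open>s \<le> 1 / 2\<close> the cut of
  \<open>{a}\<close> and \<open>{b}\<close> has discrepancy at least 1/2, for larger
  \<open>s\<close> the loopless cut of \<open>{a}\<close> with itself.\<close>

lemma cut_dist_INF_ge:
  assumes n: "0 < n" and G: "G \<subseteq> all_pairs n" and r: "0 < r" and ev: "real n * r \<le> lambda1 n G"
  shows "1 / (2 * (real n)\<^sup>2) \<le> (INF s\<in>{0..1}. cut_dist {..<n} G s)"
proof (rule cINF_greatest)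
  fix s :: real
  obtain z where z: "real n * r \<le> bil n G z z"
    by (rule nonneg_top_vector[OF n r ev])
  have "0 < real n * r" using n r by simp
  then have "bil n G z z \<noteq> 0" using z by simp
  moreover have "bil n G z z = 0" if "\<not> (\<exists>a<n. \<exists>b<n. {a, b} \<in> G)"
    unfolding bil_def using that by (intro sum.neutral ballI) auto
  ultimately obtain a b where ab: "a < n" "b < n" "{a, b} \<in> G" by blast
  show "1 / (2 * (real n)\<^sup>2) \<le> cut_dist {..<n} G s"
  proof (cases "s \<le> 1 / 2")
    case True
    have "{(x, y). x \<in> {a} \<and> y \<in> {b} \<and> {x, y} \<in> G} = {(a, b)}" using ab by auto
    then have "edge_count G {a} {b} = 1" by (simp add: edge_count_def)
    then have "1 / (real n)\<^sup>2 * \<bar>1 - s\<bar> \<le> cut_dist {..<n} G s"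
      using cut_dist_bounds[of "{a}" n "{b}" G s] ab by simp
    moreover have "1 / (real n)\<^sup>2 * (1 / 2) \<le> 1 / (real n)\<^sup>2 * \<bar>1 - s\<bar>"
      using True by (intro mult_left_mono) auto
    ultimately show ?thesis by simp
  next
    case False
    have "{a} \<notin> G" using G by (auto simp: all_pairs_def)
      then have "{(x, y). x \<in> {a} \<and> y \<in> {a} \<and> {x, y} \<in> G} = {}" by auto
      then have "edge_count G {a} {a} = 0" unfolding edge_count_def by (simp only: card.empty)
      then have "1 / (real n)\<^sup>2 * \<bar>s\<bar> \<le> cut_dist {..<n} G s"
        using cut_dist_bounds[of "{a}" n "{a}" G s] ab by simp
      moreover have "1 / (real n)\<^sup>2 * (1 / 2) \<le> 1 / (real n)\<^sup>2 * \<bar>s\<bar>"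
        using False by (intro mult_left_mono) auto
      ultimately show ?thesis by simp
  qed
qed simp

lemma cut_dist_nonneg: "0 \<le> cut_dist {..<n :: nat} G s"
proof -
  obtain A B where "cut_dist {..<n} G s = 1 / (real n)\<^sup>2 * \<bar>real (edge_count G A B) - s * real (card A) * real (card B)\<bar>"
    by (rule cut_dist_attained)
  then show ?thesis by simp
qed

lemma near_constant_upper:
  assumes n: "0 < n" and p: "0 < p" "p < 1" and r: "0 < r" "r < 1" and pr: "p \<le> r" and \<epsilon>: "0 < \<epsilon>"
  shows "prb (all_pairs n) (\<lambda>_. p)
      (\<lambda>G. \<not> \<epsilon> < (INF s\<in>{0..1}. cut_dist {..<n} G s) \<and> real n * r \<le> lambda1 n G)
    \<le> exp (- ((h p r / 2 - r * curv p r * (2 * \<epsilon> * (1 + 1 / r\<^sup>2))) * (real n)\<^sup>2))"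
proof -
  let ?\<delta> = "2 * \<epsilon> * (1 + 1 / r\<^sup>2)"
  have "prb (all_pairs n) (\<lambda>_. p)
      (\<lambda>G. \<not> \<epsilon> < (INF s\<in>{0..1}. cut_dist {..<n} G s) \<and> real n * r \<le> lambda1 n G)
    \<le> prb (all_pairs n) (\<lambda>_. p) (\<lambda>G. (r - ?\<delta>) * (real n)\<^sup>2 \<le> 2 * (\<Sum>e\<in>all_pairs n. if e \<in> G then 1 else 0))"
  proof (rule prb_mono[OF finite_all_pairs])
    fix G assume G: "G \<subseteq> all_pairs n"
      and ev: "\<not> \<epsilon> < (INF s\<in>{0..1}. cut_dist {..<n} G s) \<and> real n * r \<le> lambda1 n G"
    \<comment> \<open>Doubling \<open>\<epsilon>\<close> gives a strict inequality and thereby some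
      \<open>s\<close>, without asking whether the infimum is attained.\<close>
    have "(INF s\<in>{0..1}. cut_dist {..<n} G s) < 2 * \<epsilon>" using ev \<epsilon> by linarith
    then obtain s where s: "0 \<le> s" "s \<le> 1" "cut_dist {..<n} G s < 2 * \<epsilon>"
      by (subst (asm) cInf_less_iff) (auto intro!: bdd_belowI2[of _ 0] cut_dist_nonneg)
    have "r \<le> s + 2 * \<epsilon> / r\<^sup>2"
      using near_constant_density[OF n r(1) _ s(1), of G "2 * \<epsilon>"] ev s(3) by simp
    then have "r - ?\<delta> \<le> s - 2 * \<epsilon>" by (simp add: algebra_simps)
    then have "(r - ?\<delta>) * (real n)\<^sup>2 \<le> (s - 2 * \<epsilon>) * (real n)\<^sup>2" by (intro mult_right_mono) auto
    also have "\<dots> \<le> 2 * (\<Sum>e\<in>all_pairs n. if e \<in> G then 1 else 0)"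
      using near_constant_edges[OF n G, of s "2 * \<epsilon>"] s(3) by simp
    finally show "(r - ?\<delta>) * (real n)\<^sup>2 \<le> 2 * (\<Sum>e\<in>all_pairs n. if e \<in> G then 1 else 0)" .
  qed (use p in auto)
  also have "\<dots> \<le> exp (- ((h p r / 2 - r * curv p r * ?\<delta>) * (real n)\<^sup>2))"
    by (rule many_edges_upper[OF p r pr])
  finally show ?thesis .
qed

section \<open>Conditional probabilities\<close>

lemma normalized_log_tendsto:
  assumes "rate p r \<longlonglongrightarrow> \<l>"
  shows "(\<lambda>n. 1 / real (n choose 2) * ln (eig_prob p r n)) \<longlonglongrightarrow> - (2 * \<l>)"
proof -
  have "(\<lambda>n. (real n)\<^sup>2 / real (n choose 2)) \<longlonglongrightarrow> 2" unfolding real_choose_two by real_asymp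
  then have "(\<lambda>n. - ((real n)\<^sup>2 / real (n choose 2) * rate p r n)) \<longlonglongrightarrow> - (2 * \<l>)"
    using assms by (intro tendsto_intros)
  moreover have "\<forall>\<^sub>F n in sequentially. - ((real n)\<^sup>2 / real (n choose 2) * rate p r n)
      = 1 / real (n choose 2) * ln (eig_prob p r n)"
    using eventually_gt_at_top[of 0] by eventually_elim (simp add: rate_def)
  ultimately show ?thesis by (rule Lim_transform_eventually)
qed

lemma conditional_probability_ge:
  assumes p: "0 < p" "p < 1" and P: "0 < eig_prob p r n"
    and le: "prb (all_pairs n) (\<lambda>_. p) (\<lambda>G. \<not> R G \<and> real n * r \<le> lambda1 n G) \<le> \<beta> * eig_prob p r n"
  shows "1 - \<beta> \<le> \<P>(G in erdos_renyi n p. R G \<bar> lambda1 n G \<ge> real n * r)"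
proof -
  let ?P = "\<lambda>Q. prb (all_pairs n) (\<lambda>_. p) Q"
  have pe: "\<P>(G in erdos_renyi n p. Q G) = ?P Q" for Q using p by (intro prob_erdos_renyi) auto
  have eq: "\<P>(G in erdos_renyi n p. R G \<bar> lambda1 n G \<ge> real n * r)
      = ?P (\<lambda>G. R G \<and> real n * r \<le> lambda1 n G) / eig_prob p r n"
    unfolding cond_prob_def pe eig_prob_def ..
  have "eig_prob p r n = ?P (\<lambda>G. R G \<and> real n * r \<le> lambda1 n G) + ?P (\<lambda>G. \<not> R G \<and> real n * r \<le> lambda1 n G)"
    unfolding eig_prob_def by (rule prb_split[OF finite_all_pairs])
  then have "(1 - \<beta>) * eig_prob p r n \<le> ?P (\<lambda>G. R G \<and> real n * r \<le> lambda1 n G)"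
    using le by (simp add: left_diff_distrib)
  then show ?thesis unfolding eq using P by (simp add: le_divide_eq)
qed

lemma eig_prob_eq_exp_rate:
  assumes "0 < n" "0 < eig_prob p r n"
  shows "eig_prob p r n = exp (- (rate p r n * (real n)\<^sup>2))"
  using assms by (simp add: rate_def)

text \<open>A bound for large \<open>n\<close> is the right form: the cut of a single vertex with
  itself shows that \<open>cut_dist\<close> is at least \<open>r / n^2\<close>, so for fixed
  \<open>n\<close> and small \<open>\<epsilon>\<close> no graph is close to
  \<open>r\<close>.\<close>

lemma concentration_above_threshold:
  assumes p: "0 < p" "p < 1" and r: "0 < r" "r < 1" and pr: "p \<le> r" and t: "threshold r \<le> p" and \<epsilon>: "0 < \<epsilon>"
    and lim: "rate p r \<longlonglongrightarrow> h p r / 2"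
  shows "\<exists>C>0. \<forall>\<^sub>F n in sequentially.
    1 - exp (- C * (real n)\<^sup>2) \<le> \<P>(G in erdos_renyi n p. cut_dist {..<n} G r < \<epsilon> \<bar> lambda1 n G \<ge> real n * r)"
proof -
  define \<eta> where "\<eta> = \<epsilon> / 4"
  have \<eta>: "0 < \<eta>" using \<epsilon> by (simp add: \<eta>_def)
  obtain K K' where K: "0 \<le> K" and dev: "tilt_close p r \<eta> K K'"
    using tilt_deviation_bound[OF p r pr t \<eta>] by blast
  define \<theta> where "\<theta> = min (min (1 / 2) (\<epsilon> / 16)) (1 / (2 * (K + 1)))"
  have \<theta>: "0 < \<theta>" "\<theta> \<le> 1 / 2" "\<theta> \<le> \<epsilon> / 16" "\<theta> \<le> 1 / (2 * (K + 1))"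
    using \<epsilon> K unfolding \<theta>_def by (auto intro: min.coboundedI1 min.coboundedI2)
  have \<theta>K: "2 * \<theta> * K \<le> 1"
  proof -
    have "2 * \<theta> * K \<le> 2 * \<theta> * (K + 1)" using \<theta> by simp
    also have "\<dots> \<le> 1" using \<theta>(4) K by (simp add: pos_le_divide_eq mult_ac)
    finally show ?thesis .
  qed
  define C where "C = \<theta> * \<epsilon> / 4"
  have C: "0 < C" using \<theta> \<epsilon> by (simp add: C_def)
  define C2 where "C2 = 2 * curv p r * r + 6 * \<theta> * \<bar>K'\<bar> + \<theta>"
  \<comment> \<open>Since \<open>\<eta> = \<epsilon> / 4\<close> and
    \<open>\<theta> \<le> \<epsilon> / 16\<close>, at least half of the gain
    \<open>\<theta> * \<epsilon> = 4 * C\<close> remains. One \<open>C\<close> absorbs the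
    lower-order terms, the other is the final exponent.\<close>
  have small: "\<theta> * \<eta> + 2 * \<theta>\<^sup>2 - \<theta> * \<epsilon> \<le> - (2 * C)"
  proof -
    have "\<theta> * \<theta> \<le> \<theta> * (\<epsilon> / 16)" using \<theta> by (intro mult_left_mono) auto
    moreover have "0 < \<theta> * \<epsilon>" using \<theta> \<epsilon> by simp
    ultimately show ?thesis unfolding \<eta>_def C_def power2_eq_square by linarith
  qed
  have "(\<lambda>n. (ln 2 + real n * ln 4 + real n * ln ((real n)\<^sup>2 + 1) + C2 * real n) / (real n)\<^sup>2
      + (rate p r n - real (n choose 2) / (real n)\<^sup>2 * h p r)) \<longlonglongrightarrow> 0 + (h p r / 2 - 1 / 2 * h p r)"
  proof (intro tendsto_add tendsto_diff lim tendsto_mult tendsto_const)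
    show "(\<lambda>n. (ln 2 + real n * ln 4 + real n * ln ((real n)\<^sup>2 + 1) + C2 * real n) / (real n)\<^sup>2) \<longlonglongrightarrow> 0"
      by real_asymp
    show "(\<lambda>n. real (n choose 2) / (real n)\<^sup>2) \<longlonglongrightarrow> 1 / 2" unfolding real_choose_two by real_asymp
  qed
  then have ev: "\<forall>\<^sub>F n in sequentially. (ln 2 + real n * ln 4 + real n * ln ((real n)\<^sup>2 + 1) + C2 * real n) / (real n)\<^sup>2
      + (rate p r n - real (n choose 2) / (real n)\<^sup>2 * h p r) < C"
    using C by (intro order_tendstoD) auto
  show ?thesis
  proof (intro exI[of _ C] conjI C)
    show "\<forall>\<^sub>F n in sequentially. 1 - exp (- C * (real n)\<^sup>2)
        \<le> \<P>(G in erdos_renyi n p. cut_dist {..<n} G r < \<epsilon> \<bar> lambda1 n G \<ge> real n * r)"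
      using ev rate_bounded[OF p r(2)] eventually_gt_at_top[of 0]
    proof eventually_elim
      case (elim n)
      have n: "0 < real n" using elim by simp
      have pos: "0 < eig_prob p r n" using elim by blast
      define N where "N = real (n choose 2)"
      define l where "l = ln 2 + real n * ln 4 + real n * ln ((real n)\<^sup>2 + 1)"
      have pre: "2 * 4 ^ n * ((real n)\<^sup>2 + 1) ^ n = exp l"
      proof -
        have "0 < (real n)\<^sup>2 + 1" by (intro add_nonneg_pos) auto
        then show ?thesis by (simp add: l_def exp_add exp_of_nat_mult)
      qed
      have "prb (all_pairs n) (\<lambda>_. p) (\<lambda>G. \<not> cut_dist {..<n} G r < \<epsilon> \<and> real n * r \<le> lambda1 n G)
          \<le> 2 * 4 ^ n * ((real n)\<^sup>2 + 1) ^ n * exp (- N * h p r + (2 * curv p r * r + 6 * \<theta> * \<bar>K'\<bar>) * real n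
            + (\<theta> * \<eta> + 2 * \<theta>\<^sup>2) * (real n)\<^sup>2 - \<theta> * (\<epsilon> * (real n)\<^sup>2 - real n))"
        unfolding not_less N_def
        using \<theta> \<theta>K \<eta> by (intro joint_upper[OF elim(3) p r pr t _ _ _ dev]) auto
      also have "\<dots> = exp (l - N * h p r + C2 * real n + (\<theta> * \<eta> + 2 * \<theta>\<^sup>2 - \<theta> * \<epsilon>) * (real n)\<^sup>2)"
        unfolding pre exp_add[symmetric] by (simp add: C2_def algebra_simps)
      also have "\<dots> \<le> exp (- C * (real n)\<^sup>2 + - (rate p r n * (real n)\<^sup>2))"
      proof (simp only: exp_le_cancel_iff)
        have "(\<theta> * \<eta> + 2 * \<theta>\<^sup>2 - \<theta> * \<epsilon>) * (real n)\<^sup>2 \<le> - (2 * C) * (real n)\<^sup>2"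
          using small by (intro mult_right_mono) auto
        moreover have "l + C2 * real n + rate p r n * (real n)\<^sup>2 - N * h p r \<le> C * (real n)\<^sup>2"
        proof -
          have "((l + C2 * real n) / (real n)\<^sup>2 + (rate p r n - N / (real n)\<^sup>2 * h p r)) * (real n)\<^sup>2 \<le> C * (real n)\<^sup>2"
            using elim(1) unfolding l_def N_def by (intro mult_right_mono) auto
          moreover have "((l + C2 * real n) / (real n)\<^sup>2 + (rate p r n - N / (real n)\<^sup>2 * h p r)) * (real n)\<^sup>2
              = l + C2 * real n + rate p r n * (real n)\<^sup>2 - N * h p r"
          proof -
            have "(X / D + (a - b / D * H)) * D = X + a * D - b * H" if "D \<noteq> 0" for X D a b H :: real
              using that by (simp add: distrib_right left_diff_distrib)
            then show ?thesis using n by simp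
          qed
          ultimately show ?thesis by simp
        qed
        ultimately show "l - N * h p r + C2 * real n + (\<theta> * \<eta> + 2 * \<theta>\<^sup>2 - \<theta> * \<epsilon>) * (real n)\<^sup>2
            \<le> - C * (real n)\<^sup>2 + - (rate p r n * (real n)\<^sup>2)"
          by linarith
      qed
      also have "\<dots> = exp (- C * (real n)\<^sup>2) * eig_prob p r n"
        unfolding exp_add eig_prob_eq_exp_rate[OF elim(3) pos] ..
      finally show ?case by (rule conditional_probability_ge[OF p pos])
    qed
  qed
qed

text \<open>Closeness to a constant costs nearly \<open>h p r / 2\<close> per \<open>n^2\<close>,
  the eigenvalue event only \<open>\<l>\<close>, so the ratio of the probabilities is exponentially
  small.\<close>

lemma symmetry_breaking_below_threshold:
  assumes p: "0 < p" "p < 1" and r: "0 < r" "r < 1" and pr: "p \<le> r"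
    and lim: "rate p r \<longlonglongrightarrow> \<l>" and gap: "2 * \<l> < h p r"
  shows "\<exists>\<epsilon>>0. \<exists>C>0. \<forall>n. 0 < \<P>(G in erdos_renyi n p. lambda1 n G \<ge> real n * r) \<longrightarrow>
    1 - exp (- C * (real n)\<^sup>2)
      \<le> \<P>(G in erdos_renyi n p. (INF s\<in>{0..1}. cut_dist {..<n} G s) > \<epsilon> \<bar> lambda1 n G \<ge> real n * r)"
proof -
  \<comment> \<open>A third of the gap in the exponents each for the convergence of the rate, for
    the final exponent and for the loss \<open>\<gamma>\<close> caused by
    \<open>\<epsilon>\<close>.\<close>
  define C where "C = (h p r / 2 - \<l>) / 3"
  have C: "0 < C" "\<l> + C < h p r / 2 - C" using gap by (auto simp: C_def field_simps)
  have "\<forall>\<^sub>F n in sequentially. rate p r n < \<l> + C" using C by (intro order_tendstoD[OF lim]) auto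
  then have "\<forall>\<^sub>F n in sequentially. 0 < n \<and> rate p r n < \<l> + C"
    using eventually_gt_at_top[of 0] by eventually_elim auto
  then obtain n1 where n1: "\<And>n. n1 \<le> n \<Longrightarrow> 0 < n \<and> rate p r n < \<l> + C"
    unfolding eventually_sequentially by blast
  define c where "c = r * curv p r * (2 * (1 + 1 / r\<^sup>2))"
  have c: "0 \<le> c" unfolding c_def using p pr r by (intro mult_nonneg_nonneg curv_nonneg add_nonneg_nonneg) auto
  define \<gamma> where "\<gamma> = h p r / 2 - C - (\<l> + C)"
  have \<gamma>: "0 < \<gamma>" using C by (simp add: \<gamma>_def)
  \<comment> \<open>The second bound keeps \<open>\<epsilon>\<close> below the value of
    \<open>cut_dist_INF_ge\<close> for every positive \<open>n < n1\<close>.\<close>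
  define \<epsilon> where "\<epsilon> = min (\<gamma> / (c + 1)) (1 / (4 * (real n1 + 1)\<^sup>2))"
  have \<epsilon>: "0 < \<epsilon>" "\<epsilon> \<le> 1 / (4 * (real n1 + 1)\<^sup>2)" "c * \<epsilon> \<le> \<gamma>"
  proof -
    show "0 < \<epsilon>" using \<gamma> c by (simp add: \<epsilon>_def)
    show "\<epsilon> \<le> 1 / (4 * (real n1 + 1)\<^sup>2)" by (simp add: \<epsilon>_def)
    have "\<epsilon> \<le> \<gamma> / (c + 1)" by (simp add: \<epsilon>_def)
    then have "\<epsilon> * (c + 1) \<le> \<gamma>" using c by (simp add: pos_le_divide_eq)
    moreover have "0 \<le> \<epsilon>" using \<open>0 < \<epsilon>\<close> by simp
    ultimately show "c * \<epsilon> \<le> \<gamma>" by (simp add: algebra_simps)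
  qed
  let ?I = "\<lambda>n G. INF s\<in>{0..1}. cut_dist {..<n} G s"
  have main: "1 - exp (- C * (real n)\<^sup>2) \<le> \<P>(G in erdos_renyi n p. ?I n G > \<epsilon> \<bar> lambda1 n G \<ge> real n * r)"
    if pos: "0 < eig_prob p r n" for n
  proof -
    consider "n = 0" | "0 < n" "n < n1" | "n1 \<le> n" by linarith
    then show ?thesis
    proof cases
      \<comment> \<open>Here the claimed bound is \<open>1 - exp 0 = 0\<close>.\<close>
      case 1
      then show ?thesis by (simp add: cond_prob_def)
    next
      case 2
      have "1 - 0 \<le> \<P>(G in erdos_renyi n p. ?I n G > \<epsilon> \<bar> lambda1 n G \<ge> real n * r)"
      proof (rule conditional_probability_ge[OF p pos])
        have "\<epsilon> < ?I n G" if "G \<subseteq> all_pairs n" "real n * r \<le> lambda1 n G" for G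
        proof -
          have "(real n)\<^sup>2 \<le> (real n1 + 1)\<^sup>2" using 2 by (intro power_mono) auto
          moreover have "0 < (real n1 + 1)\<^sup>2" by (intro zero_less_power) simp
          ultimately have "2 * (real n)\<^sup>2 < 4 * (real n1 + 1)\<^sup>2" by linarith
          then have "1 / (4 * (real n1 + 1)\<^sup>2) < 1 / (2 * (real n)\<^sup>2)"
            using 2 by (intro divide_strict_left_mono) auto
          then show ?thesis using \<epsilon>(2) cut_dist_INF_ge[OF 2(1) that(1) r(1) that(2)] by linarith
        qed
        then have "{G. G \<subseteq> all_pairs n \<and> \<not> \<epsilon> < ?I n G \<and> real n * r \<le> lambda1 n G} = {}" by blast
        then show "prb (all_pairs n) (\<lambda>_. p) (\<lambda>G. \<not> \<epsilon> < ?I n G \<and> real n * r \<le> lambda1 n G) \<le> 0 * eig_prob p r n"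
          unfolding prb_def by (simp only: sum.empty mult_zero_left)
      qed
      moreover have "0 \<le> exp (- C * (real n)\<^sup>2)" by simp
      ultimately show ?thesis by linarith
    next
      case 3
      then have n: "0 < n" and rt: "rate p r n < \<l> + C" using n1 by auto
      have "prb (all_pairs n) (\<lambda>_. p) (\<lambda>G. \<not> \<epsilon> < ?I n G \<and> real n * r \<le> lambda1 n G)
          \<le> exp (- ((h p r / 2 - r * curv p r * (2 * \<epsilon> * (1 + 1 / r\<^sup>2))) * (real n)\<^sup>2))"
        by (rule near_constant_upper[OF n p r pr \<epsilon>(1)])
      also have "r * curv p r * (2 * \<epsilon> * (1 + 1 / r\<^sup>2)) = c * \<epsilon>" by (simp add: c_def)
      also have "exp (- ((h p r / 2 - c * \<epsilon>) * (real n)\<^sup>2)) \<le> exp (- ((C + rate p r n) * (real n)\<^sup>2))"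
        using \<epsilon>(3) rt by (simp only: exp_le_cancel_iff neg_le_iff_le) (intro mult_right_mono, auto simp: \<gamma>_def)
      also have "\<dots> = exp (- C * (real n)\<^sup>2) * eig_prob p r n"
        unfolding eig_prob_eq_exp_rate[OF n pos] exp_add[symmetric] by (simp add: algebra_simps)
      finally show ?thesis by (rule conditional_probability_ge[OF p pos])
    qed
  qed
  have pe: "\<P>(G in erdos_renyi n p. lambda1 n G \<ge> real n * r) = eig_prob p r n" for n
    unfolding eig_prob_def using p by (intro prob_erdos_renyi) auto
  show ?thesis
    unfolding pe using \<epsilon>(1) C(1) main by blast
qed

theorem theorem1p2:
  fixes p r :: real
  assumes "0 < p" and "p \<le> r" and "r < 1"
  shows
    "(p \<ge> threshold r \<longrightarrow>
        (\<lambda>n. 1 / real (n choose 2) *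
               ln (\<P>(G in erdos_renyi n p. lambda1 n G \<ge> real n * r))) \<longlonglongrightarrow> - h p r
      \<and> (\<forall>\<epsilon>>0. \<exists>C>0. \<forall>\<^sub>F n in sequentially.
            \<P>(G in erdos_renyi n p. cut_dist {..<n} G r < \<epsilon> \<bar> lambda1 n G \<ge> real n * r)
              \<ge> 1 - exp (- C * (real n)\<^sup>2)))
   \<and> (p < threshold r \<longrightarrow>
        (\<exists>L. (\<lambda>n. 1 / real (n choose 2) *
                 ln (\<P>(G in erdos_renyi n p. lambda1 n G \<ge> real n * r))) \<longlonglongrightarrow> L
             \<and> L > - h p r)
      \<and> (\<exists>\<epsilon>>0. \<exists>C>0. \<forall>n. \<P>(G in erdos_renyi n p. lambda1 n G \<ge> real n * r) > 0 \<longrightarrow>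
            \<P>(G in erdos_renyi n p. (INF s\<in>{0..1}. cut_dist {..<n} G s) > \<epsilon>
                \<bar> lambda1 n G \<ge> real n * r)
              \<ge> 1 - exp (- C * (real n)\<^sup>2)))"
proof -
  have p: "0 < p" "p < 1" and r: "0 < r" "r < 1" using assms by auto
  obtain \<l> where lim: "rate p r \<longlonglongrightarrow> \<l>"
    using rate_convergent[OF p r] by (auto simp: convergent_def)
  have pe: "\<P>(G in erdos_renyi n p. lambda1 n G \<ge> real n * r) = eig_prob p r n" for n
    unfolding eig_prob_def using p by (intro prob_erdos_renyi) auto
  show ?thesis
  proof (intro conjI impI allI)
    assume t: "p \<ge> threshold r"
    have l: "\<l> = h p r / 2" by (rule rate_limit_above_threshold[OF p r assms(2) t lim])
    show "(\<lambda>n. 1 / real (n choose 2) * ln (\<P>(G in erdos_renyi n p. lambda1 n G \<ge> real n * r))) \<longlonglongrightarrow> - h p r"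
      unfolding pe using normalized_log_tendsto[OF lim] l by simp
    fix \<epsilon> :: real assume "0 < \<epsilon>"
    then show "\<exists>C>0. \<forall>\<^sub>F n in sequentially.
        \<P>(G in erdos_renyi n p. cut_dist {..<n} G r < \<epsilon> \<bar> lambda1 n G \<ge> real n * r) \<ge> 1 - exp (- C * (real n)\<^sup>2)"
      using concentration_above_threshold[OF p r assms(2) t] lim l by simp
  next
    assume t: "p < threshold r"
    have l: "2 * \<l> < h p r" by (rule rate_limit_below_threshold[OF p r assms(2) t lim])
    show "\<exists>L. (\<lambda>n. 1 / real (n choose 2) * ln (\<P>(G in erdos_renyi n p. lambda1 n G \<ge> real n * r))) \<longlonglongrightarrow> L
        \<and> L > - h p r"
      unfolding pe using normalized_log_tendsto[OF lim] l by (intro exI[of _ "- (2 * \<l>)"]) auto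
    show "\<exists>\<epsilon>>0. \<exists>C>0. \<forall>n. \<P>(G in erdos_renyi n p. lambda1 n G \<ge> real n * r) > 0 \<longrightarrow>
        \<P>(G in erdos_renyi n p. (INF s\<in>{0..1}. cut_dist {..<n} G s) > \<epsilon> \<bar> lambda1 n G \<ge> real n * r)
          \<ge> 1 - exp (- C * (real n)\<^sup>2)"
      by (rule symmetry_breaking_below_threshold[OF p r assms(2) lim l])
  qed
qed

end
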